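(* Let $L$ and $\mu$ be as in the context, and suppose that the following amalgamation assumption holds: (i) if $A\leq B_1,B_2\in\mathcal{C}_\mu(L)$ and the free amalgam of $B_1$ and $B_2$ over $A$ is not in $\mathcal{C}_\mu(L)$, then there exist $Y\subseteq A$ and minimally simply algebraic extensions $Y\leq Z_i\subseteq B_i$ ($i=1,2$) which are isomorphic over $Y$ and satisfy $Z_i\setminus Y\subseteq B_i\setminus A$; and (ii) $(\mathcal{C}_\mu(L),\leq)$ is an amalgamation class. Suppose further that $\mu(Y,Z)\geq 2$ for all minimally simply algebraic $Y\leq Z\in\mathcal{C}_0(L)$ with $\delta(Y)\geq 2$, and $\mu(Y,Z)\geq 1$ for those with $\delta(Y)=1$. Let $\mathcal{M}_\mu(L)$ be the generic structure of $(\mathcal{C}_\mu(L),\leq)$ and $\mathcal{M}_0(L)$ the generic structure of $(\mathcal{C}_0(L),\leq)$. Suppose that $X\leq\mathcal{M}_\mu(L)$ is finite and ${\rm cl}_{\mathcal{M}_\mu(L)}(X)$ is infinite. Then the localization $G_X(\mathcal{M}_\mu(L))$ and $G(\mathcal{M}_0(L))$ are isomorphic geometries. In particular, $G(\mathcal{M}_\mu(L))$ and $G(\mathcal{M}_0(L))$ are locally isomorphic (i.e. some localization of the former over a finite set is isomorphic to the latter).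
   Context: $L$ consists of relation symbols $(R_i:i\in I)$, $I\neq\emptyset$, $R_i$ of arity $n_i\geq 3$, with only finitely many symbols of each arity. In an $L$-structure $A$, $R_i^A$ is a set of $n_i$-element subsets of $A$; substructures are induced. For finite $A$, $\delta(A)=|A|-\sum_i|R_i^A|$. $\mathcal{C}_0(L)$: finite $L$-structures all of whose subsets have $\delta\geq0$. For $A\subseteq B\in\mathcal{C}_0(L)$, $A\leq B$ (self-sufficient) means $\delta(A)\leq\delta(B')$ whenever $A\subseteq B'\subseteq B$. $\bar{\mathcal{C}}_0(L)$: $L$-structures all of whose finite substructures lie in $\mathcal{C}_0(L)$; there $A\leq B$ means $\delta(C)\geq\delta(C\cap A)$ for all finite $C\subseteq B$. For finite $A\subseteq B\in\bar{\mathcal{C}}_0(L)$, $d_B(A)=\min\{\delta(A'):A\subseteq A'\subseteq B, A'\text{ finite}\}$; ${\rm cl}_B(A)=\{c: d_B(A\cup\{c\})=d_B(A)\}$, extended to infinite $A$ as the union over finite subsets. $(B,{\rm cl}_B)$ is a pregeometry with geometry $G(B)$ (points ${\rm cl}_B(x)\setminus{\rm cl}_B(\emptyset)$, $x\notin{\rm cl}_B(\emptyset)$, closure induced). For $Y\subseteq B$, the localization over $Y$ is the pregeometry with closure $Z\mapsto{\rm cl}_B(Y\cup Z)$, and $G_Y(B)$ is its associated geometry. Free amalgam of $B_1,B_2$ over a common substructure $A$: the disjoint union of $B_1,B_2$ over $A$ with $R_i=R_i^{B_1}\cup R_i^{B_2}$. For $Y\leq Z\in\mathcal{C}_0(L)$,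 $Y\neq Z$: algebraic if $\delta(Y)=\delta(Z)$; simply algebraic if also $\delta(Z')>\delta(Y)$ for $Y\subsetneq Z'\subsetneq Z$; minimally simply algebraic (msa) if also $Y'\subseteq Y'\cup(Z\setminus Y)$ is not simply algebraic for every $Y'\subsetneq Y$. $\mu$ is a function from isomorphism types of msa extensions in $\mathcal{C}_0(L)$ to the non-negative integers. $\mathcal{C}_\mu(L)$ is the class of $A\in\mathcal{C}_0(L)$ such that for every msa $Y\leq Z$ in $\mathcal{C}_0(L)$, $A$ does not contain a copy $Y_0$ of $Y$ together with $\mu(Y,Z)+1$ substructures $Z_1,\dots$ each isomorphic to $Z$ over $Y_0$ (via isomorphisms extending a fixed identification of $Y$ with $Y_0$) with the sets $Z_j\setminus Y_0$ pairwise disjoint. Amalgamation class $(\mathcal{A},\leq)$, $\mathcal{A}\subseteq\mathcal{C}_0(L)$: closed under self-sufficient substructures, and if $A\leq B_1,B_2\in\mathcal{A}$ there are $C\in\mathcal{A}$ and embeddings $f_i:B_i\to C$ with $f_i(B_i)\leq C$ agreeing on $A$. Its generic structure is the unique-up-to-isomorphism countable $\mathcal{M}\in\bar{\mathcal{C}}_0(L)$ that is a union of a chain $A_0\leq A_1\leq\cdots$ of members of $\mathcal{A}$ and such that whenever finite $A\leq\mathcal{M}$ and $A\leq B\in\mathcal{A}$, there is an embedding $g:B\to\mathcal{M}$ over $A$ with $g(B)\leq\mathcal{M}$. $(\mathcal{C}_0(L),\leq)$ is an amalgamation class. *)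

theory Defs
  imports Main "HOL-Library.Countable_Set" "HOL-Library.Disjoint_Sets"
begin

section \<open>Languages and structures\<close>

text \<open>
  A language is given by its arity function on a type of relation symbols; the index set of the
  symbols is the whole (automatically nonempty) type.
\<close>

definition language :: "('i \<Rightarrow> nat) \<Rightarrow> bool" where
  "language ar \<longleftrightarrow> (\<forall>i. ar i \<ge> 3) \<and> (\<forall>k. finite {i. ar i = k})"

record ('i, 'a) lstruct =
  univ :: "'a set"
  rel :: "'i \<Rightarrow> 'a set set"

definition is_lstruct :: "('i \<Rightarrow> nat) \<Rightarrow> ('i, 'a) lstruct \<Rightarrow> bool" where
  "is_lstruct ar A \<longleftrightarrow> (\<forall>i. \<forall>e \<in> rel A i. e \<subseteq> univ A \<and> finite e \<and> card e = ar i)"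

definition restr :: "('i, 'a) lstruct \<Rightarrow> 'a set \<Rightarrow> ('i, 'a) lstruct" where
  "restr A S = \<lparr>univ = S, rel = (\<lambda>i. {e \<in> rel A i. e \<subseteq> S})\<rparr>"

definition embedding :: "('a \<Rightarrow> 'b) \<Rightarrow> ('i, 'a) lstruct \<Rightarrow> ('i, 'b) lstruct \<Rightarrow> bool" where
  "embedding f A B \<longleftrightarrow> inj_on f (univ A) \<and> f ` univ A \<subseteq> univ B \<and>
     (\<forall>i. \<forall>e \<subseteq> univ A. e \<in> rel A i \<longleftrightarrow> f ` e \<in> rel B i)"

definition isomorphism :: "('a \<Rightarrow> 'b) \<Rightarrow> ('i, 'a) lstruct \<Rightarrow> ('i, 'b) lstruct \<Rightarrow> bool" where
  "isomorphism f A B \<longleftrightarrow> embedding f A B \<and> f ` univ A = univ B"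

section \<open>Predimension and self-sufficiency\<close>

text \<open>
  For a finite structure over a language with finitely many symbols of each arity, only finitely
  many relations are nonempty, so the sum below is the sum over all symbols.
\<close>

definition delta :: "('i, 'a) lstruct \<Rightarrow> int" where
  "delta A = int (card (univ A)) - (\<Sum>i | rel A i \<noteq> {}. int (card (rel A i)))"

definition C0 :: "('i \<Rightarrow> nat) \<Rightarrow> ('i, 'a) lstruct set" where
  "C0 ar = {A. is_lstruct ar A \<and> finite (univ A) \<and> (\<forall>S \<subseteq> univ A. 0 \<le> delta (restr A S))}"

definition C0bar :: "('i \<Rightarrow> nat) \<Rightarrow> ('i, 'a) lstruct set" where
  "C0bar ar = {A. is_lstruct ar A \<and> (\<forall>S \<subseteq> univ A. finite S \<longrightarrow> restr A S \<in> C0 ar)}"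

text \<open>
  Self-sufficiency of a subset (carrying the induced structure): \<open>ss_fin\<close> is the notion inside
  members of \<^const>\<open>C0\<close>, \<open>ss\<close> the one inside members of \<^const>\<open>C0bar\<close>.
\<close>

definition ss_fin :: "'a set \<Rightarrow> ('i, 'a) lstruct \<Rightarrow> bool" where
  "ss_fin A B \<longleftrightarrow> A \<subseteq> univ B \<and>
     (\<forall>B'. A \<subseteq> B' \<and> B' \<subseteq> univ B \<longrightarrow> delta (restr B A) \<le> delta (restr B B'))"

definition ss :: "'a set \<Rightarrow> ('i, 'a) lstruct \<Rightarrow> bool" where
  "ss A B \<longleftrightarrow> A \<subseteq> univ B \<and>
     (\<forall>C \<subseteq> univ B. finite C \<longrightarrow> delta (restr B (C \<inter> A)) \<le> delta (restr B C))"

section \<open>Dimension, closure and geometries\<close>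

definition dim :: "('i, 'a) lstruct \<Rightarrow> 'a set \<Rightarrow> int" where
  "dim B A = (LEAST k. \<exists>A'. A \<subseteq> A' \<and> A' \<subseteq> univ B \<and> finite A' \<and> k = delta (restr B A'))"

definition cl_fin :: "('i, 'a) lstruct \<Rightarrow> 'a set \<Rightarrow> 'a set" where
  "cl_fin B A = {c \<in> univ B. dim B (A \<union> {c}) = dim B A}"

definition cl :: "('i, 'a) lstruct \<Rightarrow> 'a set \<Rightarrow> 'a set" where
  "cl B A = (if finite A then cl_fin B A else (\<Union>F \<in> {F. finite F \<and> F \<subseteq> A}. cl_fin B F))"

record 'a pregeom =
  pts :: "'a set"
  clo :: "'a set \<Rightarrow> 'a set"

definition pregeom_of :: "('i, 'a) lstruct \<Rightarrow> 'a pregeom" where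
  "pregeom_of B = \<lparr>pts = univ B, clo = cl B\<rparr>"

definition localization :: "'a pregeom \<Rightarrow> 'a set \<Rightarrow> 'a pregeom" where
  "localization P Y = \<lparr>pts = pts P, clo = (\<lambda>Z. clo P (Y \<union> Z))\<rparr>"

definition geometry_of :: "'a pregeom \<Rightarrow> 'a set pregeom" where
  "geometry_of P =
     \<lparr>pts = {clo P {x} - clo P {} | x. x \<in> pts P \<and> x \<notin> clo P {}},
      clo = (\<lambda>S. {clo P {x} - clo P {} | x. x \<in> clo P (\<Union>S) \<and> x \<notin> clo P {}})\<rparr>"

definition geom :: "('i, 'a) lstruct \<Rightarrow> 'a set pregeom" where
  "geom B = geometry_of (pregeom_of B)"

definition geom_over :: "('i, 'a) lstruct \<Rightarrow> 'a set \<Rightarrow> 'a set pregeom" where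
  "geom_over B Y = geometry_of (localization (pregeom_of B) Y)"

definition geom_iso :: "'a pregeom \<Rightarrow> 'b pregeom \<Rightarrow> bool" where
  "geom_iso G H \<longleftrightarrow>
     (\<exists>f. bij_betw f (pts G) (pts H) \<and> (\<forall>S \<subseteq> pts G. f ` clo G S = clo H (f ` S)))"

section \<open>Free amalgams\<close>

text \<open>
  \<open>A\<close> is a set of points common to \<open>B1\<close> and \<open>B2\<close> on which both induce the same structure.  The
  free amalgam is built on a sum type, so \<open>B1\<close> and \<open>B2\<close> may overlap outside \<open>A\<close>: points of \<open>A\<close>
  are identified (tagged \<^const>\<open>Inl\<close>), all other points are kept apart.
\<close>

definition common_sub :: "'a set \<Rightarrow> ('i, 'a) lstruct \<Rightarrow> ('i, 'a) lstruct \<Rightarrow> bool" where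
  "common_sub A B1 B2 \<longleftrightarrow> A \<subseteq> univ B1 \<and> A \<subseteq> univ B2 \<and> restr B1 A = restr B2 A"

definition amalg_inr :: "'a set \<Rightarrow> 'a \<Rightarrow> 'a + 'a" where
  "amalg_inr A x = (if x \<in> A then Inl x else Inr x)"

definition free_amalgam ::
  "'a set \<Rightarrow> ('i, 'a) lstruct \<Rightarrow> ('i, 'a) lstruct \<Rightarrow> ('i, 'a + 'a) lstruct" where
  "free_amalgam A B1 B2 =
     \<lparr>univ = Inl ` univ B1 \<union> amalg_inr A ` univ B2,
      rel = (\<lambda>i. (\<lambda>e. Inl ` e) ` rel B1 i \<union> (\<lambda>e. amalg_inr A ` e) ` rel B2 i)\<rparr>"

section \<open>Minimally simply algebraic extensions\<close>

definition algebraic :: "('i \<Rightarrow> nat) \<Rightarrow> 'a set \<Rightarrow> ('i, 'a) lstruct \<Rightarrow> bool" where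
  "algebraic ar Y Z \<longleftrightarrow> Z \<in> C0 ar \<and> ss_fin Y Z \<and> Y \<noteq> univ Z \<and> delta (restr Z Y) = delta Z"

definition simply_algebraic :: "('i \<Rightarrow> nat) \<Rightarrow> 'a set \<Rightarrow> ('i, 'a) lstruct \<Rightarrow> bool" where
  "simply_algebraic ar Y Z \<longleftrightarrow> algebraic ar Y Z \<and>
     (\<forall>Z'. Y \<subset> Z' \<and> Z' \<subset> univ Z \<longrightarrow> delta (restr Z Z') > delta (restr Z Y))"

definition msa :: "('i \<Rightarrow> nat) \<Rightarrow> 'a set \<Rightarrow> ('i, 'a) lstruct \<Rightarrow> bool" where
  "msa ar Y Z \<longleftrightarrow> simply_algebraic ar Y Z \<and>
     (\<forall>Y'. Y' \<subset> Y \<longrightarrow> \<not> simply_algebraic ar Y' (restr Z (Y' \<union> (univ Z - Y))))"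

text \<open>
  Every finite structure has an isomorphic copy on a set of natural numbers, so classes of finite
  structures are represented by their members with universe in \<^typ>\<open>nat\<close>, and a function of
  isomorphism types of msa extensions is an isomorphism-invariant function of such extensions
  (its values at other arguments are irrelevant).
\<close>

definition mu_function ::
  "('i \<Rightarrow> nat) \<Rightarrow> (nat set \<Rightarrow> ('i, nat) lstruct \<Rightarrow> nat) \<Rightarrow> bool" where
  "mu_function ar \<mu> \<longleftrightarrow>
     (\<forall>Y Z Y' Z' f. msa ar Y Z \<and> msa ar Y' Z' \<and> isomorphism f Z Z' \<and> f ` Y = Y'
        \<longrightarrow> \<mu> Y Z = \<mu> Y' Z')"

text \<open>
  \<open>h\<close> identifies \<open>Y\<close> with its copy in \<open>A\<close>; the \<open>F j\<close> for \<open>j = 0, \<dots>, \<mu> Y Z\<close> give the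
  \<open>\<mu> Y Z + 1\<close> copies of \<open>Z\<close> over it.
\<close>

definition Cmu ::
  "('i \<Rightarrow> nat) \<Rightarrow> (nat set \<Rightarrow> ('i, nat) lstruct \<Rightarrow> nat) \<Rightarrow> ('i, 'a) lstruct set" where
  "Cmu ar \<mu> = {A \<in> C0 ar. \<forall>Y Z. msa ar Y Z \<longrightarrow>
     \<not> (\<exists>h F. embedding h (restr Z Y) A \<and>
          (\<forall>j \<le> \<mu> Y Z. embedding (F j) Z A \<and> (\<forall>y \<in> Y. F j y = h y)) \<and>
          disjoint_family_on (\<lambda>j. F j ` (univ Z - Y)) {..\<mu> Y Z})}"

section \<open>Amalgamation classes and generic structures\<close>

definition amalgamation_class :: "('i \<Rightarrow> nat) \<Rightarrow> ('i, nat) lstruct set \<Rightarrow> bool" where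
  "amalgamation_class ar \<A> \<longleftrightarrow> \<A> \<subseteq> C0 ar \<and>
     (\<forall>B \<in> \<A>. \<forall>A. ss_fin A B \<longrightarrow> restr B A \<in> \<A>) \<and>
     (\<forall>A. \<forall>B1 \<in> \<A>. \<forall>B2 \<in> \<A>. common_sub A B1 B2 \<and> ss_fin A B1 \<and> ss_fin A B2 \<longrightarrow>
        (\<exists>C \<in> \<A>. \<exists>f1 f2. embedding f1 B1 C \<and> embedding f2 B2 C \<and>
           ss_fin (f1 ` univ B1) C \<and> ss_fin (f2 ` univ B2) C \<and> (\<forall>a \<in> A. f1 a = f2 a)))"

text \<open>
  Since \<open>M\<close> need not live on \<^typ>\<open>nat\<close>, membership of its finite substructures in \<open>\<A>\<close> is up to
  isomorphism, and an extension \<open>A \<le> B \<in> \<A>\<close> of a finite self-sufficient \<open>A \<le> M\<close> is given by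
  \<open>A \<le> B\<close> together with an embedding \<open>h\<close> of \<open>A\<close> onto a self-sufficient subset of \<open>M\<close>.
\<close>

definition is_generic ::
  "('i \<Rightarrow> nat) \<Rightarrow> ('i, nat) lstruct set \<Rightarrow> ('i, 'a) lstruct \<Rightarrow> bool" where
  "is_generic ar \<A> M \<longleftrightarrow> M \<in> C0bar ar \<and> countable (univ M) \<and>
     (\<exists>A :: nat \<Rightarrow> 'a set.
        (\<forall>k. \<exists>B \<in> \<A>. \<exists>f. isomorphism f B (restr M (A k))) \<and>
        (\<forall>k. ss_fin (A k) (restr M (A (Suc k)))) \<and>
        univ M = (\<Union>k. A k)) \<and>
     (\<forall>B \<in> \<A>. \<forall>A h. ss_fin A B \<and> embedding h (restr B A) M \<and> ss (h ` A) M \<longrightarrow>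
        (\<exists>g. embedding g B M \<and> (\<forall>a \<in> A. g a = h a) \<and> ss (g ` univ B) M))"

definition free_amalgam_condition ::
  "('i \<Rightarrow> nat) \<Rightarrow> (nat set \<Rightarrow> ('i, nat) lstruct \<Rightarrow> nat) \<Rightarrow> bool" where
  "free_amalgam_condition ar \<mu> \<longleftrightarrow>
     (\<forall>A. \<forall>B1 \<in> Cmu ar \<mu>. \<forall>B2 \<in> Cmu ar \<mu> :: ('i, nat) lstruct set.
        common_sub A B1 B2 \<and> ss_fin A B1 \<and> ss_fin A B2 \<and> free_amalgam A B1 B2 \<notin> Cmu ar \<mu> \<longrightarrow>
        (\<exists>Y Z1 Z2 f. Y \<subseteq> A \<and> Z1 \<subseteq> univ B1 \<and> Z2 \<subseteq> univ B2 \<and>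
           msa ar Y (restr B1 Z1) \<and> msa ar Y (restr B2 Z2) \<and>
           isomorphism f (restr B1 Z1) (restr B2 Z2) \<and> (\<forall>y \<in> Y. f y = y) \<and>
           Z1 - Y \<subseteq> univ B1 - A \<and> Z2 - Y \<subseteq> univ B2 - A))"

end

theory Submission
  imports Defs
begin

text \<open>
  A back-and-forth between finite self-sufficient subsets of the two generic structures builds the
  isomorphism.  It matches parallel classes over \<open>X\<close>, not points, and preserves rank.  Suppose
  \<open>A \<le> A1\<close> on one side and \<open>B\<close> is matched with \<open>A\<close>.  Among the relations of \<open>A1\<close> outside \<open>A\<close> only
  those of rank at least two over \<open>X\<close> influence the geometry, and their effect does not change when a
  point is replaced by a parallel one.  So each of them is copied onto fresh points, no fresh point
  being used twice; the fresh points of one class form a chain, and consecutive points of the chain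
  are made parallel by a relation through them and one fixed tuple \<open>xs\<close> from the infinite set
  \<open>cl X\<close>.  A fresh point then lies in at most two chain relations and one copied relation.  In a
  family of msa copies over a common base that contains a fresh point, two chain relations force
  \<open>xs\<close> into the base, so that every copy is a single chain relation, and a copied relation forces
  the base to have predimension at least two; hence \<open>\<mu> \<ge> 2\<close> (\<open>\<mu> \<ge> 1\<close> for predimension one) is enough
  to stay inside the class.
\<close>


section \<open>Predimension, dimension and closure\<close>

text \<open>The obstacle is the bound on disjoint copies. Genericity extends an embedding only to a
  member of the class, while \<open>A1\<close> comes from the other structure and may contain more
  copies than \<open>\<mu>\<close> allows. What is added to \<open>B\<close> must obey the bound
  whatever \<open>A1\<close> is. The infinite closure supplies loops outside \<open>B\<close>, both
  for \<open>xs\<close> and for the loop positions of the copied relations. Since \<open>xs\<close>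
  lies outside \<open>B\<close>, no earlier relation through \<open>xs\<close> contains an old
  nonloop, so the first link of an old class has no rival of its kind. The links use a symbol of
  least arity: the base of a copy that is a single link has one point less than that arity, hence
  carries no relation and has predimension at least two. The final statement of the theorem also
  asks for some \<open>X\<close> with infinite closure: one point less than the least arity, chosen
  independent, suffices, as a chain of links over them can have any length.\<close>

definition ed :: "('i, 'a) lstruct \<Rightarrow> 'a set \<Rightarrow> ('i \<times> 'a set) set" where
  "ed D S = {(i, e). e \<in> rel D i \<and> e \<subseteq> S}"

abbreviation (input) dl :: "('i, 'a) lstruct \<Rightarrow> 'a set \<Rightarrow> int" where
  "dl D S \<equiv> delta (restr D S)"

lemma univ_restr [simp]: "univ (restr D S) = S"
  by (simp add: restr_def)

lemma rel_restr [simp]: "rel (restr D S) i = {e \<in> rel D i. e \<subseteq> S}"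
  by (simp add: restr_def)

lemma restr_restr [simp]: "S \<subseteq> T \<Longrightarrow> restr (restr D T) S = restr D S"
  by (auto simp: restr_def)

lemma restr_univ [simp]: "is_lstruct ar D \<Longrightarrow> restr D (univ D) = D"
  by (cases D) (auto simp: restr_def is_lstruct_def fun_eq_iff)

lemma is_lstruct_restr [simp]: "is_lstruct ar D \<Longrightarrow> is_lstruct ar (restr D S)"
  by (auto simp: is_lstruct_def)

lemma ed_mono: "S \<subseteq> T \<Longrightarrow> ed D S \<subseteq> ed D T"
  by (auto simp: ed_def)

lemma ed_Int: "ed D (S \<inter> T) = ed D S \<inter> ed D T"
  by (auto simp: ed_def)

lemma card_Int_Un_int:
  "finite S \<Longrightarrow> finite T \<Longrightarrow> int (card (S \<union> T)) + int (card (S \<inter> T)) = int (card S) + int (card T)"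
  using card_Un_Int[of S T] by simp

locale lang_struct =
  fixes ar :: "'i \<Rightarrow> nat" and D :: "('i, 'a) lstruct"
  assumes lang: "language ar" and str: "is_lstruct ar D"
begin

lemma finite_ar_le: "finite {i. ar i \<le> k}"
proof -
  have "{i. ar i \<le> k} = (\<Union>m\<in>{..k}. {i. ar i = m})" by auto
  thus ?thesis using lang by (simp add: language_def)
qed

lemma relD:
  assumes "e \<in> rel D i"
  shows "e \<subseteq> univ D" "finite e" "card e = ar i" "e \<noteq> {}"
proof -
  show *: "e \<subseteq> univ D" "finite e" "card e = ar i" using assms str by (auto simp: is_lstruct_def)
  have "ar i \<ge> 3" using lang by (simp add: language_def)
  thus "e \<noteq> {}" using * by auto
qed

text \<open>An edge has as many points as the arity of its symbol, so edges inside \<open>S\<close>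
  use only the finitely many symbols of arity at most \<open>card S\<close>. The type of symbols
  itself may be infinite.\<close>

lemma finite_ed: "finite S \<Longrightarrow> finite (ed D S)"
proof -
  assume S: "finite S"
  have "ed D S \<subseteq> {i. ar i \<le> card S} \<times> Pow S"
    using S by (auto simp: ed_def relD(3)[symmetric] intro: card_mono)
  thus ?thesis using S finite_ar_le by (meson finite_Pow_iff finite_SigmaI finite_subset)
qed

text \<open>Edges are paired with their symbols because one point set may be an edge for several
  symbols. The sum in \<open>delta\<close> becomes the size of one finite set, and
  inclusion-exclusion then serves points and edges alike.\<close>

lemma dl_eq:
  assumes S: "finite S"
  shows "dl D S = int (card S) - int (card (ed D S))"
proof -
  let ?I = "{i. rel (restr D S) i \<noteq> {}}"
  have ed: "ed D S = (SIGMA i:?I. rel (restr D S) i)" by (auto simp: ed_def)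
  have "?I = fst ` ed D S" by (force simp: ed_def)
  hence f: "finite ?I" using finite_ed[OF S] by simp
  have "finite (rel (restr D S) i)" for i
    by (rule finite_subset[of _ "Pow S"]) (use S in auto)
  hence "card (ed D S) = (\<Sum>i\<in>?I. card (rel (restr D S) i))"
    using f unfolding ed by (subst card_SigmaI) auto
  thus ?thesis by (simp add: delta_def)
qed

lemma dl_empty [simp]: "dl D {} = 0"
proof -
  have "ed D {} = {}" using relD(4) by (auto simp: ed_def)
  thus ?thesis by (simp add: dl_eq)
qed

text \<open>Points are counted modularly; edges give only an inequality, because an edge inside
  \<open>S \<union> T\<close> may lie in neither of the two sets.\<close>

lemma dl_submod:
  assumes "finite S" "finite T"
  shows "dl D (S \<union> T) + dl D (S \<inter> T) \<le> dl D S + dl D T"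
proof -
  have "ed D S \<union> ed D T \<subseteq> ed D (S \<union> T)" by (auto simp: ed_def)
  hence "card (ed D S \<union> ed D T) \<le> card (ed D (S \<union> T))"
    using assms finite_ed by (intro card_mono) auto
  moreover have "int (card (ed D S \<union> ed D T)) + int (card (ed D (S \<inter> T))) = int (card (ed D S)) + int (card (ed D T))"
    unfolding ed_Int using assms finite_ed by (intro card_Int_Un_int) auto
  ultimately show ?thesis
    using assms card_Int_Un_int[OF assms] by (simp add: dl_eq)
qed

lemma dl_Un_le:
  assumes "finite S" "finite T"
  shows "dl D (S \<union> T) \<le> dl D S + int (card T)"
proof -
  have "card (ed D S) \<le> card (ed D (S \<union> T))"
    using assms finite_ed by (intro card_mono ed_mono) auto
  moreover have "card (S \<union> T) \<le> card S + card T" by (rule card_Un_le)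
  ultimately show ?thesis using assms by (simp add: dl_eq)
qed

end

lemma C0D:
  assumes "D \<in> C0 ar"
  shows "is_lstruct ar D" "finite (univ D)" "S \<subseteq> univ D \<Longrightarrow> 0 \<le> dl D S"
  using assms by (auto simp: C0_def)

lemma C0_restr: "D \<in> C0 ar \<Longrightarrow> S \<subseteq> univ D \<Longrightarrow> restr D S \<in> C0 ar"
  by (auto simp: C0_def finite_subset)

locale C0bar_struct = lang_struct ar D for ar :: "'i \<Rightarrow> nat" and D :: "('i, 'a) lstruct" +
  assumes Cbar: "D \<in> C0bar ar"
begin

lemma dl_nonneg: "finite S \<Longrightarrow> S \<subseteq> univ D \<Longrightarrow> 0 \<le> dl D S"
  using Cbar by (auto simp: C0bar_def C0_def)

text \<open>\<open>LEAST\<close> over the integers says nothing until a minimum is known to exist.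
  Nonnegativity on finite subsets lets the search run over natural numbers.\<close>

lemma dim_attained:
  assumes S: "finite S" "S \<subseteq> univ D"
  shows "\<exists>S'. S \<subseteq> S' \<and> S' \<subseteq> univ D \<and> finite S' \<and> dim D S = dl D S' \<and>
     (\<forall>T. S \<subseteq> T \<and> T \<subseteq> univ D \<and> finite T \<longrightarrow> dl D S' \<le> dl D T)"
proof -
  let ?P = "\<lambda>T. S \<subseteq> T \<and> T \<subseteq> univ D \<and> finite T"
  have "?P S" using S by auto
  from ex_has_least_nat[of ?P, OF this, of "\<lambda>T. nat (dl D T)"]
  obtain S' where S': "?P S'" and min: "\<And>T. ?P T \<Longrightarrow> nat (dl D S') \<le> nat (dl D T)" by blast
  have min': "dl D S' \<le> dl D T" if "?P T" for T
    using min[OF that] dl_nonneg S' that by (simp add: nat_le_eq_zle)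
  have "dim D S = dl D S'"
    unfolding dim_def by (rule Least_equality) (use S' min' in auto)
  thus ?thesis using S' min' by blast
qed

lemma dim_le: "S \<subseteq> T \<Longrightarrow> T \<subseteq> univ D \<Longrightarrow> finite T \<Longrightarrow> dim D S \<le> dl D T"
  using dim_attained[of S] finite_subset[of S T] by fastforce

lemma dim_ex:
  assumes "finite S" "S \<subseteq> univ D"
  obtains S' where "S \<subseteq> S'" "S' \<subseteq> univ D" "finite S'" "dim D S = dl D S'"
  using dim_attained[OF assms] by blast

lemma dim_geI:
  assumes "finite S" "S \<subseteq> univ D" "\<And>T. S \<subseteq> T \<Longrightarrow> T \<subseteq> univ D \<Longrightarrow> finite T \<Longrightarrow> k \<le> dl D T"
  shows "k \<le> dim D S"
  using dim_ex[OF assms(1,2)] assms(3) by metis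

lemma dim_mono: "S \<subseteq> T \<Longrightarrow> T \<subseteq> univ D \<Longrightarrow> finite T \<Longrightarrow> dim D S \<le> dim D T"
  by (rule dim_geI) (auto intro: dim_le)

lemma dim_submod:
  assumes "finite S" "S \<subseteq> univ D" "finite T" "T \<subseteq> univ D"
  shows "dim D (S \<union> T) + dim D (S \<inter> T) \<le> dim D S + dim D T"
proof -
  obtain S' T' where
    S': "S \<subseteq> S'" "S' \<subseteq> univ D" "finite S'" "dim D S = dl D S'" and
    T': "T \<subseteq> T'" "T' \<subseteq> univ D" "finite T'" "dim D T = dl D T'"
    using assms dim_ex by metis
  have "dim D (S \<union> T) \<le> dl D (S' \<union> T')" "dim D (S \<inter> T) \<le> dl D (S' \<inter> T')"
    using S' T' by (auto intro!: dim_le)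
  thus ?thesis using dl_submod[OF S'(3) T'(3)] S' T' by linarith
qed

lemma dim_Un_le:
  assumes "finite S" "S \<subseteq> univ D" "finite T" "T \<subseteq> univ D"
  shows "dim D (S \<union> T) \<le> dim D S + int (card T)"
proof -
  obtain S' where S': "S \<subseteq> S'" "S' \<subseteq> univ D" "finite S'" "dim D S = dl D S'"
    using assms dim_ex by metis
  have "dim D (S \<union> T) \<le> dl D (S' \<union> T)" using S' assms by (auto intro!: dim_le)
  thus ?thesis using dl_Un_le[OF S'(3) assms(3)] S' by linarith
qed

lemma dim_insert_le:
  "finite S \<Longrightarrow> S \<subseteq> univ D \<Longrightarrow> c \<in> univ D \<Longrightarrow> dim D (insert c S) \<le> dim D S + 1"
  using dim_Un_le[of S "{c}"] by simp

lemma cl_iff: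
  "finite S \<Longrightarrow> u \<in> cl D S \<longleftrightarrow> u \<in> univ D \<and> dim D (insert u S) = dim D S"
  by (simp add: cl_def cl_fin_def)

lemma cl_subset_univ: "cl D S \<subseteq> univ D"
  by (auto simp: cl_def cl_fin_def)

lemma cl_extensive: "finite S \<Longrightarrow> S \<subseteq> univ D \<Longrightarrow> S \<subseteq> cl D S"
  by (auto simp: cl_iff insert_absorb)

text \<open>Submodularity: \<open>insert u S \<inter> T\<close> contains \<open>S\<close>, so
  \<open>u\<close> raises the dimension of \<open>T\<close> by no more than that of
  \<open>S\<close>.\<close>

lemma cl_mono_fin:
  assumes "S \<subseteq> T" "finite T" "T \<subseteq> univ D"
  shows "cl D S \<subseteq> cl D T"
proof
  fix u assume u: "u \<in> cl D S"
  have fS: "finite S" "S \<subseteq> univ D" using assms finite_subset by auto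
  with u have u: "u \<in> univ D" "dim D (insert u S) = dim D S" by (auto simp: cl_iff)
  have "dim D (insert u S \<union> T) + dim D (insert u S \<inter> T) \<le> dim D (insert u S) + dim D T"
    using u fS assms by (intro dim_submod) auto
  moreover have "insert u S \<union> T = insert u T" using assms by auto
  moreover have "dim D S \<le> dim D (insert u S \<inter> T)"
    using assms fS by (intro dim_mono) auto
  moreover have "dim D T \<le> dim D (insert u T)" using assms u by (intro dim_mono) auto
  ultimately show "u \<in> cl D T" using u assms by (simp add: cl_iff)
qed

lemma dim_cl:
  assumes S: "finite S" "S \<subseteq> univ D" and F: "finite F" "F \<subseteq> cl D S"
  shows "dim D (S \<union> F) = dim D S"
  using F
proof (induction F rule: finite_induct)
  case (insert u F)
  have Fu: "F \<subseteq> univ D" using insert.prems cl_subset_univ by blast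
  have "u \<in> cl D (S \<union> F)"
    using cl_mono_fin[of S "S \<union> F"] insert S Fu by auto
  thus ?case using insert S by (simp add: cl_iff)
qed simp

lemma cl_subsetI:
  assumes S: "finite S" "S \<subseteq> univ D" and F: "finite F" "F \<subseteq> cl D S"
  shows "cl D F \<subseteq> cl D S"
proof
  fix u assume "u \<in> cl D F"
  moreover have Fu: "F \<subseteq> univ D" using F cl_subset_univ by blast
  ultimately have "u \<in> cl D (S \<union> F)" using cl_mono_fin[of F "S \<union> F"] S F by auto
  hence "u \<in> univ D" "dim D (insert u (S \<union> F)) = dim D S"
    using S F dim_cl[OF S F] by (auto simp: cl_iff)
  moreover have "dim D (insert u S) \<le> dim D (insert u (S \<union> F))"
    using S F Fu \<open>u \<in> univ D\<close> by (intro dim_mono) auto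
  moreover have "dim D S \<le> dim D (insert u S)"
    using S F Fu \<open>u \<in> univ D\<close> by (intro dim_mono) auto
  ultimately show "u \<in> cl D S" using S by (simp add: cl_iff)
qed

text \<open>Each point raises the dimension by at most one: once \<open>v\<close> has taken the
  single unit available in \<open>insert u S\<close> over \<open>S\<close>, none is left for
  \<open>u\<close>.\<close>

lemma cl_exchange:
  assumes S: "finite S" "S \<subseteq> univ D" and u: "u \<in> univ D" and v: "v \<in> cl D (insert u S)" "v \<notin> cl D S"
  shows "u \<in> cl D (insert v S)"
proof -
  have vu: "v \<in> univ D" "dim D (insert v (insert u S)) = dim D (insert u S)"
    using v S by (auto simp: cl_iff)
  have "dim D (insert v S) \<noteq> dim D S" using v S vu by (simp add: cl_iff)
  moreover have "dim D S \<le> dim D (insert v S)" using S vu by (intro dim_mono) auto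
  moreover have "dim D (insert u S) \<le> dim D S + 1" using S u by (intro dim_insert_le)
  moreover have "dim D (insert v S) \<le> dim D (insert v (insert u S))" using S u vu by (intro dim_mono) auto
  ultimately show ?thesis using S u vu by (simp add: cl_iff insert_commute)
qed

lemma cl_iff_finite_subset:
  assumes "S \<subseteq> univ D"
  shows "u \<in> cl D S \<longleftrightarrow> (\<exists>F. finite F \<and> F \<subseteq> S \<and> u \<in> cl D F)"
proof (cases "finite S")
  case True
  thus ?thesis using assms cl_mono_fin by blast
next
  case False
  thus ?thesis by (auto simp: cl_def)
qed

lemma cl_mono: "S \<subseteq> T \<Longrightarrow> T \<subseteq> univ D \<Longrightarrow> cl D S \<subseteq> cl D T"
proof
  fix u assume "S \<subseteq> T" "T \<subseteq> univ D" "u \<in> cl D S"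
  moreover from this obtain F where "finite F" "F \<subseteq> S" "u \<in> cl D F"
    using cl_iff_finite_subset[of S u] by auto
  ultimately show "u \<in> cl D T" using cl_iff_finite_subset[of T u] by blast
qed

text \<open>Intersecting a minimizing superset with the self-sufficient \<open>A\<close> does not
  raise its predimension, so dimensions of subsets of \<open>A\<close> are computed inside
  \<open>A\<close>.\<close>

lemma ss_dim:
  assumes "ss A D" "finite A" "S \<subseteq> A"
  shows "\<exists>S'. S \<subseteq> S' \<and> S' \<subseteq> A \<and> dim D S = dl D S'"
proof -
  have A: "A \<subseteq> univ D" using assms by (auto simp: ss_def)
  obtain S' where S': "S \<subseteq> S'" "S' \<subseteq> univ D" "finite S'" "dim D S = dl D S'"
    using assms A dim_ex by (metis finite_subset order_trans)
  have "dl D (S' \<inter> A) \<le> dl D S'" using assms S' by (auto simp: ss_def)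
  moreover have "dim D S \<le> dl D (S' \<inter> A)" using assms S' by (intro dim_le) auto
  ultimately show ?thesis using S' assms by (intro exI[of _ "S' \<inter> A"]) auto
qed

lemma ss_dim_eq: "ss A D \<Longrightarrow> finite A \<Longrightarrow> dim D A = dl D A"
  using ss_dim[of A A] by auto

text \<open>A minimizing superset of \<open>F\<close> inside \<open>E\<close> consists of points
  dependent on \<open>F\<close>, hence of points of the closed set whose trace \<open>F\<close> is;
  so it is \<open>F\<close> itself.\<close>

lemma dl_closed:
  assumes E: "ss E D" "finite E" and F: "F = E \<inter> cl D S" "S \<subseteq> univ D" "finite S"
  shows "dl D F = dim D F"
proof -
  have Fu: "F \<subseteq> univ D" "finite F" using F E cl_subset_univ by auto
  obtain F' where F': "F \<subseteq> F'" "F' \<subseteq> E" "dim D F = dl D F'"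
    using ss_dim[OF E, of F] F by auto
  have fF': "finite F'" "F' \<subseteq> univ D" using F' E by (auto simp: ss_def dest: finite_subset)
  have "F' \<subseteq> cl D F"
  proof
    fix u assume u: "u \<in> F'"
    have "dim D (insert u F) \<le> dl D F'" using u F' fF' by (intro dim_le) auto
    moreover have "dim D F \<le> dim D (insert u F)" using u fF' Fu by (intro dim_mono) auto
    ultimately show "u \<in> cl D F" using u fF' Fu F' by (auto simp: cl_iff)
  qed
  also have "\<dots> \<subseteq> cl D S" using F Fu by (intro cl_subsetI) auto
  finally have "F' = F" using F' F by auto
  thus ?thesis using F' by simp
qed

text \<open>A finite set minimizing the predimension over \<open>S\<close> is self-sufficient by
  submodularity, and none of its points raises the dimension of \<open>S\<close>.\<close>

lemma ss_hull:
  assumes S: "finite S" "S \<subseteq> univ D"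
  obtains H where "S \<subseteq> H" "finite H" "ss H D" "H \<subseteq> cl D S"
proof -
  from dim_ex[OF S] obtain H where H: "S \<subseteq> H" "H \<subseteq> univ D" "finite H" "dim D S = dl D H" .
  have min: "dl D H \<le> dl D T" if "S \<subseteq> T" "T \<subseteq> univ D" "finite T" for T
    using dim_le[OF that] H by simp
  have "dl D (C \<inter> H) \<le> dl D C" if "C \<subseteq> univ D" "finite C" for C
  proof -
    have "dl D H \<le> dl D (C \<union> H)" using that H by (intro min) auto
    thus ?thesis using dl_submod[OF that(2) H(3)] by linarith
  qed
  hence "ss H D" using H by (auto simp: ss_def)
  moreover have "H \<subseteq> cl D S"
  proof
    fix u assume u: "u \<in> H"
    have "dim D (insert u S) \<le> dl D H" using u H by (intro dim_le) auto
    moreover have "dim D S \<le> dim D (insert u S)" using u H S by (intro dim_mono) auto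
    ultimately show "u \<in> cl D S" using u H S by (auto simp: cl_iff)
  qed
  ultimately show thesis using that H by blast
qed

end

section \<open>Classes of parallel points and the gain of an extension\<close>

locale localized = C0bar_struct ar D for ar :: "'i \<Rightarrow> nat" and D :: "('i, 'a) lstruct" +
  fixes X :: "'a set"
  assumes finX: "finite X" and ssX: "ss X D"
begin

definition rk :: "'a set \<Rightarrow> int" where
  "rk S = dim D (X \<union> S) - dim D X"

text \<open>A system of representatives, one for each parallel class of nonloops over
  \<open>X\<close> that meets \<open>E\<close>. Working with points postpones the quotient until the
  geometry is formed.\<close>

definition transv :: "'a set \<Rightarrow> 'a set \<Rightarrow> bool" where
  "transv E R \<longleftrightarrow> R \<subseteq> E \<and> R \<inter> cl D X = {} \<and>
     (\<forall>\<rho>\<in>R. \<forall>\<sigma>\<in>R. \<sigma> \<in> cl D (insert \<rho> X) \<longrightarrow> \<sigma> = \<rho>) \<and>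
     (\<forall>u\<in>E. u \<in> cl D X \<or> (\<exists>\<rho>\<in>R. u \<in> cl D (insert \<rho> X)))"

text \<open>In general smaller than the trace of the closure of \<open>L\<close>: only the loops of
  \<open>E\<close> and the single classes of the members of \<open>L\<close>. For the
  representatives in a closed set the two agree (\<open>span_cl\<close>).\<close>

definition span :: "'a set \<Rightarrow> 'a set \<Rightarrow> 'a set" where
  "span E L = {u \<in> E. u \<in> cl D X \<or> (\<exists>\<rho>\<in>L. u \<in> cl D (insert \<rho> X))}"

definition ed2 :: "'a set \<Rightarrow> ('i \<times> 'a set) set" where
  "ed2 S = {(i, e) \<in> ed D S. 2 \<le> rk e}"

lemma Xu: "X \<subseteq> univ D"
  using ssX by (auto simp: ss_def)

lemma dim_X: "dim D X = dl D X"
  using ss_dim_eq[OF ssX finX] .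

lemma dim_insert_notin:
  assumes "finite S" "S \<subseteq> univ D" "u \<in> univ D" "u \<notin> cl D S"
  shows "dim D (insert u S) = dim D S + 1"
proof -
  have "dim D (insert u S) \<noteq> dim D S" using assms by (simp add: cl_iff)
  moreover have "dim D S \<le> dim D (insert u S)" using assms by (intro dim_mono) auto
  ultimately show ?thesis using dim_insert_le[OF assms(1-3)] by simp
qed

lemma rk_empty [simp]: "rk {} = 0"
  by (simp add: rk_def)

lemma rk_mono: "S \<subseteq> T \<Longrightarrow> T \<subseteq> univ D \<Longrightarrow> finite T \<Longrightarrow> rk S \<le> rk T"
  unfolding rk_def using dim_mono[of "X \<union> S" "X \<union> T"] Xu finX by (simp add: sup.coboundedI2)

lemma rk_le_1:
  assumes "finite e" "e \<subseteq> cl D (insert \<rho> X)" "\<rho> \<in> univ D"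
  shows "rk e \<le> 1"
proof -
  have eu: "e \<subseteq> univ D" using assms cl_subset_univ by blast
  have "dim D (insert \<rho> X \<union> e) = dim D (insert \<rho> X)"
    using assms Xu finX by (intro dim_cl) auto
  moreover have "dim D (X \<union> e) \<le> dim D (insert \<rho> X \<union> e)"
    using assms Xu finX eu by (intro dim_mono) auto
  moreover have "dim D (insert \<rho> X) \<le> dim D X + 1"
    using assms Xu finX by (intro dim_insert_le) auto
  ultimately show ?thesis by (simp add: rk_def)
qed

lemma rk_loops:
  assumes "finite e" "e \<subseteq> cl D X"
  shows "rk e = 0"
  using dim_cl[OF finX Xu assms] by (simp add: rk_def)

lemma cl_X_subset: "\<rho> \<in> univ D \<Longrightarrow> cl D X \<subseteq> cl D (insert \<rho> X)"
  using Xu finX by (intro cl_mono_fin) auto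

lemma par_eq:
  assumes "\<rho> \<in> univ D" "u \<in> cl D (insert \<rho> X)" "u \<notin> cl D X"
  shows "cl D (insert u X) = cl D (insert \<rho> X)"
proof
  have u: "u \<in> univ D" using assms cl_subset_univ by blast
  have X1: "X \<subseteq> cl D (insert \<rho> X)" "X \<subseteq> cl D (insert u X)"
    using cl_extensive[of "insert \<rho> X"] cl_extensive[of "insert u X"] Xu finX assms u by auto
  show "cl D (insert u X) \<subseteq> cl D (insert \<rho> X)"
    using assms Xu finX X1 by (intro cl_subsetI) auto
  have "\<rho> \<in> cl D (insert u X)" by (rule cl_exchange[OF finX Xu assms])
  thus "cl D (insert \<rho> X) \<subseteq> cl D (insert u X)"
    using assms Xu finX X1 u by (intro cl_subsetI) auto
qed

lemma transv_unique:
  assumes "transv E R" "E \<subseteq> univ D" "\<rho> \<in> R" "\<sigma> \<in> R" "u \<in> cl D (insert \<rho> X)" "u \<in> cl D (insert \<sigma> X)"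
    "u \<notin> cl D X"
  shows "\<sigma> = \<rho>"
proof -
  have u: "\<rho> \<in> univ D" "\<sigma> \<in> univ D" using assms by (auto simp: transv_def)
  have "cl D (insert \<rho> X) = cl D (insert \<sigma> X)"
    using par_eq[of \<rho> u] par_eq[of \<sigma> u] assms u by auto
  moreover have "\<sigma> \<in> cl D (insert \<sigma> X)" using cl_extensive[of "insert \<sigma> X"] u Xu finX by auto
  ultimately show ?thesis using assms unfolding transv_def by metis
qed

text \<open>A set of maximal size among the pairwise nonparallel sets of nonloops of
  \<open>A1\<close> containing \<open>R\<close> works: an uncovered nonloop could be added to
  it.\<close>

lemma transv_extend:
  assumes R: "transv A R" and A: "A \<subseteq> A1" "finite A1" "A1 \<subseteq> univ D"
  obtains R1 where "transv A1 R1" "R \<subseteq> R1"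
proof -
  let ?P = "\<lambda>S. R \<subseteq> S \<and> S \<subseteq> A1 \<and> S \<inter> cl D X = {} \<and>
     (\<forall>\<rho>\<in>S. \<forall>\<sigma>\<in>S. \<sigma> \<in> cl D (insert \<rho> X) \<longrightarrow> \<sigma> = \<rho>)"
  have "?P R" using R A unfolding transv_def by auto
  moreover have "\<forall>S. ?P S \<longrightarrow> card S < Suc (card A1)" using A by (auto simp: less_Suc_eq_le intro: card_mono)
  ultimately have "\<exists>S. ?P S \<and> (\<forall>T. ?P T \<longrightarrow> card T \<le> card S)"
    by (rule ex_has_greatest_nat)
  then obtain R1 where "?P R1 \<and> (\<forall>T. ?P T \<longrightarrow> card T \<le> card R1)" by (rule exE)
  hence R1: "?P R1" and max: "\<forall>T. ?P T \<longrightarrow> card T \<le> card R1" by (rule conjunct1, rule conjunct2)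
  have fR1: "finite R1" using R1 A finite_subset by blast
  have "u \<in> cl D X \<or> (\<exists>\<rho>\<in>R1. u \<in> cl D (insert \<rho> X))" if u: "u \<in> A1" for u
  proof (rule ccontr)
    assume c: "\<not> (u \<in> cl D X \<or> (\<exists>\<rho>\<in>R1. u \<in> cl D (insert \<rho> X)))"
    have uu: "u \<in> univ D" using u A by auto
    have "u \<notin> R1"
      using c cl_extensive[of "insert u X"] Xu finX uu by auto
    have "\<rho> \<notin> cl D (insert u X)" if "\<rho> \<in> R1" for \<rho>
    proof
      assume "\<rho> \<in> cl D (insert u X)"
      moreover have "\<rho> \<notin> cl D X" using that R1 by auto
      ultimately have "u \<in> cl D (insert \<rho> X)" using cl_exchange[of X u \<rho>] Xu finX uu by auto
      thus False using c that by auto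
    qed
    hence "?P (insert u R1)" using R1 c u by auto
    hence "card (insert u R1) \<le> card R1" using max by simp
    thus False using \<open>u \<notin> R1\<close> fR1 by simp
  qed
  hence "transv A1 R1" using R1 unfolding transv_def by auto
  thus thesis using that R1 by blast
qed

lemma span_empty: "span E {} = E \<inter> cl D X"
  by (auto simp: span_def)

lemma span_single: "\<rho> \<in> univ D \<Longrightarrow> span E {\<rho>} = E \<inter> cl D (insert \<rho> X)"
  using cl_X_subset by (auto simp: span_def)

lemma span_cl:
  assumes R: "transv E R" "E \<subseteq> univ D" and K: "finite K" "K \<subseteq> univ D"
  shows "span E (R \<inter> cl D (X \<union> K)) = E \<inter> cl D (X \<union> K)" (is "?l = ?r")
proof
  have XK: "X \<subseteq> cl D (X \<union> K)" using cl_extensive[of "X \<union> K"] Xu finX K by auto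
  have sub: "cl D (insert \<rho> X) \<subseteq> cl D (X \<union> K)" if "\<rho> \<in> cl D (X \<union> K)" for \<rho>
    using that XK Xu finX K by (intro cl_subsetI) auto
  have "cl D X \<subseteq> cl D (X \<union> K)" using Xu finX K by (intro cl_mono_fin) auto
  thus "?l \<subseteq> ?r" using sub by (auto simp: span_def)
  show "?r \<subseteq> ?l"
  proof
    fix u assume u: "u \<in> ?r"
    show "u \<in> ?l"
    proof (cases "u \<in> cl D X")
      case False
      then obtain \<rho> where \<rho>: "\<rho> \<in> R" "u \<in> cl D (insert \<rho> X)"
        using R u by (auto simp: transv_def)
      moreover have "\<rho> \<in> univ D" using \<rho> R by (auto simp: transv_def)
      ultimately have "\<rho> \<in> cl D (insert u X)"
        using cl_exchange[of X \<rho> u] Xu finX False by auto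
      hence "\<rho> \<in> cl D (X \<union> K)" using sub[of u] u by auto
      thus ?thesis using \<rho> u by (auto simp: span_def)
    qed (use u in \<open>auto simp: span_def\<close>)
  qed
qed

lemma span_subset_cl:
  assumes "L \<subseteq> univ D" "finite L"
  shows "span E L \<subseteq> cl D (X \<union> L)"
proof -
  have "cl D X \<subseteq> cl D (X \<union> L)" using Xu finX assms by (intro cl_mono_fin) auto
  moreover have "cl D (insert \<rho> X) \<subseteq> cl D (X \<union> L)" if "\<rho> \<in> L" for \<rho>
    using that Xu finX assms by (intro cl_mono_fin) auto
  ultimately show ?thesis by (auto simp: span_def)
qed

lemma subset_span: "L \<subseteq> E \<Longrightarrow> X \<subseteq> E \<Longrightarrow> E \<subseteq> univ D \<Longrightarrow> X \<union> L \<subseteq> span E L"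
proof
  fix u assume a: "L \<subseteq> E" "X \<subseteq> E" "E \<subseteq> univ D" "u \<in> X \<union> L"
  hence "u \<in> cl D X \<or> u \<in> L \<and> u \<in> cl D (insert u X)"
    using cl_extensive[of X] cl_extensive[of "insert u X"] Xu finX by auto
  thus "u \<in> span E L" using a by (auto simp: span_def)
qed

lemma dim_closed:
  assumes E: "ss E D" "finite E" "X \<subseteq> E" and K: "K \<subseteq> E"
  shows "dl D (E \<inter> cl D (X \<union> K)) = dim D (X \<union> K)"
proof -
  have Eu: "E \<subseteq> univ D" using E by (auto simp: ss_def)
  have fK: "finite K" "K \<subseteq> univ D" using K E Eu by (auto dest: finite_subset)
  let ?F = "E \<inter> cl D (X \<union> K)"
  have "dl D ?F = dim D ?F" using fK finX Xu by (intro dl_closed[OF E(1,2) refl]) auto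
  moreover have "(X \<union> K) \<union> ?F = ?F"
    using cl_extensive[of "X \<union> K"] fK finX Xu E K by auto
  moreover have "dim D ((X \<union> K) \<union> ?F) = dim D (X \<union> K)"
    using fK finX Xu E by (intro dim_cl) auto
  ultimately show ?thesis by simp
qed

text \<open>
  The relations of rank at most one inside \<open>cl (insert \<rho> X)\<close> leave exactly one degree of freedom to the class
  of \<open>\<rho>\<close>; only relations of rank at least two lower the total further.
\<close>

lemma span_count:
  assumes E: "ss E D" "finite E" "X \<subseteq> E" and R: "transv E R" and L: "L \<subseteq> R"
  shows "dl D (span E L) = dl D X + int (card L) - int (card (ed2 (span E L)))"
proof -
  have Eu: "E \<subseteq> univ D" using E by (auto simp: ss_def)
  have fs: "finite (span E L)" for L by (rule finite_subset[of _ E]) (use E in \<open>auto simp: span_def\<close>)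
  define ed1 where "ed1 S = ed D S - ed2 S" for S
  have ed1: "(i, e) \<in> ed1 S \<longleftrightarrow> e \<in> rel D i \<and> e \<subseteq> S \<and> rk e \<le> 1" for i e S
    by (auto simp: ed1_def ed_def ed2_def)
  have fe1: "finite (ed1 (span E L))" for L using finite_ed[OF fs] by (simp add: ed1_def)
  have split: "dl D (span E L) = int (card (span E L)) - int (card (ed1 (span E L))) - int (card (ed2 (span E L)))" for L
  proof -
    have "ed2 (span E L) \<subseteq> ed D (span E L)" by (auto simp: ed2_def)
    hence "card (ed D (span E L)) = card (ed1 (span E L)) + card (ed2 (span E L))"
      unfolding ed1_def using finite_ed[OF fs] by (metis card_Diff_subset card_mono finite_subset le_add_diff_inverse2)
    thus ?thesis by (simp add: dl_eq[OF fs])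
  qed
  \<comment> \<open>The loops in \<open>E\<close> are the trace of \<open>cl D X\<close>, so their
    predimension is \<open>dim D X\<close>, and they contain no relation of rank two. The next step
    repeats this for one class, with one more unit of dimension.\<close>
  have c0: "int (card (span E {})) - int (card (ed1 (span E {}))) = dl D X"
  proof -
    have "rk e = 0" if "e \<in> rel D i" "e \<subseteq> span E {}" for i e
      using that relD(2) by (intro rk_loops) (auto simp: span_empty)
    hence "ed2 (span E {}) = {}" by (auto simp: ed2_def ed_def)
    thus ?thesis using split[of "{}"] dim_closed[OF E, of "{}"] by (simp add: span_empty dim_X)
  qed
  have c1: "int (card (span E {\<rho>})) - int (card (ed1 (span E {\<rho>}))) = dl D X + 1" if \<rho>: "\<rho> \<in> R" for \<rho>
  proof -
    have \<rho>u: "\<rho> \<in> univ D" "\<rho> \<in> E" "\<rho> \<notin> cl D X" using \<rho> R Eu by (auto simp: transv_def)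
    have "rk e \<le> 1" if "e \<in> rel D i" "e \<subseteq> span E {\<rho>}" for i e
      using that relD(2) \<rho>u by (intro rk_le_1[of _ \<rho>]) (auto simp: span_single)
    hence "ed2 (span E {\<rho>}) = {}" by (fastforce simp: ed2_def ed_def)
    moreover have "dim D (insert \<rho> X) = dim D X + 1"
      using \<rho>u finX Xu by (intro dim_insert_notin) auto
    ultimately show ?thesis using split[of "{\<rho>}"] dim_closed[OF E, of "{\<rho>}"] \<rho>u
      by (simp add: span_single dim_X)
  qed
  have "finite L" using L R E by (auto simp: transv_def intro: finite_subset)
  hence "int (card (span E L)) - int (card (ed1 (span E L))) = dl D X + int (card L)"
    using L
  proof (induction L rule: finite_induct)
    case (insert \<rho> L)
    have \<rho>: "\<rho> \<in> univ D" "\<rho> \<in> R" using insert.prems R Eu by (auto simp: transv_def)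
    have un: "span E (insert \<rho> L) = span E L \<union> span E {\<rho>}" by (auto simp: span_def)
    have int: "span E L \<inter> span E {\<rho>} = span E {}"
    proof -
      have "u \<in> cl D X" if "u \<in> span E L" "u \<in> span E {\<rho>}" for u
        using that transv_unique[OF R Eu _ \<rho>(2)] insert by (auto simp: span_def)
      thus ?thesis by (auto simp: span_def)
    qed
    \<comment> \<open>A relation of rank at most one with a nonloop \<open>u\<close> lies in
      \<open>cl D (insert u X)\<close> and so cannot meet two classes. Relations of low rank split
      along the classes and are shared only among loops.\<close>
    have eun: "ed1 (span E (insert \<rho> L)) = ed1 (span E L) \<union> ed1 (span E {\<rho>})"
    proof -
      have "(i, e) \<in> ed1 (span E L) \<union> ed1 (span E {\<rho>})" if e: "(i, e) \<in> ed1 (span E (insert \<rho> L))" for i e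
      proof (cases "e \<subseteq> cl D X")
        case True
        thus ?thesis using e by (auto simp: ed1 span_def)
      next
        case False
        then obtain u where u: "u \<in> e" "u \<notin> cl D X" by auto
        from e have e': "e \<in> rel D i" "e \<subseteq> span E (insert \<rho> L)" "rk e \<le> 1" by (auto simp: ed1)
        obtain \<sigma> where \<sigma>: "\<sigma> \<in> insert \<rho> L" "u \<in> cl D (insert \<sigma> X)" using u e' by (auto simp: span_def)
        have \<sigma>u: "\<sigma> \<in> univ D" using \<sigma> \<rho> insert.prems R Eu by (auto simp: transv_def)
        have uu: "u \<in> univ D" using \<sigma> cl_subset_univ by blast
        have eq: "cl D (insert u X) = cl D (insert \<sigma> X)" using par_eq \<sigma> \<sigma>u u by blast
        have eu: "e \<subseteq> univ D" "finite e" using relD e' by auto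
        have "e \<subseteq> cl D (insert u X)"
        proof
          fix v assume v: "v \<in> e"
          have "dim D (insert v (insert u X)) \<le> dim D (X \<union> e)"
            using v u eu Xu finX by (intro dim_mono) auto
          also have "\<dots> \<le> dim D X + 1" using e' by (simp add: rk_def)
          also have "\<dots> \<le> dim D (insert u X)"
            using u uu finX Xu by (simp add: dim_insert_notin)
          finally have "dim D (insert v (insert u X)) \<le> dim D (insert u X)" .
          moreover have "dim D (insert u X) \<le> dim D (insert v (insert u X))"
            using v eu uu Xu finX by (intro dim_mono) auto
          ultimately show "v \<in> cl D (insert u X)" using v eu finX by (auto simp: cl_iff)
        qed
        hence "e \<subseteq> span E {\<sigma>}" using e' eq by (auto simp: span_def)
        thus ?thesis using e' \<sigma> by (auto simp: ed1 span_def)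
      qed
      thus ?thesis by (fastforce simp: ed1 un)
    qed
    have eint: "ed1 (span E L) \<inter> ed1 (span E {\<rho>}) = ed1 (span E {})"
      unfolding int[symmetric] by (auto simp: ed1)
    from card_Int_Un_int[OF fs fs, of L "{\<rho>}"] card_Int_Un_int[OF fe1 fe1, of L "{\<rho>}"]
    show ?case using insert c0 c1[OF \<rho>(2)] unfolding un[symmetric] int eun[symmetric] eint by simp
  qed (simp add: c0)
  thus ?thesis using split[of L] by simp
qed

end

locale localized_ext = localized ar D X for ar :: "'i \<Rightarrow> nat" and D :: "('i, 'a) lstruct" and X +
  fixes A A1 R0 R1 :: "'a set"
  assumes A: "ss A D" "X \<subseteq> A" "A \<subseteq> A1" and A1: "ss A1 D" "finite A1"
    and R: "transv A R0" "transv A1 R1" "R0 \<subseteq> R1"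
begin

definition newE :: "('i \<times> 'a set) set" where
  "newE = {(i, e) \<in> ed2 A1. \<not> e \<subseteq> A}"

definition newI :: "'a set \<Rightarrow> nat" where
  "newI L = card {(i, e) \<in> newE. e \<subseteq> span A1 L}"

lemma Au: "A \<subseteq> univ D" "A1 \<subseteq> univ D" "finite A" "R0 \<subseteq> A" "R1 \<subseteq> A1" "R0 \<subseteq> univ D" "R1 \<subseteq> univ D"
  "finite R0" "finite R1" "X \<subseteq> A1"
proof -
  show 1: "A \<subseteq> univ D" "A1 \<subseteq> univ D" "R0 \<subseteq> A" "R1 \<subseteq> A1" "X \<subseteq> A1"
    using A A1 R unfolding ss_def transv_def by auto
  thus "R0 \<subseteq> univ D" "R1 \<subseteq> univ D" by auto
  show "finite A" using A A1 finite_subset by metis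
  thus "finite R0" using 1 finite_subset by metis
  show "finite R1" using 1 A1 finite_subset by metis
qed

lemma finite_newE: "finite newE"
proof -
  have "newE \<subseteq> ed D A1" by (auto simp: newE_def ed2_def)
  thus ?thesis using finite_ed A1 finite_subset by blast
qed

lemma newI_mono: "L \<subseteq> L' \<Longrightarrow> newI L \<le> newI L'"
  unfolding newI_def
proof (rule card_mono)
  show "finite {(i, e) \<in> newE. e \<subseteq> span A1 L'}"
    by (rule finite_subset[OF _ finite_newE]) auto
  assume "L \<subseteq> L'"
  thus "{(i, e) \<in> newE. e \<subseteq> span A1 L} \<subseteq> {(i, e) \<in> newE. e \<subseteq> span A1 L'}"
    by (auto simp: span_def subset_iff)
qed

lemma span_Int_A:
  assumes "L \<subseteq> R1"
  shows "span A1 L \<inter> A = span A (L \<inter> R0)"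
proof -
  have "u \<in> span A (L \<inter> R0)" if u: "u \<in> A" "u \<in> span A1 L" for u
  proof (cases "u \<in> cl D X")
    case False
    obtain \<rho> where \<rho>: "\<rho> \<in> L" "u \<in> cl D (insert \<rho> X)" using u False by (auto simp: span_def)
    obtain \<sigma> where \<sigma>: "\<sigma> \<in> R0" "u \<in> cl D (insert \<sigma> X)" using u False R by (auto simp: transv_def)
    have "\<sigma> = \<rho>" by (rule transv_unique[OF R(2) Au(2)]) (use \<rho> \<sigma> assms R False in auto)
    thus ?thesis using \<rho> \<sigma> u by (auto simp: span_def)
  qed (use u in \<open>auto simp: span_def\<close>)
  thus ?thesis using A by (auto simp: span_def)
qed

text \<open>The difference of two applications of \<open>span_count\<close>: what has rank at most
  one cancels, leaving the new classes and the new relations of rank at least two.\<close>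

lemma dl_span:
  assumes L: "L \<subseteq> R1"
  shows "dl D (span A1 L) = dl D (span A (L \<inter> R0)) + int (card (L - R0)) - int (newI L)"
proof -
  have fL: "finite L" using L Au by (auto intro: finite_subset)
  have f: "finite (ed2 (span A1 L))"
    by (rule finite_subset[OF _ finite_ed[OF A1(2)]]) (auto simp: ed2_def ed_def span_def)
  have un: "ed2 (span A1 L) = ed2 (span A (L \<inter> R0)) \<union> {(i, e) \<in> newE. e \<subseteq> span A1 L}"
    unfolding span_Int_A[OF L, symmetric]
    by (auto simp: ed2_def ed_def newE_def span_def subset_iff)
  have "card (ed2 (span A1 L)) = card (ed2 (span A (L \<inter> R0))) + newI L"
    unfolding newI_def un
    using f[unfolded un] span_Int_A[OF L] by (intro card_Un_disjoint) (auto simp: newE_def ed2_def ed_def)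
  moreover have "card L = card (L \<inter> R0) + card (L - R0)"
    using fL by (metis card_Diff_subset_Int card_Int_Diff finite_Int)
  ultimately show ?thesis
    using span_count[OF A1 _ R(2) L] span_count[OF A(1) Au(3) A(2) R(1), of "L \<inter> R0"] Au by auto
qed

text \<open>
  The rank on \<open>A1\<close> is the minimum over supersets of the gain below, which refers to \<open>A\<close> only
  through ranks.  Two extensions with the same gain therefore have the same geometry.
\<close>

lemma rk_le_gain:
  assumes L: "L \<subseteq> R1"
  shows "rk L \<le> rk (L \<inter> R0) + int (card (L - R0)) - int (newI L)"
proof -
  have fL: "finite L" "L \<subseteq> univ D" using L Au by (auto intro: finite_subset)
  \<comment> \<open>Adding the old representatives in the closure of \<open>L \<inter> R0\<close>
    makes the part in \<open>A\<close> the trace of a closed set, whose predimension is its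
    dimension. No new class is added, and the count of new relations can only grow.\<close>
  define L' where "L' = L \<union> (R0 \<inter> cl D (X \<union> (L \<inter> R0)))"
  have L'R: "L' \<subseteq> R1" using L R by (auto simp: L'_def)
  have fL': "finite L'" "L' \<subseteq> univ D" using L'R Au by (auto intro: finite_subset)
  have ext: "L \<inter> R0 \<subseteq> cl D (X \<union> (L \<inter> R0))"
    using cl_extensive[of "X \<union> (L \<inter> R0)"] fL finX Xu by auto
  have e1: "L' \<inter> R0 = R0 \<inter> cl D (X \<union> (L \<inter> R0))" using ext by (auto simp: L'_def)
  have e2: "L' - R0 = L - R0" by (auto simp: L'_def)
  have "span A (L' \<inter> R0) = A \<inter> cl D (X \<union> (L \<inter> R0))"
    unfolding e1 using fL by (intro span_cl[OF R(1) Au(1)]) auto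
  hence "dl D (span A (L' \<inter> R0)) = dim D (X \<union> (L \<inter> R0))"
    using dim_closed[OF A(1) Au(3) A(2), of "L \<inter> R0"] Au by auto
  hence "dl D (span A1 L') = dim D X + rk (L \<inter> R0) + int (card (L - R0)) - int (newI L')"
    using dl_span[OF L'R] e2 by (simp add: rk_def)
  moreover have "dim D (X \<union> L) \<le> dl D (span A1 L')"
  proof (rule dim_le)
    have "X \<union> L' \<subseteq> span A1 L'" using L'R Au by (intro subset_span) auto
    thus "X \<union> L \<subseteq> span A1 L'" by (auto simp: L'_def)
    show "span A1 L' \<subseteq> univ D" "finite (span A1 L')" using Au A1 by (auto simp: span_def)
  qed
  moreover have "newI L \<le> newI L'" by (rule newI_mono) (auto simp: L'_def)
  ultimately show ?thesis by (simp add: rk_def)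
qed

text \<open>The minimum is attained at the representatives in \<open>cl D (X \<union> K)\<close>:
  both spans are then traces of this closed set, so their predimensions are dimensions.\<close>

lemma rk_eq_gain:
  assumes K: "K \<subseteq> R1"
  shows "\<exists>L. K \<subseteq> L \<and> L \<subseteq> R1 \<and> rk K = rk (L \<inter> R0) + int (card (L - R0)) - int (newI L)"
proof -
  have fK: "finite K" "K \<subseteq> univ D" using K Au by (auto intro: finite_subset)
  define L where "L = R1 \<inter> cl D (X \<union> K)"
  have LR: "L \<subseteq> R1" by (auto simp: L_def)
  have fL: "finite L" "L \<subseteq> univ D" using LR Au by (auto intro: finite_subset)
  have KL: "K \<subseteq> L" using cl_extensive[of "X \<union> K"] fK finX Xu K by (auto simp: L_def)
  have "span A1 L = A1 \<inter> cl D (X \<union> K)" unfolding L_def using fK by (intro span_cl[OF R(2) Au(2)])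
  hence 1: "dl D (span A1 L) = dim D (X \<union> K)"
    using dim_closed[OF A1 Au(10), of K] Au K by auto
  have "L \<inter> R0 = R0 \<inter> cl D (X \<union> K)" using R by (auto simp: L_def)
  hence F: "span A (L \<inter> R0) = A \<inter> cl D (X \<union> K)" using fK span_cl[OF R(1) Au(1)] by auto
  have "dl D (span A (L \<inter> R0)) = dim D (span A (L \<inter> R0))"
    using fK finX Xu by (intro dl_closed[OF A(1) Au(3) F]) auto
  moreover have "(X \<union> (L \<inter> R0)) \<union> span A (L \<inter> R0) = span A (L \<inter> R0)"
    using subset_span[of "L \<inter> R0" A] Au A by auto
  moreover have "dim D ((X \<union> (L \<inter> R0)) \<union> span A (L \<inter> R0)) = dim D (X \<union> (L \<inter> R0))"
    using fL finX Xu Au span_subset_cl[of "L \<inter> R0" A] by (intro dim_cl) (auto simp: span_def)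
  ultimately have "dim D (X \<union> K) = dim D (X \<union> (L \<inter> R0)) + int (card (L - R0)) - int (newI L)"
    using dl_span[OF LR] 1 by simp
  thus ?thesis using KL LR by (intro exI[of _ L]) (auto simp: rk_def)
qed

definition rep :: "'a \<Rightarrow> 'a" where
  "rep u = (SOME \<rho>. \<rho> \<in> R1 \<and> u \<in> cl D (insert \<rho> X))"

lemma rep:
  assumes "u \<in> A1" "u \<notin> cl D X"
  shows "rep u \<in> R1" "u \<in> cl D (insert (rep u) X)"
proof -
  have "\<exists>\<rho>. \<rho> \<in> R1 \<and> u \<in> cl D (insert \<rho> X)" using assms R by (auto simp: transv_def)
  from someI_ex[OF this] show "rep u \<in> R1" "u \<in> cl D (insert (rep u) X)" by (auto simp: rep_def)
qed

text \<open>Lets the number of new relations inside a span be read off from their classes, which is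
  all that the copy on the other side retains.\<close>

lemma subset_span_iff:
  assumes "e \<subseteq> A1" "L \<subseteq> R1"
  shows "e \<subseteq> span A1 L \<longleftrightarrow> rep ` (e - cl D X) \<subseteq> L"
proof
  assume a: "e \<subseteq> span A1 L"
  have "rep u \<in> L" if u: "u \<in> e" "u \<notin> cl D X" for u
  proof -
    obtain \<rho> where \<rho>: "\<rho> \<in> L" "u \<in> cl D (insert \<rho> X)" using u a by (auto simp: span_def)
    have "rep u = \<rho>" by (rule transv_unique[OF R(2) Au(2)]) (use \<rho> assms u rep in auto)
    thus ?thesis using \<rho> by simp
  qed
  thus "rep ` (e - cl D X) \<subseteq> L" by auto
next
  assume a: "rep ` (e - cl D X) \<subseteq> L"
  thus "e \<subseteq> span A1 L" using assms rep(2) by (fastforce simp: span_def)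
qed

text \<open>The representatives of the nonloops of \<open>e\<close> span all of \<open>e\<close>, so
  the classes of a copied relation have joint rank at least two.\<close>

lemma rk_rep:
  assumes "e \<subseteq> A1"
  shows "rk e \<le> rk (rep ` (e - cl D X))"
proof -
  let ?L = "rep ` (e - cl D X)"
  have LR: "?L \<subseteq> R1" using rep assms by auto
  have fL: "finite ?L" "?L \<subseteq> univ D" "finite e"
    using LR Au A1 assms by (auto intro: finite_subset)
  have "e \<subseteq> span A1 ?L" using subset_span_iff[OF assms LR] by simp
  hence "e \<subseteq> cl D (X \<union> ?L)" using span_subset_cl fL by blast
  hence "dim D (X \<union> ?L \<union> e) = dim D (X \<union> ?L)" using fL finX Xu by (intro dim_cl) auto
  moreover have "dim D (X \<union> e) \<le> dim D (X \<union> ?L \<union> e)"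
    using fL finX Xu assms Au by (intro dim_mono) auto
  ultimately show ?thesis by (simp add: rk_def)
qed

end

section \<open>Embeddings and minimally simply algebraic extensions\<close>

lemma embedding_rel_iff: "embedding f A B \<Longrightarrow> e \<subseteq> univ A \<Longrightarrow> f ` e \<in> rel B i \<longleftrightarrow> e \<in> rel A i"
  by (auto simp: embedding_def)

lemma embedding_subset: "embedding f A B \<Longrightarrow> S \<subseteq> univ A \<Longrightarrow> f ` S \<subseteq> univ B"
  by (auto simp: embedding_def)

lemma embedding_inj: "embedding f A B \<Longrightarrow> inj_on f (univ A)"
  by (simp add: embedding_def)

lemma embedding_comp:
  assumes f: "embedding f A B" and g: "embedding g B C"
  shows "embedding (g \<circ> f) A C"
proof -
  have "inj_on (g \<circ> f) (univ A)"
    using f g by (auto simp: embedding_def intro: comp_inj_on inj_on_subset)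
  moreover have "e \<in> rel A i \<longleftrightarrow> (g \<circ> f) ` e \<in> rel C i" if "e \<subseteq> univ A" for e i
  proof -
    have "f ` e \<subseteq> univ B" using f that by (rule embedding_subset)
    thus ?thesis using embedding_rel_iff[OF f that] embedding_rel_iff[OF g]
      unfolding image_comp[symmetric] by blast
  qed
  moreover have "(g \<circ> f) ` univ A \<subseteq> univ C"
    using embedding_subset[OF g embedding_subset[OF f order_refl]] by (simp add: image_comp)
  ultimately show ?thesis unfolding embedding_def by blast
qed

lemma embedding_pull:
  assumes f: "embedding f A B" and S: "S \<subseteq> univ A" and e: "e \<in> rel B i" "e \<subseteq> f ` S"
  obtains e' where "e' \<in> rel A i" "e' \<subseteq> S" "e = f ` e'"
proof -
  have eq: "f ` {x \<in> S. f x \<in> e} = e" using e by auto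
  moreover have "{x \<in> S. f x \<in> e} \<in> rel A i"
    using embedding_rel_iff[OF f, of "{x \<in> S. f x \<in> e}" i] eq e S by auto
  ultimately show thesis using that[of "{x \<in> S. f x \<in> e}"] by auto
qed

lemma embedding_dl:
  assumes L: "language ar" and A: "is_lstruct ar A" and B: "is_lstruct ar B"
    and f: "embedding f A B" and S: "S \<subseteq> univ A" "finite S"
  shows "dl B (f ` S) = dl A S"
proof -
  interpret A: lang_struct ar A using L A by unfold_locales
  interpret B: lang_struct ar B using L B by unfold_locales
  have inj: "inj_on f S" using embedding_inj[OF f] S inj_on_subset by blast
  have "ed B (f ` S) = (\<lambda>(i, e). (i, f ` e)) ` ed A S"
  proof
    show "ed B (f ` S) \<subseteq> (\<lambda>(i, e). (i, f ` e)) ` ed A S"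
    proof clarify
      fix i e assume "(i, e) \<in> ed B (f ` S)"
      then obtain e' where "e' \<in> rel A i" "e' \<subseteq> S" "e = f ` e'"
        using embedding_pull[OF f S(1)] by (auto simp: ed_def)
      thus "(i, e) \<in> (\<lambda>(i, e). (i, f ` e)) ` ed A S" by (force simp: ed_def)
    qed
    show "(\<lambda>(i, e). (i, f ` e)) ` ed A S \<subseteq> ed B (f ` S)"
      using embedding_rel_iff[OF f] S by (auto simp: ed_def)
  qed
  moreover have "inj_on (\<lambda>(i, e). (i, f ` e)) (ed A S)"
    using inj_on_image_eq_iff[OF inj] by (auto simp: inj_on_def ed_def)
  ultimately have "card (ed B (f ` S)) = card (ed A S)" by (simp add: card_image)
  thus ?thesis using S inj by (simp add: A.dl_eq B.dl_eq card_image)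
qed

lemma embedding_C0:
  assumes L: "language ar" and A: "is_lstruct ar A" "finite (univ A)"
    and f: "embedding f A B" and B: "B \<in> C0 ar"
  shows "A \<in> C0 ar"
proof -
  have "0 \<le> dl A S" if "S \<subseteq> univ A" for S
    using embedding_dl[OF L A(1) C0D(1)[OF B] f that] C0D(3)[OF B embedding_subset[OF f that]]
      finite_subset[OF that A(2)] by simp
  thus ?thesis using A by (simp add: C0_def)
qed

lemma CmuI:
  assumes "A \<in> C0 ar"
    and "\<And>Y Z h F. msa ar Y Z \<Longrightarrow> embedding h (restr Z Y) A \<Longrightarrow>
      (\<forall>j \<le> \<mu> Y Z. embedding (F j) Z A \<and> (\<forall>y \<in> Y. F j y = h y)) \<Longrightarrow>
      disjoint_family_on (\<lambda>j. F j ` (univ Z - Y)) {..\<mu> Y Z} \<Longrightarrow> False"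
  shows "A \<in> Cmu ar \<mu>"
  unfolding Cmu_def mem_Collect_eq
proof (intro conjI allI impI notI)
  fix Y Z
  assume m: "msa ar Y Z" and "\<exists>h F. embedding h (restr Z Y) A \<and>
          (\<forall>j \<le> \<mu> Y Z. embedding (F j) Z A \<and> (\<forall>y \<in> Y. F j y = h y)) \<and>
          disjoint_family_on (\<lambda>j. F j ` (univ Z - Y)) {..\<mu> Y Z}"
  then obtain h F where "embedding h (restr Z Y) A"
    "\<forall>j \<le> \<mu> Y Z. embedding (F j) Z A \<and> (\<forall>y \<in> Y. F j y = h y)"
    "disjoint_family_on (\<lambda>j. F j ` (univ Z - Y)) {..\<mu> Y Z}" by (elim exE conjE)
  thus False by (rule assms(2)[OF m])
qed (rule assms(1))

lemma CmuD:
  assumes "A \<in> Cmu ar \<mu>" "msa ar Y Z" "embedding h (restr Z Y) A"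
    "\<forall>j \<le> \<mu> Y Z. embedding (F j) Z A \<and> (\<forall>y \<in> Y. F j y = h y)"
    "disjoint_family_on (\<lambda>j. F j ` (univ Z - Y)) {..\<mu> Y Z}"
  shows False
proof -
  have "\<forall>Y Z. msa ar Y Z \<longrightarrow>
     \<not> (\<exists>h F. embedding h (restr Z Y) A \<and>
          (\<forall>j \<le> \<mu> Y Z. embedding (F j) Z A \<and> (\<forall>y \<in> Y. F j y = h y)) \<and>
          disjoint_family_on (\<lambda>j. F j ` (univ Z - Y)) {..\<mu> Y Z})"
    using assms(1) unfolding Cmu_def mem_Collect_eq by (rule conjunct2)
  from this[rule_format, OF assms(2)] show False
    by (rule notE) (intro exI conjI, fact+)
qed

text \<open>A forbidden family of copies in \<open>A\<close> is carried by \<open>f\<close> to one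
  in \<open>B\<close>, so the class is closed under all substructures and not merely the
  self-sufficient ones.\<close>

lemma embedding_Cmu:
  assumes L: "language ar" and A: "is_lstruct ar A" "finite (univ A)"
    and f: "embedding f A B" and B: "B \<in> Cmu ar \<mu>"
  shows "A \<in> Cmu ar \<mu>"
proof -
  have B0: "B \<in> C0 ar" using B by (simp add: Cmu_def)
  have "False" if m: "msa ar Y Z" and h: "embedding h (restr Z Y) A"
    and F: "\<forall>j \<le> \<mu> Y Z. embedding (F j) Z A \<and> (\<forall>y \<in> Y. F j y = h y)"
    and d: "disjoint_family_on (\<lambda>j. F j ` (univ Z - Y)) {..\<mu> Y Z}" for Y Z h F
  proof -
    have 1: "embedding (f \<circ> h) (restr Z Y) B" using h f by (rule embedding_comp)
    have 2: "\<forall>j \<le> \<mu> Y Z. embedding (f \<circ> F j) Z B \<and> (\<forall>y \<in> Y. (f \<circ> F j) y = (f \<circ> h) y)"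
      using F by (auto intro: embedding_comp[OF _ f])
    have 3: "disjoint_family_on (\<lambda>j. (f \<circ> F j) ` (univ Z - Y)) {..\<mu> Y Z}"
      unfolding disjoint_family_on_def
    proof (intro ballI impI)
      fix j k assume jk: "j \<in> {..\<mu> Y Z}" "k \<in> {..\<mu> Y Z}" "j \<noteq> k"
      have "F j ` (univ Z - Y) \<subseteq> univ A" "F k ` (univ Z - Y) \<subseteq> univ A"
        using F jk embedding_subset[of "F j" Z A "univ Z - Y"] embedding_subset[of "F k" Z A "univ Z - Y"] by auto
      moreover have "F j ` (univ Z - Y) \<inter> F k ` (univ Z - Y) = {}"
        using d jk by (auto simp: disjoint_family_on_def)
      ultimately have "f ` (F j ` (univ Z - Y)) \<inter> f ` (F k ` (univ Z - Y)) = {}"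
        using inj_on_image_Int[OF embedding_inj[OF f]] by (metis image_empty)
      thus "(f \<circ> F j) ` (univ Z - Y) \<inter> (f \<circ> F k) ` (univ Z - Y) = {}" by (simp add: image_comp)
    qed
    show False by (rule CmuD[OF B m 1 2 3])
  qed
  thus ?thesis using embedding_C0[OF L A f B0] by (intro CmuI)
qed

lemma msaD:
  assumes "msa ar Y Z"
  shows "Z \<in> C0 ar" "Y \<subseteq> univ Z" "Y \<noteq> univ Z" "dl Z Y = delta Z" "is_lstruct ar Z" "finite (univ Z)"
    "\<And>S. Y \<subseteq> S \<Longrightarrow> S \<subseteq> univ Z \<Longrightarrow> dl Z Y \<le> dl Z S"
    "\<And>S. Y \<subset> S \<Longrightarrow> S \<subset> univ Z \<Longrightarrow> dl Z Y < dl Z S"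
    "\<And>Y'. Y' \<subset> Y \<Longrightarrow> \<not> simply_algebraic ar Y' (restr Z (Y' \<union> (univ Z - Y)))"
proof -
  have s: "simply_algebraic ar Y Z" using assms by (simp add: msa_def)
  hence a: "algebraic ar Y Z" by (simp add: simply_algebraic_def)
  thus "Z \<in> C0 ar" "Y \<subseteq> univ Z" "Y \<noteq> univ Z" "dl Z Y = delta Z"
    by (auto simp: algebraic_def ss_fin_def)
  thus "is_lstruct ar Z" "finite (univ Z)" by (auto simp: C0_def)
  show "\<And>S. Y \<subseteq> S \<Longrightarrow> S \<subseteq> univ Z \<Longrightarrow> dl Z Y \<le> dl Z S" using a by (auto simp: algebraic_def ss_fin_def)
  show "\<And>S. Y \<subset> S \<Longrightarrow> S \<subset> univ Z \<Longrightarrow> dl Z Y < dl Z S" using s by (auto simp: simply_algebraic_def)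
  show "\<And>Y'. Y' \<subset> Y \<Longrightarrow> \<not> simply_algebraic ar Y' (restr Z (Y' \<union> (univ Z - Y)))"
    using assms by (auto simp: msa_def)
qed

text \<open>Minimality of the base: a point \<open>y\<close> in no relation that leaves
  \<open>Y\<close> could be dropped, and the same points would still be simply algebraic over
  \<open>Y - {y}\<close>.\<close>

lemma msa_touch:
  assumes L: "language ar" and m: "msa ar Y Z" and y: "y \<in> Y"
  obtains i e where "e \<in> rel Z i" "y \<in> e" "\<not> e \<subseteq> Y"
proof -
  note mD = msaD[OF m]
  interpret Z: lang_struct ar Z using L mD by unfold_locales
  have "\<exists>i. \<exists>e\<in>rel Z i. y \<in> e \<and> \<not> e \<subseteq> Y"
  proof (rule ccontr)
    assume c: "\<not> (\<exists>i. \<exists>e\<in>rel Z i. y \<in> e \<and> \<not> e \<subseteq> Y)"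
    define Y' where "Y' = Y - {y}"
    have YY: "Y' \<subset> Y" using y by (auto simp: Y'_def)
    let ?Z = "restr Z (Y' \<union> (univ Z - Y))"
    have fY: "finite Y" using mD(2,6) finite_subset by blast
    \<comment> \<open>No relation joins \<open>y\<close> to points outside \<open>Y\<close>, so
      deleting \<open>y\<close> shifts the predimensions of all sets between base and extension by
      the same amount.\<close>
    have key: "dl Z (Y' \<union> S) = dl Z Y' + dl Z (Y \<union> S) - dl Z Y" if S: "S \<subseteq> univ Z - Y" for S
    proof -
      have fS: "finite S" using S mD(6) by (auto intro: finite_subset)
      have e1: "ed Z (Y \<union> S) = ed Z Y \<union> ed Z (Y' \<union> S)"
        using c by (auto simp: ed_def Y'_def)
      have "Y \<inter> (Y' \<union> S) = Y'" "Y \<union> (Y' \<union> S) = Y \<union> S" using S by (auto simp: Y'_def)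
      moreover have "int (card (ed Z Y \<union> ed Z (Y' \<union> S))) + int (card (ed Z Y \<inter> ed Z (Y' \<union> S)))
         = int (card (ed Z Y)) + int (card (ed Z (Y' \<union> S)))"
        using fY fS by (intro card_Int_Un_int Z.finite_ed) (auto simp: Y'_def)
      moreover have "int (card (Y \<union> (Y' \<union> S))) + int (card (Y \<inter> (Y' \<union> S))) = int (card Y) + int (card (Y' \<union> S))"
        using fY fS by (intro card_Int_Un_int) (auto simp: Y'_def)
      ultimately show ?thesis using fY fS
        by (simp add: Z.dl_eq e1 ed_Int[symmetric] Y'_def)
    qed
    have "simply_algebraic ar Y' ?Z"
      unfolding simply_algebraic_def algebraic_def ss_fin_def
    proof (intro conjI allI impI)
      show "?Z \<in> C0 ar" using mD(1,2) by (intro C0_restr) (auto simp: Y'_def)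
      show "Y' \<subseteq> univ ?Z" by auto
      show "Y' \<noteq> univ ?Z" using mD(2,3) by (auto simp: Y'_def)
      have "Y \<union> (univ Z - Y) = univ Z" using mD(2) by auto
      thus "dl ?Z Y' = delta ?Z" using key[of "univ Z - Y"] mD(4,5) by simp
    next
      fix S assume S: "Y' \<subseteq> S \<and> S \<subseteq> univ ?Z"
      define S0 where "S0 = S - Y'"
      have S0: "S0 \<subseteq> univ Z - Y" "S = Y' \<union> S0" using S by (auto simp: S0_def)
      have "dl Z Y \<le> dl Z (Y \<union> S0)" using S0 mD(2) by (intro mD(7)) auto
      thus "dl ?Z Y' \<le> dl ?Z S" using key[OF S0(1)] S S0(2) by simp
    next
      fix S assume S: "Y' \<subset> S \<and> S \<subset> univ ?Z"
      define S0 where "S0 = S - Y'"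
      have S0: "S0 \<subseteq> univ Z - Y" "S = Y' \<union> S0" using S by (auto simp: S0_def)
      have "dl Z Y < dl Z (Y \<union> S0)" using S S0 mD(2) by (intro mD(8)) auto
      moreover have "S \<subseteq> Y' \<union> (univ Z - Y)" using S0 by auto
      ultimately show "dl ?Z Y' < dl ?Z S" using key[OF S0(1)] S0(2) by simp
    qed
    thus False using mD(9)[OF YY] by simp
  qed
  thus thesis using that by blast
qed

text \<open>The point \<open>v\<close> brings at least one relation, so \<open>insert v Y\<close>
  has no larger predimension than \<open>Y\<close> and must be all of \<open>Z\<close>. Equality of
  predimensions leaves no room for a second relation, and \<open>msa_touch\<close> then puts every
  base point into \<open>e\<close>.\<close>

lemma msa_single:
  assumes L: "language ar" and m: "msa ar Y Z" and e: "e \<in> rel Z i" "v \<in> e" "v \<notin> Y" "e \<subseteq> insert v Y"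
  shows "univ Z = e" "Y = e - {v}"
proof -
  note mD = msaD[OF m]
  interpret Z: lang_struct ar Z using L mD by unfold_locales
  have fY: "finite Y" using mD(2,6) finite_subset by blast
  have v: "v \<in> univ Z" using e Z.relD by auto
  have card_ge: "card (ed Z Y) + card E \<le> card (ed Z (insert v Y))"
    if E: "E \<subseteq> ed Z (insert v Y)" "\<forall>(i, e)\<in>E. \<not> e \<subseteq> Y" for E
  proof -
    have f: "finite (ed Z (insert v Y))" using fY Z.finite_ed by simp
    have "ed Z Y \<inter> E = {}" using E(2) by (auto simp: ed_def)
    moreover have "finite E" "finite (ed Z Y)" using finite_subset[OF E(1) f] fY Z.finite_ed by auto
    ultimately have "card (ed Z Y) + card E = card (ed Z Y \<union> E)" by (simp add: card_Un_disjoint)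
    also have "\<dots> \<le> card (ed Z (insert v Y))" using E(1) f ed_mono[of Y "insert v Y"] by (intro card_mono) auto
    finally show ?thesis .
  qed
  have "dl Z (insert v Y) \<le> dl Z Y"
  proof -
    have "card (ed Z Y) + card {(i, e)} \<le> card (ed Z (insert v Y))"
      using e by (intro card_ge) (auto simp: ed_def)
    thus ?thesis using e(3) fY by (simp add: Z.dl_eq)
  qed
  hence Z: "univ Z = insert v Y" using mD(8)[of "insert v Y"] mD(2) e v by (metis insertI1 insert_subset not_less psubsetI subset_insertI)
  have dle: "dl Z (insert v Y) = dl Z Y" using mD(4,5) Z by (metis restr_univ)
  have "y \<in> e" if y: "y \<in> Y" for y
  proof -
    obtain i' e' where e': "e' \<in> rel Z i'" "y \<in> e'" "\<not> e' \<subseteq> Y" using msa_touch[OF L m y] .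
    have "(i', e') = (i, e)"
    proof (rule ccontr)
      assume ne: "(i', e') \<noteq> (i, e)"
      have "e' \<subseteq> insert v Y" using Z.relD(1)[OF e'(1)] Z by simp
      hence "card (ed Z Y) + card {(i, e), (i', e')} \<le> card (ed Z (insert v Y))"
        using e e' by (intro card_ge) (auto simp: ed_def)
      moreover have "card {(i, e), (i', e')} = 2" using ne by (simp add: card_2_iff) blast
      ultimately show False using dle e(3) fY by (simp add: Z.dl_eq)
    qed
    thus ?thesis using e' by simp
  qed
  thus "univ Z = e" "Y = e - {v}" using Z e by auto
qed

section \<open>Copying new relations along chains of fresh parallel points\<close>

text \<open>
  \<open>Rep\<close> indexes the classes of the extended structure and \<open>old\<close> those already present in \<open>B\<close>, with
  representative \<open>vt \<rho> 0 \<in> B\<close>; \<open>Lp\<close> is the set of loops of \<open>B\<close>.  The points \<open>vt \<rho> 0, \<dots>, vt \<rho> T\<close> form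
  the chain of the class \<open>\<rho>\<close>.  Each \<open>q \<in> Q\<close> stands for a relation to be copied: \<open>fl q\<close> lists the chain
  points replacing its nonloops and \<open>lo q\<close> the loops replacing its loops.  The rank to be
  realized is \<open>r\<close>.
\<close>

locale gadget =
  fixes ar :: "'i \<Rightarrow> nat" and B :: "('i, 'v) lstruct" and Lp xs :: "'v set" and i0 :: 'i
    and Rep old :: "'c set" and vt :: "'c \<Rightarrow> nat \<Rightarrow> 'v" and T :: nat
    and Q :: "'q set" and sy :: "'q \<Rightarrow> 'i" and fl :: "'q \<Rightarrow> ('c \<times> nat) set" and lo :: "'q \<Rightarrow> 'v set"
    and r :: "'c set \<Rightarrow> int"
  assumes lang: "language ar" and B: "B \<in> C0 ar"
    and Lp: "Lp \<subseteq> univ B" and xs: "xs \<subseteq> Lp" "card xs = ar i0 - 2"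
    and Rep: "finite Rep" "old \<subseteq> Rep"
    and vt_inj: "\<And>\<rho> \<sigma> j k. \<rho> \<in> Rep \<Longrightarrow> \<sigma> \<in> Rep \<Longrightarrow> j \<le> T \<Longrightarrow> k \<le> T \<Longrightarrow> vt \<rho> j = vt \<sigma> k \<Longrightarrow> \<rho> = \<sigma> \<and> j = k"
    and vt_B: "\<And>\<rho> j. \<rho> \<in> Rep \<Longrightarrow> j \<le> T \<Longrightarrow> vt \<rho> j \<in> univ B \<longleftrightarrow> j = 0 \<and> \<rho> \<in> old"
    and vt_Lp: "\<And>\<rho>. \<rho> \<in> old \<Longrightarrow> vt \<rho> 0 \<notin> Lp"
    and Q: "finite Q"
    and fl: "\<And>q. q \<in> Q \<Longrightarrow> fl q \<subseteq> Rep \<times> {1..T}" "\<And>q. q \<in> Q \<Longrightarrow> fl q \<noteq> {}"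
    and fl_disj: "\<And>q q'. q \<in> Q \<Longrightarrow> q' \<in> Q \<Longrightarrow> q \<noteq> q' \<Longrightarrow> fl q \<inter> fl q' = {}"
    and lo: "\<And>q. q \<in> Q \<Longrightarrow> lo q \<subseteq> Lp - xs"
    and card_te: "\<And>q. q \<in> Q \<Longrightarrow> card (fl q) + card (lo q) = ar (sy q)"
    and r_mono: "\<And>L L'. L \<subseteq> L' \<Longrightarrow> L' \<subseteq> Rep \<Longrightarrow> r L \<le> r L'"
    and r_gain: "\<And>L. L \<subseteq> Rep \<Longrightarrow>
       r L \<le> r (L \<inter> old) + int (card (L - old)) - int (card {q \<in> Q. fst ` fl q \<subseteq> L})"
    and r_eq: "\<And>K. K \<subseteq> Rep \<Longrightarrow> \<exists>L. K \<subseteq> L \<and> L \<subseteq> Rep \<and>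
       r K = r (L \<inter> old) + int (card (L - old)) - int (card {q \<in> Q. fst ` fl q \<subseteq> L})"
    and r1: "\<And>\<rho>. \<rho> \<in> Rep \<Longrightarrow> 1 \<le> r {\<rho>}" and r2: "\<And>q. q \<in> Q \<Longrightarrow> 2 \<le> r (fst ` fl q)"
    and rB_ge: "\<And>J U. J \<subseteq> old \<Longrightarrow> U \<subseteq> univ B \<Longrightarrow> Lp \<subseteq> U \<Longrightarrow> (\<lambda>\<rho>. vt \<rho> 0) ` J \<subseteq> U \<Longrightarrow>
       dl B Lp + r J \<le> dl B U"
    and rB_le: "\<And>J. J \<subseteq> old \<Longrightarrow> \<exists>U. U \<subseteq> univ B \<and> Lp \<subseteq> U \<and> (\<lambda>\<rho>. vt \<rho> 0) ` J \<subseteq> U \<and>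
       dl B U \<le> dl B Lp + r J"
begin

definition vx :: "'c \<times> nat \<Rightarrow> 'v" where "vx p = vt (fst p) (snd p)"

text \<open>The edge lowers the predimension by the one unit that its upper chain point adds, so a
  class keeps one degree of freedom however long its chain is.\<close>

definition link :: "'c \<times> nat \<Rightarrow> 'v set" where
  "link p = xs \<union> {vt (fst p) (snd p), vt (fst p) (Suc (snd p))}"

definition te :: "'q \<Rightarrow> 'v set" where "te q = vx ` fl q \<union> lo q"

definition B1 :: "('i, 'v) lstruct" where
  "B1 = \<lparr>univ = univ B \<union> vx ` (Rep \<times> {..T}),
     rel = (\<lambda>i. rel B i \<union> {e. i = i0 \<and> (\<exists>p \<in> Rep \<times> {..<T}. e = link p)}
        \<union> {e. \<exists>q\<in>Q. sy q = i \<and> e = te q})\<rparr>"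

lemma univ_B1: "univ B1 = univ B \<union> vx ` (Rep \<times> {..T})"
  by (simp add: B1_def)

lemma rel_B1: "e \<in> rel B1 i \<longleftrightarrow> e \<in> rel B i \<or> (i = i0 \<and> (\<exists>p \<in> Rep \<times> {..<T}. e = link p))
   \<or> (\<exists>q\<in>Q. sy q = i \<and> e = te q)"
  by (auto simp: B1_def)

lemma finB: "finite (univ B)" "is_lstruct ar B"
  using C0D[OF B] by auto

lemma finLp: "finite Lp" "finite xs"
  using finB Lp xs finite_subset by metis+

lemma ar3: "ar i \<ge> 3"
  using lang by (simp add: language_def)

lemma xs_ne: "xs \<noteq> {}"
  using xs(2) ar3[of i0] by auto

lemma vt_notLp: "\<rho> \<in> Rep \<Longrightarrow> j \<le> T \<Longrightarrow> vt \<rho> j \<notin> Lp"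
  using vt_B[of \<rho> j] vt_Lp[of \<rho>] Lp by auto

lemma inj_vx: "inj_on vx (Rep \<times> {..T})"
  by (auto simp: inj_on_def vx_def dest: vt_inj)

lemma vx_fl:
  assumes "q \<in> Q" "v \<in> vx ` fl q"
  obtains \<rho> j where "(\<rho>, j) \<in> fl q" "v = vt \<rho> j" "\<rho> \<in> Rep" "1 \<le> j" "j \<le> T" "v \<notin> univ B"
proof -
  from assms obtain p where p: "p \<in> fl q" "v = vx p" by auto
  obtain \<rho> j where \<rho>: "p = (\<rho>, j)" by (cases p)
  hence "\<rho> \<in> Rep" "1 \<le> j" "j \<le> T" using fl(1)[OF assms(1)] p by auto
  moreover hence "v \<notin> univ B" using p \<rho> vt_B by (simp add: vx_def)
  ultimately show thesis using that[of \<rho> j] p \<rho> by (simp add: vx_def)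
qed

lemma vx_notB: "q \<in> Q \<Longrightarrow> p \<in> fl q \<Longrightarrow> vx p \<notin> univ B"
  using fl(1)[of q] vt_B by (force simp: vx_def)

lemma card_link: "p \<in> Rep \<times> {..<T} \<Longrightarrow> finite (link p) \<and> card (link p) = ar i0"
proof -
  assume p: "p \<in> Rep \<times> {..<T}"
  obtain \<rho> j where \<rho>: "p = (\<rho>, j)" "\<rho> \<in> Rep" "j < T" using p by auto
  have "vt \<rho> j \<noteq> vt \<rho> (Suc j)" using vt_inj[of \<rho> \<rho> j "Suc j"] \<rho> by auto
  moreover have "vt \<rho> j \<notin> xs" "vt \<rho> (Suc j) \<notin> xs" using vt_notLp[of \<rho>] xs \<rho> by fastforce+
  ultimately show ?thesis using finLp xs ar3[of i0] by (simp add: link_def \<rho>)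
qed

lemma card_te': "q \<in> Q \<Longrightarrow> finite (te q) \<and> card (te q) = ar (sy q)"
proof -
  assume q: "q \<in> Q"
  have f: "finite (fl q)" using fl(1)[OF q] Rep by (meson finite_SigmaI finite_atLeastAtMost finite_subset)
  have "fl q \<subseteq> Rep \<times> {..T}" using fl(1)[OF q] by auto
  hence "card (vx ` fl q) = card (fl q)" using inj_vx inj_on_subset card_image by metis
  moreover have "vx ` fl q \<inter> lo q = {}" using lo[OF q] Lp vx_notB[OF q] by blast
  moreover have "finite (lo q)" using lo[OF q] finLp finite_subset by (metis Diff_subset order_trans)
  ultimately show ?thesis using f card_te[OF q] by (simp add: te_def card_Un_disjoint)
qed

lemma str_B1: "is_lstruct ar B1"
  unfolding is_lstruct_def
proof (intro allI ballI)
  fix i e assume e: "e \<in> rel B1 i"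
  then consider "e \<in> rel B i" | p where "i = i0" "p \<in> Rep \<times> {..<T}" "e = link p"
    | q where "q \<in> Q" "sy q = i" "e = te q" by (auto simp: rel_B1)
  thus "e \<subseteq> univ B1 \<and> finite e \<and> card e = ar i"
  proof cases
    case 1
    thus ?thesis using finB(2) by (auto simp: is_lstruct_def univ_B1)
  next
    case 2
    obtain \<rho> j where \<rho>: "p = (\<rho>, j)" "\<rho> \<in> Rep" "j < T" using 2 by auto
    have "vx (\<rho>, j) \<in> univ B1" "vx (\<rho>, Suc j) \<in> univ B1"
      using \<rho> by (auto simp: univ_B1 intro!: imageI)
    hence "link p \<subseteq> univ B1" using xs Lp by (auto simp: link_def univ_B1 vx_def \<rho>)
    thus ?thesis using 2 card_link by auto
  next
    case 3
    have "te q \<subseteq> univ B1" using 3 fl(1)[of q] lo[of q] Lp by (fastforce simp: te_def univ_B1)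
    thus ?thesis using 3 card_te' by auto
  qed
qed

sublocale b: lang_struct ar B using lang finB by unfold_locales
sublocale b1: lang_struct ar B1 using lang str_B1 by unfold_locales

lemma finB1: "finite (univ B1)"
  using finB Rep by (simp add: univ_B1)

lemma link_new: "p \<in> Rep \<times> {..<T} \<Longrightarrow> \<not> link p \<subseteq> univ B"
  using vt_B[of "fst p" "Suc (snd p)"] by (auto simp: link_def)

lemma te_new:
  assumes "q \<in> Q"
  shows "\<not> te q \<subseteq> univ B"
proof -
  obtain p where p: "p \<in> fl q" using fl(2)[OF assms] by auto
  hence "vx p \<notin> univ B" by (rule vx_notB[OF assms])
  thus ?thesis using p by (auto simp: te_def)
qed

lemma rel_B1_B: "e \<subseteq> univ B \<Longrightarrow> e \<in> rel B1 i \<longleftrightarrow> e \<in> rel B i"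
  using link_new te_new by (auto simp: rel_B1)

lemma restr_B1: "S \<subseteq> univ B \<Longrightarrow> restr B1 S = restr B S"
  using rel_B1_B by (auto simp: restr_def fun_eq_iff)

lemma xs_te: "q \<in> Q \<Longrightarrow> xs \<inter> te q = {}"
  using lo[of q] xs Lp vx_notB[of q] unfolding te_def by blast

lemma inj_link: "inj_on link (Rep \<times> {..<T})"
proof (rule inj_onI)
  fix p q assume p: "p \<in> Rep \<times> {..<T}" and q: "q \<in> Rep \<times> {..<T}" and eq: "link p = link q"
  obtain \<rho> j \<sigma> k where \<rho>: "p = (\<rho>, j)" "q = (\<sigma>, k)" "\<rho> \<in> Rep" "\<sigma> \<in> Rep" "j < T" "k < T" using p q by auto
  have "vt \<rho> (Suc j) \<in> link q" "vt \<sigma> (Suc k) \<in> link p" using eq \<rho> by (auto simp: link_def)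
  moreover have "vt \<rho> (Suc j) \<notin> xs" "vt \<sigma> (Suc k) \<notin> xs" using vt_notLp[of \<rho> "Suc j"] vt_notLp[of \<sigma> "Suc k"] xs \<rho> by auto
  ultimately have 1: "vt \<rho> (Suc j) = vt \<sigma> k \<or> vt \<rho> (Suc j) = vt \<sigma> (Suc k)"
    and 2: "vt \<sigma> (Suc k) = vt \<rho> j \<or> vt \<sigma> (Suc k) = vt \<rho> (Suc j)" using \<rho> by (auto simp: link_def)
  have "\<rho> = \<sigma> \<and> (Suc j = k \<or> j = k)"
    using 1 vt_inj[of \<rho> \<sigma> "Suc j" k] vt_inj[of \<rho> \<sigma> "Suc j" "Suc k"] \<rho> by auto
  moreover have "Suc k = j \<or> j = k"
    using 2 vt_inj[of \<sigma> \<rho> "Suc k" j] vt_inj[of \<sigma> \<rho> "Suc k" "Suc j"] \<rho> by auto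
  ultimately show "p = q" using \<rho> by auto
qed

lemma te_unique:
  assumes q: "q \<in> Q" "q' \<in> Q" and v: "v \<in> te q" "v \<in> te q'" "v \<notin> univ B"
  shows "q = q'"
proof -
  have "v \<in> vx ` fl q" "v \<in> vx ` fl q'" using v lo[OF q(1)] lo[OF q(2)] Lp by (auto simp: te_def)
  then obtain \<rho> j \<sigma> k where 1: "(\<rho>, j) \<in> fl q" "v = vt \<rho> j" "(\<sigma>, k) \<in> fl q'" "v = vt \<sigma> k"
      "\<rho> \<in> Rep" "\<sigma> \<in> Rep" "j \<le> T" "k \<le> T"
    by (elim vx_fl[OF q(1)] vx_fl[OF q(2)]) blast
  hence "(\<rho>, j) = (\<sigma>, k)" using vt_inj[of \<rho> \<sigma> j k] by auto
  thus ?thesis using 1 fl_disj[OF q] by auto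
qed

lemma inj_te: "inj_on te Q"
proof (rule inj_onI)
  fix q q' assume "q \<in> Q" "q' \<in> Q" "te q = te q'"
  thus "q = q'" using te_new[of q] te_unique[of q q'] by auto
qed

section \<open>Counting the predimension of the extended structure\<close>

definition nw :: "'v set \<Rightarrow> ('c \<times> nat) set" where
  "nw U = {p \<in> Rep \<times> {..T}. vx p \<in> U - univ B}"
definition Lk :: "'v set \<Rightarrow> ('c \<times> nat) set" where
  "Lk U = {p \<in> Rep \<times> {..<T}. link p \<subseteq> U}"
definition Tq :: "'v set \<Rightarrow> 'q set" where
  "Tq U = {q \<in> Q. te q \<subseteq> U}"
definition Kl :: "'v set \<Rightarrow> 'c set" where
  "Kl U = {\<rho> \<in> Rep. \<exists>j\<le>T. vt \<rho> j \<in> U}"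
text \<open>Classes that \<open>U\<close> meets without containing an old representative of theirs.
  The lowest chain point of such a class in \<open>U\<close> is a new point that no link inside
  \<open>U\<close> pays for.\<close>

definition Fr :: "'v set \<Rightarrow> 'c set" where
  "Fr U = {\<rho> \<in> Kl U. \<not> (\<rho> \<in> old \<and> vt \<rho> 0 \<in> U)}"

lemma fin_idx: "finite (nw U)" "finite (Lk U)" "finite (Tq U)" "finite (Kl U)" "finite (Fr U)"
  using Rep Q by (auto simp: nw_def Lk_def Tq_def Kl_def Fr_def)

text \<open>The three kinds of relations never coincide: old ones lie in \<open>B\<close> and the
  others do not, links contain the nonempty set \<open>xs\<close>, and copied relations avoid
  it.\<close>

lemma dl_B1:
  assumes U: "U \<subseteq> univ B1"
  shows "dl B1 U = dl B (U \<inter> univ B) + int (card (nw U)) - int (card (Lk U)) - int (card (Tq U))"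
proof -
  have fU: "finite U" using U finB1 finite_subset by blast
  have "U - univ B = vx ` nw U" using U by (auto simp: univ_B1 nw_def)
  moreover have "inj_on vx (nw U)" by (rule inj_on_subset[OF inj_vx]) (auto simp: nw_def)
  ultimately have "card (U - univ B) = card (nw U)" by (simp add: card_image)
  moreover have "card U = card (U \<inter> univ B) + card (U - univ B)"
    using fU by (metis card_Int_Diff)
  moreover have "card (ed B1 U) = card (ed B (U \<inter> univ B)) + card (Lk U) + card (Tq U)"
  proof -
    let ?l = "(\<lambda>p. (i0, link p)) ` Lk U" and ?t = "(\<lambda>q. (sy q, te q)) ` Tq U" and ?o = "ed B (U \<inter> univ B)"
    have eq: "ed B1 U = ?o \<union> ?l \<union> ?t"
    proof -
      have "(i, e) \<in> ed B1 U \<longleftrightarrow> (i, e) \<in> ?o \<union> ?l \<union> ?t" for i e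
        using b.relD(1) by (auto simp: ed_def rel_B1 Lk_def Tq_def image_iff)
      thus ?thesis by auto
    qed
    have "card ?l = card (Lk U)"
      using inj_link by (intro card_image) (auto simp: inj_on_def Lk_def)
    moreover have "card ?t = card (Tq U)"
      using inj_te by (intro card_image) (auto simp: inj_on_def Tq_def)
    moreover have "?o \<inter> ?l = {}" using link_new by (fastforce simp: ed_def Lk_def)
    moreover have "(?o \<union> ?l) \<inter> ?t = {}"
    proof -
      have "link p \<noteq> te q" if "q \<in> Q" for p q
        using xs_te[OF that] xs_ne by (auto simp: link_def)
      thus ?thesis using te_new by (fastforce simp: ed_def Tq_def)
    qed
    moreover have "finite ?o" using finB by (intro b.finite_ed) auto
    ultimately show ?thesis unfolding eq using fin_idx by (simp add: card_Un_disjoint)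
  qed
  ultimately show ?thesis using fU by (simp add: b.dl_eq b1.dl_eq)
qed

text \<open>An injection into the new points of \<open>U\<close>: a link goes to its upper endpoint,
  a class in \<open>Fr U\<close> to its lowest point in \<open>U\<close>. The latter is not the
  upper endpoint of a link inside \<open>U\<close>, since the lower endpoint would be in
  \<open>U\<close> too.\<close>

lemma Lk_Fr: "card (Lk U) + card (Fr U) \<le> card (nw U)"
proof -
  let ?g = "\<lambda>p. (fst p, Suc (snd p))" and ?h = "\<lambda>\<rho>. (\<rho>, LEAST j. vt \<rho> j \<in> U)"
  have "?g ` Lk U \<subseteq> nw U"
  proof clarify
    fix \<rho> j assume "(\<rho>, j) \<in> Lk U"
    hence "\<rho> \<in> Rep" "j < T" "vt \<rho> (Suc j) \<in> U" by (auto simp: Lk_def link_def)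
    thus "(fst (\<rho>, j), Suc (snd (\<rho>, j))) \<in> nw U" using vt_B[of \<rho> "Suc j"] by (simp add: nw_def vx_def)
  qed
  moreover have h: "?h \<rho> \<in> nw U" if \<rho>: "\<rho> \<in> Fr U" for \<rho>
  proof -
    obtain j where j: "\<rho> \<in> Rep" "j \<le> T" "vt \<rho> j \<in> U" using \<rho> by (auto simp: Fr_def Kl_def)
    let ?j = "LEAST j. vt \<rho> j \<in> U"
    have "vt \<rho> ?j \<in> U" using j LeastI by metis
    moreover have "?j \<le> T" using j Least_le[of "\<lambda>j. vt \<rho> j \<in> U" j] by simp
    moreover have "\<not> (?j = 0 \<and> \<rho> \<in> old)" using \<rho> \<open>vt \<rho> ?j \<in> U\<close> by (auto simp: Fr_def)
    ultimately show ?thesis using j vt_B by (simp add: nw_def vx_def)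
  qed
  moreover have "?g ` Lk U \<inter> ?h ` Fr U = {}"
  proof -
    have "Suc j \<noteq> (LEAST j. vt \<rho> j \<in> U)" if "(\<rho>, j) \<in> Lk U" for \<rho> j
    proof -
      have "vt \<rho> j \<in> U" using that by (auto simp: Lk_def link_def)
      thus ?thesis using Least_le[of "\<lambda>j. vt \<rho> j \<in> U" j] by simp
    qed
    thus ?thesis by fastforce
  qed
  moreover have "card (?g ` Lk U) = card (Lk U)" by (rule card_image) (auto simp: inj_on_def prod_eq_iff)
  moreover have "card (?h ` Fr U) = card (Fr U)" by (rule card_image) (auto simp: inj_on_def)
  ultimately have "card (Lk U) + card (Fr U) = card (?g ` Lk U \<union> ?h ` Fr U)"
    using fin_idx by (simp add: card_Un_disjoint)
  also have "\<dots> \<le> card (nw U)"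
    by (rule card_mono) (use fin_idx \<open>?g ` Lk U \<subseteq> nw U\<close> h in auto)
  finally show ?thesis .
qed

lemma Tq_le:
  assumes "Kl U \<subseteq> L"
  shows "card (Tq U) \<le> card {q \<in> Q. fst ` fl q \<subseteq> L}"
proof (rule card_mono)
  show "finite {q \<in> Q. fst ` fl q \<subseteq> L}" using Q by simp
  show "Tq U \<subseteq> {q \<in> Q. fst ` fl q \<subseteq> L}"
  proof
    fix q assume q: "q \<in> Tq U"
    hence q': "q \<in> Q" "te q \<subseteq> U" by (auto simp: Tq_def)
    have "\<rho> \<in> L" if "(\<rho>, j) \<in> fl q" for \<rho> j
    proof -
      have "vx (\<rho>, j) \<in> U" using that q' by (auto simp: te_def)
      moreover have "\<rho> \<in> Rep" "j \<le> T" using that fl(1)[OF q'(1)] by auto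
      ultimately show ?thesis using assms by (auto simp: Kl_def vx_def)
    qed
    thus "q \<in> {q \<in> Q. fst ` fl q \<subseteq> L}" using q' by auto
  qed
qed

text \<open>Monotonicity of \<open>r\<close>, applied to
  \<open>old \<subseteq> old \<union> Kl U\<close>, bounds the copied relations in \<open>U\<close>
  by the new classes it meets; by \<open>Lk_Fr\<close> the new points pay for these classes and for
  the links.\<close>

lemma dl_ge_B:
  assumes U: "U \<subseteq> univ B1"
  shows "dl B (U \<inter> univ B) \<le> dl B1 U"
proof -
  let ?L = "old \<union> Kl U"
  have L: "?L \<subseteq> Rep" using Rep by (auto simp: Kl_def)
  have "r (?L \<inter> old) \<le> r ?L" using L by (intro r_mono) auto
  hence "int (card {q \<in> Q. fst ` fl q \<subseteq> ?L}) \<le> int (card (?L - old))" using r_gain[OF L] by linarith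
  moreover have "card (?L - old) \<le> card (Fr U)" using fin_idx by (intro card_mono) (auto simp: Fr_def)
  moreover have "card (Tq U) \<le> card {q \<in> Q. fst ` fl q \<subseteq> ?L}" by (rule Tq_le) auto
  ultimately show ?thesis using dl_B1[OF U] Lk_Fr[of U] by linarith
qed

lemma B1_C0: "B1 \<in> C0 ar"
proof -
  have "0 \<le> dl B1 U" if "U \<subseteq> univ B1" for U
    using dl_ge_B[OF that] C0D(3)[OF B, of "U \<inter> univ B"] by simp
  thus ?thesis using str_B1 finB1 by (simp add: C0_def)
qed

lemma ss_B1: "ss_fin (univ B) B1"
proof -
  have "dl B1 (univ B) \<le> dl B1 U" if "univ B \<subseteq> U" "U \<subseteq> univ B1" for U
    using dl_ge_B[OF that(2)] that(1) by (simp add: restr_B1 inf.absorb2)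
  thus ?thesis by (auto simp: ss_fin_def univ_B1)
qed

text \<open>The missing old representatives of classes met by \<open>U\<close> are added to its
  trace on \<open>B\<close>, where \<open>rB_ge\<close> applies. Each costs at most one unit, and
  its class belongs to \<open>Fr U\<close>, so a new point pays for it.\<close>

lemma dl_ge_r:
  assumes U: "U \<subseteq> univ B1" "Lp \<subseteq> U"
  shows "dl B Lp + r (Kl U) \<le> dl B1 U"
proof -
  let ?K = "Kl U" and ?M = "{\<rho> \<in> Kl U \<inter> old. vt \<rho> 0 \<notin> U}"
  have K: "?K \<subseteq> Rep" by (auto simp: Kl_def)
  have "dl B ((U \<inter> univ B) \<union> (\<lambda>\<rho>. vt \<rho> 0) ` ?M) \<le> dl B (U \<inter> univ B) + int (card ((\<lambda>\<rho>. vt \<rho> 0) ` ?M))"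
    using finB fin_idx by (intro b.dl_Un_le) auto
  moreover have "card ((\<lambda>\<rho>. vt \<rho> 0) ` ?M) \<le> card ?M" using fin_idx by (intro card_image_le) auto
  moreover have "dl B Lp + r (?K \<inter> old) \<le> dl B ((U \<inter> univ B) \<union> (\<lambda>\<rho>. vt \<rho> 0) ` ?M)"
    using U Lp K by (intro rB_ge) (auto simp: vt_B)
  moreover have "card (Fr U) = card (?K - old) + card ?M"
  proof -
    have "Fr U = (?K - old) \<union> ?M" by (auto simp: Fr_def)
    moreover have "(?K - old) \<inter> ?M = {}" by auto
    ultimately show ?thesis using fin_idx by (simp add: card_Un_disjoint)
  qed
  ultimately show ?thesis using dl_B1[OF U(1)] Lk_Fr[of U] r_gain[OF K] Tq_le[of U ?K, OF order_refl] by linarith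
qed

text \<open>The set consists of an optimal set in \<open>B\<close> for the old classes of the
  optimal \<open>L\<close> from \<open>r_eq\<close>, together with the full chains of all of
  \<open>L\<close>. On each chain the \<open>T\<close> points of positive index are balanced by
  \<open>T\<close> links, so only classes outside \<open>old\<close> add to the count.\<close>

lemma dl_le_r:
  assumes K: "K \<subseteq> Rep"
  shows "\<exists>U. U \<subseteq> univ B1 \<and> Lp \<subseteq> U \<and> (\<lambda>\<rho>. vt \<rho> 0) ` K \<subseteq> U \<and> vx ` (K \<times> {..T}) \<subseteq> U \<and> dl B1 U \<le> dl B Lp + r K"
proof -
  obtain L where L: "K \<subseteq> L" "L \<subseteq> Rep"
    and rK: "r K = r (L \<inter> old) + int (card (L - old)) - int (card {q \<in> Q. fst ` fl q \<subseteq> L})"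
    using r_eq[OF K] by blast
  have fL: "finite L" using L Rep finite_subset by blast
  obtain D where D: "D \<subseteq> univ B" "Lp \<subseteq> D" "(\<lambda>\<rho>. vt \<rho> 0) ` (L \<inter> old) \<subseteq> D" "dl B D \<le> dl B Lp + r (L \<inter> old)"
    using rB_le[of "L \<inter> old"] by auto
  define U where "U = D \<union> vx ` (L \<times> {..T})"
  have U: "U \<subseteq> univ B1" using D L by (auto simp: U_def univ_B1)
  have vtU: "vt \<rho> j \<in> U" if "\<rho> \<in> L" "j \<le> T" for \<rho> j
    using that by (force simp: U_def vx_def)
  have UB: "U \<inter> univ B = D"
  proof -
    have "vt \<rho> j \<in> D" if "\<rho> \<in> L" "j \<le> T" "vt \<rho> j \<in> univ B" for \<rho> j
      using that vt_B[of \<rho> j] L D(3) by blast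
    thus ?thesis using D by (auto simp: U_def vx_def)
  qed
  have "nw U \<subseteq> L \<times> {1..T} \<union> (L - old) \<times> {0}"
  proof
    fix p assume "p \<in> nw U"
    then obtain \<rho> j where p: "p = (\<rho>, j)" and a: "(\<rho>, j) \<in> nw U" by (cases p) auto
    hence 1: "\<rho> \<in> Rep" "j \<le> T" "vt \<rho> j \<in> U" "vt \<rho> j \<notin> univ B" by (auto simp: nw_def vx_def)
    hence "vt \<rho> j \<in> vx ` (L \<times> {..T})" using D by (auto simp: U_def)
    then obtain \<sigma> k where "\<sigma> \<in> L" "k \<le> T" "vt \<rho> j = vt \<sigma> k" by (auto simp: vx_def)
    hence "\<rho> \<in> L" using vt_inj[of \<rho> \<sigma> j k] 1 L by auto
    moreover have "\<not> (j = 0 \<and> \<rho> \<in> old)" using 1 vt_B[of \<rho> j] by auto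
    ultimately show "p \<in> L \<times> {1..T} \<union> (L - old) \<times> {0}" using 1 p by (cases j) auto
  qed
  hence "card (nw U) \<le> card (L \<times> {1..T} \<union> (L - old) \<times> {0})" using fL by (intro card_mono) auto
  also have "\<dots> \<le> card (L \<times> {1..T}) + card ((L - old) \<times> {0::nat})" by (rule card_Un_le)
  also have "\<dots> = card L * T + card (L - old)" by (simp add: card_cartesian_product)
  finally have 1: "card (nw U) \<le> card L * T + card (L - old)" .
  have "L \<times> {..<T} \<subseteq> Lk U"
  proof clarify
    fix \<rho> j assume a: "\<rho> \<in> L" "j < T"
    have "xs \<subseteq> U" using xs D by (auto simp: U_def)
    thus "(\<rho>, j) \<in> Lk U" using a vtU[of \<rho> j] vtU[of \<rho> "Suc j"] L by (auto simp: Lk_def link_def)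
  qed
  hence "card (L \<times> {..<T}) \<le> card (Lk U)" using fin_idx by (intro card_mono) auto
  hence 2: "card L * T \<le> card (Lk U)" by (simp add: card_cartesian_product)
  have "{q \<in> Q. fst ` fl q \<subseteq> L} \<subseteq> Tq U"
  proof clarify
    fix q assume q: "q \<in> Q" "fst ` fl q \<subseteq> L"
    have "vx ` fl q \<subseteq> U" using q fl(1)[OF q(1)] vtU by (force simp: vx_def)
    moreover have "lo q \<subseteq> U" using lo[OF q(1)] D by (auto simp: U_def)
    ultimately show "q \<in> Tq U" using q by (simp add: Tq_def te_def)
  qed
  hence 3: "card {q \<in> Q. fst ` fl q \<subseteq> L} \<le> card (Tq U)" using fin_idx by (intro card_mono) auto
  have "dl B1 U \<le> dl B Lp + r K" using dl_B1[OF U] 1 2 3 D(4) rK UB by simp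
  moreover have "Lp \<subseteq> U" using D by (auto simp: U_def)
  moreover have "(\<lambda>\<rho>. vt \<rho> 0) ` K \<subseteq> U" "vx ` (K \<times> {..T}) \<subseteq> U" using vtU L by (auto simp: U_def)
  ultimately show ?thesis using U by blast
qed

text \<open>Submodularity against \<open>Lp\<close> reduces to sets containing all loops. A chain
  point or a copied relation inside a copy thus becomes a lower bound for its predimension.\<close>

lemma dl_ge_rank:
  assumes U: "U \<subseteq> univ B1"
  shows "dl B (U \<inter> Lp) + r (Kl U) \<le> dl B1 U"
proof -
  have fU: "finite U" using U finB1 finite_subset by blast
  have LpU: "U \<union> Lp \<subseteq> univ B1" using U Lp by (auto simp: univ_B1)
  have "dl B1 (U \<union> Lp) + dl B1 (U \<inter> Lp) \<le> dl B1 U + dl B1 Lp"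
    using fU finLp(1) by (rule b1.dl_submod)
  moreover have "dl B Lp + r (Kl (U \<union> Lp)) \<le> dl B1 (U \<union> Lp)" using LpU by (intro dl_ge_r) auto
  moreover have "r (Kl U) \<le> r (Kl (U \<union> Lp))" by (rule r_mono) (auto simp: Kl_def)
  moreover have "restr B1 (U \<inter> Lp) = restr B (U \<inter> Lp)" "restr B1 Lp = restr B Lp" using Lp by (auto intro!: restr_B1)
  ultimately show ?thesis by simp
qed

lemma dl_ge1:
  assumes "U \<subseteq> univ B1" "\<rho> \<in> Rep" "j \<le> T" "vt \<rho> j \<in> U"
  shows "dl B (U \<inter> Lp) + 1 \<le> dl B1 U"
proof -
  have "r {\<rho>} \<le> r (Kl U)" using assms by (intro r_mono) (auto simp: Kl_def)
  thus ?thesis using dl_ge_rank[OF assms(1)] r1[OF assms(2)] by linarith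
qed

lemma dl_ge2:
  assumes "U \<subseteq> univ B1" "q \<in> Q" "te q \<subseteq> U"
  shows "2 \<le> dl B1 U"
proof -
  have "fst ` fl q \<subseteq> Kl U"
  proof clarify
    fix \<rho> j assume "(\<rho>, j) \<in> fl q"
    moreover hence "vx (\<rho>, j) \<in> U" using assms by (auto simp: te_def)
    moreover have "\<rho> \<in> Rep" "j \<le> T" using fl(1)[OF assms(2)] calculation by auto
    ultimately show "fst (\<rho>, j) \<in> Kl U" by (auto simp: Kl_def vx_def)
  qed
  hence "r (fst ` fl q) \<le> r (Kl U)" by (intro r_mono) (auto simp: Kl_def)
  moreover have "0 \<le> dl B (U \<inter> Lp)" using Lp by (intro C0D(3)[OF B]) auto
  ultimately show ?thesis using dl_ge_rank[OF assms(1)] r2[OF assms(2)] by linarith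
qed

lemma new_edge:
  assumes "e \<in> rel B1 i" "\<not> e \<subseteq> univ B"
  obtains (link) \<rho> j where "i = i0" "\<rho> \<in> Rep" "j < T" "e = link (\<rho>, j)"
    | (te) q where "q \<in> Q" "e = te q" "i = sy q"
proof -
  have "e \<notin> rel B i" using assms(2) b.relD(1) by blast
  thus thesis using assms(1) link te by (auto simp: rel_B1)
qed

end

section \<open>Copies of minimally simply algebraic extensions in the extended structure\<close>

context gadget
begin

lemma link_at:
  assumes "\<rho> \<in> Rep" "j \<le> T" "\<sigma> \<in> Rep" "k < T" "vt \<rho> j \<in> link (\<sigma>, k)"
  shows "\<sigma> = \<rho> \<and> (k = j \<or> Suc k = j)"
proof -
  have "vt \<rho> j \<notin> xs" using vt_notLp[OF assms(1,2)] xs by auto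
  hence "vt \<rho> j = vt \<sigma> k \<or> vt \<rho> j = vt \<sigma> (Suc k)" using assms(5) by (auto simp: link_def)
  thus ?thesis using vt_inj[of \<rho> \<sigma> j k] vt_inj[of \<rho> \<sigma> j "Suc k"] assms by auto
qed

text \<open>The assumption \<open>free\<close> serves the bases inside \<open>B\<close>: a copy
  leaving \<open>B\<close> is then a link starting at an old point \<open>vt \<rho> 0\<close>, and
  any other copy would give a second relation of \<open>i0\<close> through \<open>xs\<close> and
  this point.\<close>

lemma B1_Cmu:
  assumes BC: "B \<in> Cmu ar \<mu>" and i0: "\<And>i. ar i0 \<le> ar i"
    and free: "\<And>\<rho> e. \<rho> \<in> old \<Longrightarrow> e \<in> rel B i0 \<Longrightarrow> xs \<subseteq> e \<Longrightarrow> vt \<rho> 0 \<notin> e"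
    and mu2: "\<And>Y Z. msa ar Y Z \<Longrightarrow> delta (restr Z Y) \<ge> 2 \<Longrightarrow> \<mu> Y Z \<ge> 2"
    and mu1: "\<And>Y Z. msa ar Y Z \<Longrightarrow> delta (restr Z Y) = 1 \<Longrightarrow> \<mu> Y Z \<ge> 1"
  shows "B1 \<in> Cmu ar \<mu>"
proof (rule CmuI[OF B1_C0])
  fix Y Z h F
  assume m: "msa ar Y Z" and h: "embedding h (restr Z Y) B1"
    and F: "\<forall>j \<le> \<mu> Y Z. embedding (F j) Z B1 \<and> (\<forall>y \<in> Y. F j y = h y)"
    and d: "disjoint_family_on (\<lambda>j. F j ` (univ Z - Y)) {..\<mu> Y Z}"
  note mD = msaD[OF m]
  define n where "n = \<mu> Y Z"
  define C where "C j = F j ` univ Z" for j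
  define hY where "hY = h ` Y"
  have Fe: "embedding (F j) Z B1" if "j \<le> n" for j using F that by (simp add: n_def)
  have FY: "F j ` Y = hY" if "j \<le> n" for j using F that by (auto simp: n_def hY_def)
  have Cu: "C j \<subseteq> univ B1" if "j \<le> n" for j using embedding_subset[OF Fe[OF that]] by (simp add: C_def)
  have hYC: "hY \<subseteq> C j" if "j \<le> n" for j using FY[OF that] mD(2) by (auto simp: C_def)
  have CmY: "C j - hY = F j ` (univ Z - Y)" if "j \<le> n" for j
    using inj_on_image_set_diff[OF embedding_inj[OF Fe[OF that]], of "univ Z" Y] mD(2) FY[OF that]
    by (auto simp: C_def)
  have CC: "v \<in> hY" if "j \<le> n" "k \<le> n" "j \<noteq> k" "v \<in> C j" "v \<in> C k" for j k v
  proof (rule ccontr)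
    assume "v \<notin> hY"
    hence "v \<in> F j ` (univ Z - Y)" "v \<in> F k ` (univ Z - Y)"
      using that CmY[OF that(1)] CmY[OF that(2)] by auto
    thus False using d that by (auto simp: disjoint_family_on_def n_def)
  qed
  have dlC: "dl B1 (C j) = dl Z Y" if "j \<le> n" for j
    using embedding_dl[OF lang mD(5) str_B1 Fe[OF that], of "univ Z"] mD(4,5,6) by (simp add: C_def)
  have fY: "finite Y" using mD(2,6) finite_subset by blast
  have dlh: "dl B1 hY = dl Z Y"
    using embedding_dl[OF lang mD(5) str_B1 Fe[of 0], of Y] mD(2) fY FY[of 0] by simp
  have hYu: "hY \<subseteq> univ B1" using hYC[of 0] Cu[of 0] by auto
  \<comment> \<open>Every base point meets, in each copy, a relation that leaves the base. Such
    relations differ from copy to copy, so counting copies reduces to counting relations through one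
    point.\<close>
  have touch: "\<exists>i e. e \<in> rel B1 i \<and> h y \<in> e \<and> e \<subseteq> C j \<and> \<not> e \<subseteq> hY" if y: "y \<in> Y" "j \<le> n" for y j
  proof -
    obtain i e where e: "e \<in> rel Z i" "y \<in> e" "\<not> e \<subseteq> Y" using msa_touch[OF lang m y(1)] .
    interpret Z: lang_struct ar Z using lang mD by unfold_locales
    have eu: "e \<subseteq> univ Z" using e Z.relD by blast
    have "F j ` e \<in> rel B1 i" using embedding_rel_iff[OF Fe[OF y(2)] eu] e by simp
    moreover have "h y \<in> F j ` e" using F y e by (force simp: n_def)
    moreover have "F j ` e \<subseteq> C j" using eu by (auto simp: C_def)
    moreover have "\<not> F j ` e \<subseteq> hY"
    proof -
      obtain z where "z \<in> e" "z \<notin> Y" using e by auto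
      hence "F j z \<in> C j - hY" using CmY[OF y(2)] eu by auto
      thus ?thesis using \<open>z \<in> e\<close> by auto
    qed
    ultimately show ?thesis by blast
  qed
  have distinct: "j = k" if "j \<le> n" "k \<le> n" "e \<subseteq> C j" "e \<subseteq> C k" "\<not> e \<subseteq> hY" for j k e
    using CC[of j k] that by blast
  \<comment> \<open>A link with a single point outside the base is the whole copy. The base has
    \<open>ar i0 - 1\<close> points, too few for a relation as \<open>ar i0\<close> is the least
    arity; so its predimension is at least two, and every copy is one relation of symbol
    \<open>i0\<close>.\<close>
  have LC: "2 \<le> dl Z Y \<and> (\<forall>k\<le>n. \<exists>e. e \<in> rel B1 i0 \<and> hY \<subseteq> e \<and> e \<subseteq> C k \<and> \<not> e \<subseteq> hY)"
    if lk: "j \<le> n" "\<rho> \<in> Rep" "k < T" "link (\<rho>, k) \<subseteq> C j" "v \<in> link (\<rho>, k)" "v \<notin> hY" "link (\<rho>, k) \<subseteq> insert v hY"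
    for j \<rho> k v
  proof -
    have "link (\<rho>, k) \<in> rel B1 i0" using lk by (auto simp: rel_B1)
    then obtain e where e: "e \<in> rel Z i0" "e \<subseteq> univ Z" "link (\<rho>, k) = F j ` e"
      using embedding_pull[OF Fe[OF lk(1)], of "univ Z"] lk(4) by (auto simp: C_def)
    obtain z where z: "z \<in> e" "v = F j z" using lk(5) e by auto
    have zY: "z \<notin> Y" using lk(6) z FY[OF lk(1)] by auto
    have inj: "inj_on (F j) (univ Z)" by (rule embedding_inj[OF Fe[OF lk(1)]])
    have "e \<subseteq> insert z Y"
    proof
      fix u assume u: "u \<in> e"
      hence "F j u \<in> F j ` insert z Y" using lk(7) e z FY[OF lk(1)] by auto
      thus "u \<in> insert z Y" using inj_on_image_mem_iff[OF inj, of u "insert z Y"] u z e mD(2) by auto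
    qed
    note ms = msa_single[OF lang m e(1) z(1) zY this]
    interpret Z: lang_struct ar Z using lang mD by unfold_locales
    have cY: "card Y = ar i0 - 1" using ms(2) Z.relD(2,3)[OF e(1)] z by simp
    have "ed Z Y = {}"
    proof -
      have False if "e' \<in> rel Z i" "e' \<subseteq> Y" for i e'
      proof -
        have "card e' \<le> card Y" using that fY by (intro card_mono)
        thus False using Z.relD(3)[OF that(1)] cY i0[of i] ar3[of i0] by simp
      qed
      thus ?thesis by (auto simp: ed_def)
    qed
    hence "dl Z Y = int (ar i0 - 1)" using cY fY by (simp add: Z.dl_eq)
    hence dl2: "2 \<le> dl Z Y" using ar3[of i0] by simp
    have im: "F k' ` e \<in> rel B1 i0 \<and> hY \<subseteq> F k' ` e \<and> F k' ` e \<subseteq> C k' \<and> \<not> F k' ` e \<subseteq> hY" if k': "k' \<le> n" for k'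
    proof (intro conjI)
      show "F k' ` e \<in> rel B1 i0" using embedding_rel_iff[OF Fe[OF k'] e(2)] e(1) by simp
      show "hY \<subseteq> F k' ` e" using FY[OF k'] ms(2) by auto
      show "F k' ` e \<subseteq> C k'" using e(2) by (auto simp: C_def)
      have "F k' z \<in> C k' - hY" using CmY[OF k'] z e zY by auto
      thus "\<not> F k' ` e \<subseteq> hY" using z by auto
    qed
    show ?thesis
    proof (intro conjI allI impI dl2)
      fix k' assume "k' \<le> n"
      from im[OF this] show "\<exists>e. e \<in> rel B1 i0 \<and> hY \<subseteq> e \<and> e \<subseteq> C k' \<and> \<not> e \<subseteq> hY" by (rule exI)
    qed
  qed
  show False
  proof (cases "hY \<subseteq> univ B")
    case False
    then obtain y where y: "y \<in> Y" "h y \<notin> univ B" by (auto simp: hY_def)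
    then obtain \<rho> j where \<rho>: "\<rho> \<in> Rep" "j \<le> T" "h y = vt \<rho> j"
      using hYu by (auto simp: univ_B1 vx_def hY_def)
    have hyY: "h y \<in> hY" using y by (auto simp: hY_def)
    obtain ie ee where ee: "\<And>k. k \<le> n \<Longrightarrow> ee k \<in> rel B1 (ie k) \<and> h y \<in> ee k \<and> ee k \<subseteq> C k \<and> \<not> ee k \<subseteq> hY"
      using touch[OF y(1)] by metis
    have eeN: "\<not> ee k \<subseteq> univ B" if "k \<le> n" for k using ee[OF that] y by auto
    have diff: "ee k \<noteq> ee l" if "k \<le> n" "l \<le> n" "k \<noteq> l" for k l
      using distinct[OF that(1,2), of "ee k"] ee[OF that(1)] ee[OF that(2)] that(3) by auto
    define at_link where "at_link e \<longleftrightarrow> (\<exists>k<T. e = link (\<rho>, k) \<and> (k = j \<or> Suc k = j))" for e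
    have cases: "at_link (ee k) \<or> (\<exists>q\<in>Q. ee k = te q)" if "k \<le> n" for k
    proof -
      have "ee k \<in> rel B1 (ie k)" using ee[OF that] by simp
      thus ?thesis using eeN[OF that]
      proof (cases rule: new_edge)
        case (link \<sigma> l)
        thus ?thesis using link_at[OF \<rho>(1,2) link(2,3)] ee[OF that] \<rho>(3) by (auto simp: at_link_def)
      qed auto
    qed
    have two: "at_link e1 \<Longrightarrow> at_link e2 \<Longrightarrow> at_link e3 \<Longrightarrow> e1 = e2 \<or> e1 = e3 \<or> e2 = e3" for e1 e2 e3
      by (auto simp: at_link_def)
    \<comment> \<open>Two copies with links through the same base point share \<open>xs\<close>,
      which is thereby forced into the base. Then \<open>LC\<close> yields three distinct links
      through that point, but it lies on at most two.\<close>
    have nolinks: False if kl: "k \<le> n" "l \<le> n" "k \<noteq> l" "at_link (ee k)" "at_link (ee l)" for k l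
    proof -
      from kl(4) obtain k1 where k1: "k1 < T" "ee k = link (\<rho>, k1)" "k1 = j \<or> Suc k1 = j" by (auto simp: at_link_def)
      from kl(5) obtain l1 where l1: "ee l = link (\<rho>, l1)" by (auto simp: at_link_def)
      have xsY: "xs \<subseteq> hY"
      proof
        fix x assume "x \<in> xs"
        hence "x \<in> ee k" "x \<in> ee l" using k1 l1 by (auto simp: link_def)
        thus "x \<in> hY" using CC[OF kl(1-3)] ee[OF kl(1)] ee[OF kl(2)] by blast
      qed
      obtain v where v: "v \<in> link (\<rho>, k1)" "v \<notin> hY" using ee[OF kl(1)] k1 by auto
      have "link (\<rho>, k1) \<subseteq> insert v hY"
        using v xsY k1(3) hyY \<rho>(3) by (auto simp: link_def)
      from LC[OF kl(1) \<rho>(1) k1(1) _ v this] ee[OF kl(1)] k1(2)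
      have "2 \<le> dl Z Y" and *: "\<forall>k\<le>n. \<exists>e. e \<in> rel B1 i0 \<and> hY \<subseteq> e \<and> e \<subseteq> C k \<and> \<not> e \<subseteq> hY" by auto
      hence n2: "2 \<le> n" using mu2[OF m] by (simp add: n_def)
      from * obtain E where E: "\<And>k. k \<le> n \<Longrightarrow> E k \<in> rel B1 i0 \<and> hY \<subseteq> E k \<and> E k \<subseteq> C k \<and> \<not> E k \<subseteq> hY" by metis
      have at_link: "at_link (E k)" if "k \<le> n" for k
      proof -
        have "E k \<in> rel B1 i0" "\<not> E k \<subseteq> univ B" using E[OF that] hyY y by auto
        thus ?thesis
        proof (cases rule: new_edge)
          case (link \<sigma> l)
          thus ?thesis using link_at[OF \<rho>(1,2) link(2,3)] E[OF that] hyY \<rho>(3) by (auto simp: at_link_def)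
        next
          case (te q)
          thus ?thesis using xs_te[OF te(1)] xs_ne E[OF that] xsY by auto
        qed
      qed
      have "E k \<noteq> E l" if "k \<le> n" "l \<le> n" "k \<noteq> l" for k l
        using distinct[OF that(1,2), of "E k"] E[OF that(1)] E[OF that(2)] that(3) by auto
      thus False using two[OF at_link[of 0] at_link[of 1] at_link[of 2]] n2 by force
    qed
    have tes: "\<not> (\<exists>q\<in>Q. ee k = te q) \<or> \<not> (\<exists>q\<in>Q. ee l = te q)" if kl: "k \<le> n" "l \<le> n" "k \<noteq> l" for k l
    proof (rule ccontr)
      assume "\<not> (\<not> (\<exists>q\<in>Q. ee k = te q) \<or> \<not> (\<exists>q\<in>Q. ee l = te q))"
      then obtain q q' where q: "q \<in> Q" "ee k = te q" "q' \<in> Q" "ee l = te q'" by blast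
      hence "q = q'" using te_unique[of q q' "h y"] ee[OF kl(1)] ee[OF kl(2)] y by auto
      thus False using q diff[OF kl] by simp
    qed
    \<comment> \<open>A chain point has rank one, so the base containing it has predimension at
      least one and there are at least two copies.\<close>
    have "dl B (hY \<inter> Lp) + 1 \<le> dl B1 hY" using \<rho> hyY by (intro dl_ge1[OF hYu \<rho>(1,2)]) simp
    moreover have "0 \<le> dl B (hY \<inter> Lp)" using Lp by (intro C0D(3)[OF B]) auto
    ultimately have "dl Z Y = 1 \<or> 2 \<le> dl Z Y" using dlh by linarith
    hence n1: "1 \<le> n" using mu1[OF m] mu2[OF m] by (auto simp: n_def)
    \<comment> \<open>Links cannot serve both copies, so one contains a copied relation and has
      predimension at least two. The base has the same predimension, which gives a third copy; yet
      at most one copy can use a link and at most one a copied relation.\<close>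
    from cases[of 0] cases[of 1] nolinks[of 0 1] n1 obtain k q where kq: "k \<le> n" "q \<in> Q" "ee k = te q" by auto
    have "2 \<le> dl B1 (C k)" using dl_ge2[OF Cu[OF kq(1)] kq(2)] ee[OF kq(1)] kq(3) by simp
    hence n2: "2 \<le> n" using dlC[OF kq(1)] mu2[OF m] by (simp add: n_def)
    show False
      using cases[of 0] cases[of 1] cases[of 2] nolinks[of 0 1] nolinks[of 0 2] nolinks[of 1 2]
        tes[of 0 1] tes[of 0 2] tes[of 1 2] n2 by auto
  next
    case True
    have "\<exists>j\<le>n. \<not> C j \<subseteq> univ B"
    proof (rule ccontr)
      assume "\<not> (\<exists>j\<le>n. \<not> C j \<subseteq> univ B)"
      hence c: "C j \<subseteq> univ B" if "j \<le> n" for j using that by auto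
      have toB: "embedding g A B" if g: "embedding g A B1" "g ` univ A \<subseteq> univ B" for g :: "nat \<Rightarrow> 'v" and A :: "('i, nat) lstruct"
      proof -
        have "e \<in> rel A i \<longleftrightarrow> g ` e \<in> rel B i" if e: "e \<subseteq> univ A" for e i
        proof -
          have "g ` e \<subseteq> univ B" using e g(2) by auto
          thus ?thesis using embedding_rel_iff[OF g(1) e] rel_B1_B by simp
        qed
        thus ?thesis using g unfolding embedding_def by blast
      qed
      have "embedding h (restr Z Y) B" using toB[OF h] True by (simp add: hY_def)
      moreover have "\<forall>j \<le> \<mu> Y Z. embedding (F j) Z B \<and> (\<forall>y \<in> Y. F j y = h y)"
        using F toB c by (auto simp: n_def C_def)
      ultimately show False by (rule CmuD[OF BC m _ _ d])
    qed
    then obtain j where j: "j \<le> n" "\<not> C j \<subseteq> univ B" by auto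
    \<comment> \<open>a copy of \<open>Z\<close> cannot properly cross a self-sufficient set that contains the base\<close>
    have CB: "C j \<inter> univ B = hY"
    proof (rule ccontr)
      assume ne: "C j \<inter> univ B \<noteq> hY"
      define S where "S = {z \<in> univ Z. F j z \<in> univ B}"
      have FS: "F j ` S = C j \<inter> univ B" by (auto simp: S_def C_def)
      have "Y \<subseteq> S" using mD(2) FY[OF j(1)] True by (auto simp: S_def)
      moreover have "Y \<noteq> S" using FS FY[OF j(1)] ne by auto
      moreover have "S \<subset> univ Z" using j(2) by (auto simp: S_def C_def)
      ultimately have "dl Z Y < dl Z S" using mD(8) by blast
      also have "dl Z S = dl B1 (F j ` S)"
        using embedding_dl[OF lang mD(5) str_B1 Fe[OF j(1)], of S] mD(6) by (simp add: S_def)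
      also have "\<dots> = dl B (C j \<inter> univ B)" unfolding FS by (simp add: restr_B1)
      also have "\<dots> \<le> dl B1 (C j)" by (rule dl_ge_B[OF Cu[OF j(1)]])
      finally show False using dlC[OF j(1)] by simp
    qed
    obtain v where v: "v \<in> C j" "v \<notin> univ B" using j(2) by auto
    then obtain \<sigma> k where \<sigma>: "\<sigma> \<in> Rep" "k \<le> T" "v = vt \<sigma> k" using Cu[OF j(1)] by (auto simp: univ_B1 vx_def)
    \<comment> \<open>Over a base of loops the copy would gain rank: it meets \<open>Lp\<close>
      exactly in the base and contains a chain point, so its predimension would exceed that of the
      base.\<close>
    have "\<not> hY \<subseteq> Lp"
    proof
      assume hL: "hY \<subseteq> Lp"
      hence "C j \<inter> Lp = hY" using CB Lp by auto
      hence "dl B hY + 1 \<le> dl B1 (C j)" using dl_ge1[OF Cu[OF j(1)] \<sigma>(1,2)] v \<sigma> by simp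
      moreover have "dl B1 hY = dl B hY" using True by (simp add: restr_B1)
      ultimately show False using dlC[OF j(1)] dlh by simp
    qed
    then obtain y where y: "y \<in> Y" "h y \<notin> Lp" by (auto simp: hY_def)
    have hyB: "h y \<in> univ B" "h y \<in> hY" using y True by (auto simp: hY_def)
    \<comment> \<open>Copied relations use fresh points and loops only, so a new relation reaches a
      point of \<open>B\<close> outside \<open>Lp\<close> only as the first link of a chain.\<close>
    have linky: "\<exists>\<rho>\<in>old. 0 < T \<and> e = link (\<rho>, 0) \<and> h y = vt \<rho> 0"
      if e: "e \<in> rel B1 i" "h y \<in> e" "\<not> e \<subseteq> univ B" for i e
      using e(1,3)
    proof (cases rule: new_edge)
      case (link \<rho> k)
      have "h y \<notin> xs" using y xs by auto
      hence "h y = vt \<rho> k \<or> h y = vt \<rho> (Suc k)" using e(2) link by (auto simp: link_def)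
      thus ?thesis using vt_B[of \<rho> k] vt_B[of \<rho> "Suc k"] link hyB by auto
    next
      case (te q)
      thus ?thesis using vx_notB[OF te(1)] lo[OF te(1)] hyB y e(2) by (auto simp: te_def)
    qed
    obtain i e where e: "e \<in> rel B1 i" "h y \<in> e" "e \<subseteq> C j" "\<not> e \<subseteq> hY" using touch[OF y(1) j(1)] by blast
    have "\<not> e \<subseteq> univ B" using e CB by auto
    then obtain \<rho> where \<rho>: "\<rho> \<in> old" "0 < T" "e = link (\<rho>, 0)" "h y = vt \<rho> 0" using linky e by blast
    have \<rho>R: "\<rho> \<in> Rep" using \<rho> Rep by auto
    have xsY: "xs \<subseteq> hY" using e(3) \<rho>(3) CB xs Lp by (auto simp: link_def)
    obtain w where w: "w \<in> link (\<rho>, 0)" "w \<notin> hY" using e(4) \<rho>(3) by auto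
    have "link (\<rho>, 0) \<subseteq> insert w hY" using w xsY hyB \<rho>(4) by (auto simp: link_def)
    from LC[OF j(1) \<rho>R \<rho>(2) _ w this] e(3) \<rho>(3)
    have "2 \<le> dl Z Y" and *: "\<forall>k\<le>n. \<exists>e. e \<in> rel B1 i0 \<and> hY \<subseteq> e \<and> e \<subseteq> C k \<and> \<not> e \<subseteq> hY" by auto
    hence n2: "2 \<le> n" using mu2[OF m] by (simp add: n_def)
    \<comment> \<open>Predimension two guarantees a further copy, hence another
      \<open>i0\<close>-relation containing \<open>xs\<close> and \<open>vt \<rho> 0\<close>. Inside
      \<open>B\<close> it is excluded by \<open>free\<close>; otherwise it would be the same
      link.\<close>
    obtain k where k: "k \<le> n" "k \<noteq> j" using n2 by (cases "j = 0") auto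
    obtain e' where e': "e' \<in> rel B1 i0" "hY \<subseteq> e'" "e' \<subseteq> C k" "\<not> e' \<subseteq> hY" using *[rule_format, OF k(1)] by (elim exE conjE)
    show False
    proof (cases "e' \<subseteq> univ B")
      case True
      hence "e' \<in> rel B i0" using e' rel_B1_B by simp
      thus False using free[OF \<rho>(1)] e'(2) xsY hyB \<rho>(4) by auto
    next
      case False
      then obtain \<rho>' where \<rho>': "\<rho>' \<in> old" "e' = link (\<rho>', 0)" "h y = vt \<rho>' 0" using linky[OF e'(1)] e'(2) hyB by blast
      hence "\<rho>' = \<rho>" using vt_inj[of \<rho>' \<rho> 0 0] \<rho> Rep by auto
      hence "e' = e" using \<rho> \<rho>' by simp
      thus False using distinct[OF k(1) j(1), of e] e e' k(2) by auto
    qed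
  qed
qed

end

section \<open>One step of the back-and-forth\<close>

context localized
begin

lemma rk_insert_notin: "u \<in> univ D \<Longrightarrow> u \<notin> cl D X \<Longrightarrow> rk {u} = 1"
  using dim_insert_notin[OF finX Xu] by (simp add: rk_def)

text \<open>Together with \<open>par_iff_rk\<close> this expresses loops and parallelism by ranks,
  which are what the back-and-forth transfers.\<close>

lemma loop_iff_rk: "u \<in> univ D \<Longrightarrow> u \<in> cl D X \<longleftrightarrow> rk {u} = 0"
  using cl_iff[OF finX] by (simp add: rk_def)

lemma par_iff_rk: "u \<in> univ D \<Longrightarrow> u \<in> cl D (insert \<rho> X) \<longleftrightarrow> rk {\<rho>, u} = rk {\<rho>}"
  using cl_iff[of "insert \<rho> X"] finX by (simp add: rk_def insert_commute)

text \<open>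
  Both \<open>H\<close> and \<open>B \<inter> H\<close> have predimension \<open>d(X)\<close>, so a relation of \<open>B \<union> H\<close> inside neither \<open>B\<close> nor \<open>H\<close>
  would contradict \<open>B \<le> D\<close>.
\<close>

lemma enlarge_loops:
  assumes B: "finite B" "ss B D" "X \<subseteq> B" and inf: "infinite (cl D X)"
  obtains H where "finite H" "B \<inter> cl D X \<subseteq> H" "H \<subseteq> cl D X" "X \<subseteq> H" "ss (B \<union> H) D" "k \<le> card (H - B)"
    "\<forall>e i. e \<in> rel D i \<longrightarrow> e \<subseteq> B \<union> H \<longrightarrow> e \<inter> (H - B) \<noteq> {} \<longrightarrow> e \<subseteq> H"
    "dl D H = dim D X"
proof -
  have Bu: "B \<subseteq> univ D" using B by (auto simp: ss_def)
  have "infinite (cl D X - B)" using inf B by simp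
  then obtain V where V: "V \<subseteq> cl D X - B" "finite V" "card V = k" by (metis infinite_arbitrarily_large)
  \<comment> \<open>\<open>V\<close> provides \<open>k\<close> loops outside \<open>B\<close>.
    Including all loops of \<open>B\<close> makes \<open>B \<inter> H\<close> exactly the trace of
    \<open>cl D X\<close> on \<open>B\<close>, whose predimension is known.\<close>
  let ?S = "(B \<inter> cl D X) \<union> V \<union> X"
  have XclX: "X \<subseteq> cl D X" using cl_extensive finX Xu by blast
  have S: "finite ?S" "?S \<subseteq> cl D X" using B V finX XclX by auto
  have Su: "?S \<subseteq> univ D" using S(2) cl_subset_univ by (rule order_trans)
  obtain H where H: "?S \<subseteq> H" "finite H" "ss H D" "H \<subseteq> cl D ?S" using ss_hull[OF S(1) Su] .
  have HX: "H \<subseteq> cl D X" using H(4) cl_subsetI[OF finX Xu S(1,2)] by blast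
  have Hu: "H \<subseteq> univ D" using HX cl_subset_univ by blast
  have dH: "dl D H = dim D X"
  proof -
    have "dim D (X \<union> H) = dim D X" using finX Xu H(2) HX by (rule dim_cl)
    moreover have "X \<union> H = H" using H(1) by auto
    ultimately show ?thesis using ss_dim_eq[OF H(3,2)] by simp
  qed
  have BH: "B \<inter> H = B \<inter> cl D X" using H(1) HX by auto
  have dBH: "dl D (B \<inter> H) = dim D X" using dim_closed[OF B(2,1,3), of "{}"] by (simp add: BH)
  have ge: "dl D B \<le> dl D C" if "B \<subseteq> C" "C \<subseteq> univ D" "finite C" for C
  proof -
    have "dl D (C \<inter> B) \<le> dl D C" using B(2) that by (auto simp: ss_def)
    thus ?thesis using that by (simp add: inf.absorb2)
  qed
  have un: "ed D B \<union> ed D H \<subseteq> ed D (B \<union> H)" by (auto simp: ed_def)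
  have f: "finite (ed D (B \<union> H))" "finite (ed D B)" "finite (ed D H)" using finite_ed B H by auto
  have "int (card (ed D B \<union> ed D H)) + int (card (ed D (B \<inter> H))) = int (card (ed D B)) + int (card (ed D H))"
    unfolding ed_Int using f by (intro card_Int_Un_int)
  moreover have "dl D B \<le> dl D (B \<union> H)" using Bu Hu B H by (intro ge) auto
  ultimately have "int (card (ed D (B \<union> H))) \<le> int (card (ed D B \<union> ed D H))"
    using dH dBH card_Int_Un_int[OF B(1) H(2)] B H by (simp add: dl_eq)
  hence edeq: "ed D B \<union> ed D H = ed D (B \<union> H)" using un f by (intro card_seteq) auto
  have dlBH: "dl D (B \<union> H) \<le> dl D B" using dl_submod[OF B(1) H(2)] dH dBH by simp
  have ssBH: "ss (B \<union> H) D"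
    unfolding ss_def
  proof (intro conjI allI impI)
    show "B \<union> H \<subseteq> univ D" using Bu Hu by simp
    fix C assume C: "C \<subseteq> univ D" "finite C"
    have "dl D B \<le> dl D (C \<union> (B \<union> H))" using C Bu Hu B H by (intro ge) auto
    moreover have "dl D (C \<union> (B \<union> H)) + dl D (C \<inter> (B \<union> H)) \<le> dl D C + dl D (B \<union> H)"
      using C B H by (intro dl_submod) auto
    ultimately show "dl D (C \<inter> (B \<union> H)) \<le> dl D C" using dlBH by linarith
  qed
  have eH: "\<forall>e i. e \<in> rel D i \<longrightarrow> e \<subseteq> B \<union> H \<longrightarrow> e \<inter> (H - B) \<noteq> {} \<longrightarrow> e \<subseteq> H"
  proof (intro allI impI)
    fix e i assume that: "e \<in> rel D i" "e \<subseteq> B \<union> H" "e \<inter> (H - B) \<noteq> {}"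
    have "(i, e) \<in> ed D B \<union> ed D H" unfolding edeq using that by (simp add: ed_def)
    thus "e \<subseteq> H" using that(3) by (auto simp: ed_def)
  qed
  have "card V \<le> card (H - B)" using V H by (intro card_mono) auto
  hence "k \<le> card (H - B)" using V(3) by simp
  moreover have "B \<inter> cl D X \<subseteq> H" "X \<subseteq> H" using H(1) by auto
  ultimately show thesis using that[OF H(2) _ HX _ ssBH _ eH dH] by simp
qed

end

text \<open>What the two classes share: both contain every finite structure embeddable in a member,
  and the extensions built by the gadget. One extension lemma therefore serves both
  directions.\<close>

definition admissible :: "('i \<Rightarrow> nat) \<Rightarrow> ('i, nat) lstruct set \<Rightarrow> bool" where
  "admissible ar \<A> \<longleftrightarrow> \<A> = C0 ar \<or> (\<exists>\<mu>. \<A> = Cmu ar \<mu> \<and>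
     (\<forall>Y Z. msa ar Y Z \<longrightarrow> delta (restr Z Y) \<ge> 2 \<longrightarrow> \<mu> Y Z \<ge> 2) \<and>
     (\<forall>Y Z. msa ar Y Z \<longrightarrow> delta (restr Z Y) = 1 \<longrightarrow> \<mu> Y Z \<ge> 1))"

lemma admissible_C0: "admissible ar \<A> \<Longrightarrow> D \<in> \<A> \<Longrightarrow> D \<in> C0 ar"
  by (auto simp: admissible_def Cmu_def)

lemma admissible_embedding:
  fixes A B :: "('i, nat) lstruct"
  assumes "language ar" "admissible ar \<A>" "is_lstruct ar A" "finite (univ A)" "embedding f A B" "B \<in> \<A>"
  shows "A \<in> \<A>"
  using assms embedding_C0[OF assms(1,3-5)] embedding_Cmu[OF assms(1,3-5)] unfolding admissible_def by auto

text \<open>The gadget and the extension property work with members of the class, which live on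
  natural numbers; this brings a copy of any finite part of \<open>N\<close> there.\<close>

lemma generic_copy:
  fixes N :: "('i, 'b) lstruct"
  assumes L: "language ar" and ad: "admissible ar \<A>" and g: "is_generic ar \<A> N"
    and S: "finite S" "S \<subseteq> univ N"
  obtains D g where "D \<in> \<A>" "embedding g D N" "g ` univ D = S"
proof -
  from g obtain A :: "nat \<Rightarrow> 'b set" where
    A1: "\<forall>k. \<exists>B \<in> \<A>. \<exists>f. isomorphism f B (restr N (A k))" and
    A2: "\<forall>k. ss_fin (A k) (restr N (A (Suc k)))" and
    A3: "univ N = (\<Union>k. A k)"
    unfolding is_generic_def by (elim conjE exE)
  have mono: "A k \<subseteq> A l" if "k \<le> l" for k l
    using lift_Suc_mono_le[of A k l] A2 that by (auto simp: ss_fin_def)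
  have "\<exists>k. S \<subseteq> A k" using S
  proof (induction S rule: finite_induct)
    case (insert x S)
    then obtain k where k: "S \<subseteq> A k" by auto
    obtain l where l: "x \<in> A l" using insert A3 by auto
    have "A k \<subseteq> A (max k l)" "A l \<subseteq> A (max k l)" by (auto intro!: mono)
    thus ?case using k l by (intro exI[of _ "max k l"]) auto
  qed simp
  then obtain k where k: "S \<subseteq> A k" by auto
  obtain B f where B: "B \<in> \<A>" "isomorphism f B (restr N (A k))" using A1 by blast
  have fe: "embedding f B (restr N (A k))" "f ` univ B = A k" using B by (auto simp: isomorphism_def)
  have B0: "B \<in> C0 ar" using admissible_C0[OF ad B(1)] .
  define D where "D = restr B {x \<in> univ B. f x \<in> S}"
  have Du: "univ D \<subseteq> univ B" "f ` univ D = S" using fe k by (auto simp: D_def)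
  have DB: "embedding (\<lambda>x. x) D B"
    using Du by (auto simp: embedding_def D_def)
  have "is_lstruct ar D" "finite (univ D)" using C0D[OF B0] by (auto simp: D_def)
  hence "D \<in> \<A>" using admissible_embedding[OF L ad _ _ DB B(1)] by blast
  moreover have "embedding f D N"
  proof -
    have "inj_on f (univ D)" using embedding_inj[OF fe(1)] Du inj_on_subset by blast
    moreover have "e \<in> rel D i \<longleftrightarrow> f ` e \<in> rel N i" if "e \<subseteq> univ D" for e i
    proof -
      have "e \<subseteq> univ B" "f ` e \<subseteq> A k" using that Du k by auto
      thus ?thesis using embedding_rel_iff[OF fe(1), of e i] that by (auto simp: D_def)
    qed
    ultimately show ?thesis using Du S unfolding embedding_def by blast
  qed
  ultimately show thesis using that Du by blast
qed

lemma generic_extend: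
  assumes "is_generic ar \<A> N" "D \<in> \<A>" "ss_fin S D" "embedding h (restr D S) N" "ss (h ` S) N"
  obtains g where "embedding g D N" "\<forall>a\<in>S. g a = h a" "ss (g ` univ D) N"
proof -
  have "\<forall>B \<in> \<A>. \<forall>A h. ss_fin A B \<and> embedding h (restr B A) N \<and> ss (h ` A) N \<longrightarrow>
        (\<exists>g. embedding g B N \<and> (\<forall>a \<in> A. g a = h a) \<and> ss (g ` univ B) N)"
    using assms(1) unfolding is_generic_def by (elim conjE)
  from this[rule_format, OF assms(2) conjI[OF assms(3) conjI[OF assms(4,5)]]]
  show thesis using that by blast
qed

text \<open>\<open>p\<close> pairs representatives of classes only, so \<open>A\<close> and
  \<open>B\<close> may differ in size and structure. As a set of pairs it lets the two sides be
  swapped.\<close>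

definition bfstate :: "('i, 'a) lstruct \<Rightarrow> 'a set \<Rightarrow> ('i, 'b) lstruct \<Rightarrow> 'b set \<Rightarrow> 'a set \<Rightarrow> 'b set \<Rightarrow> ('a \<times> 'b) set \<Rightarrow> bool" where
  "bfstate M X N W A B p \<longleftrightarrow> finite A \<and> ss A M \<and> X \<subseteq> A \<and> finite B \<and> ss B N \<and> W \<subseteq> B \<and>
     inj_on fst p \<and> inj_on snd p \<and> localized.transv M X A (fst ` p) \<and> localized.transv N W B (snd ` p) \<and>
     (\<forall>J \<subseteq> p. localized.rk M X (fst ` J) = localized.rk N W (snd ` J))"

lemma bfstate_sym:
  assumes "bfstate M X N W A B p"
  shows "bfstate N W M X B A (prod.swap ` p)"
proof -
  have "localized.rk N W (fst ` J) = localized.rk M X (snd ` J)" if "J \<subseteq> prod.swap ` p" for J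
  proof -
    have "prod.swap ` J \<subseteq> p" using that by auto
    moreover have "fst ` prod.swap ` J = snd ` J" "snd ` prod.swap ` J = fst ` J" by (auto simp: image_comp)
    ultimately show ?thesis using assms unfolding bfstate_def by metis
  qed
  moreover have "inj_on fst (prod.swap ` p)" "inj_on snd (prod.swap ` p)"
    using assms by (auto simp: bfstate_def inj_on_def)
  moreover have "fst ` prod.swap ` p = snd ` p" "snd ` prod.swap ` p = fst ` p" by (auto simp: image_comp)
  ultimately show ?thesis using assms unfolding bfstate_def by simp
qed

lemma fresh_encoding:
  assumes "finite P" "finite (F :: nat set)"
  obtains enc :: "'p \<Rightarrow> nat" where "inj_on enc P" "enc ` P \<inter> F = {}"
proof -
  define m where "m = Suc (Max (insert 0 F))"
  have m: "x < m" if "x \<in> F" for x using that assms(2) by (simp add: m_def less_Suc_eq_le)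
  let ?e = "\<lambda>p. m + to_nat_on P p"
  have "inj_on ?e P" using inj_on_to_nat_on[OF countable_finite[OF assms(1)]] by (simp add: inj_on_def)
  moreover have "?e ` P \<inter> F = {}" using m by force
  ultimately show thesis using that by blast
qed

text \<open>The forth step; \<open>bfstate_sym\<close> turns it into the back step. Genericity and
  an infinite closure are asked of the side on which the copy is made.\<close>

lemma bfstate_extend:
  fixes M :: "('i, 'a) lstruct" and N :: "('i, 'b) lstruct"
  assumes M: "localized ar M X" and N: "localized ar N W" and ad: "admissible ar \<A>" and gen: "is_generic ar \<A> N"
    and inf: "infinite (cl N W)"
    and st: "bfstate M X N W A B p" and A1: "A \<subseteq> A1" "finite A1" "ss A1 M"
  obtains B1 p1 where "bfstate M X N W A1 B1 p1" "p \<subseteq> p1" "B \<subseteq> B1"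
proof -
  interpret M: localized ar M X by (rule M)
  interpret N: localized ar N W by (rule N)
  note lang = M.lang
  from st have A: "finite A" "ss A M" "X \<subseteq> A" and B: "finite B" "ss B N" "W \<subseteq> B"
    and inj: "inj_on fst p" "inj_on snd p" and tA: "M.transv A (fst ` p)" and tB: "N.transv B (snd ` p)"
    and rkp: "\<And>J. J \<subseteq> p \<Longrightarrow> M.rk (fst ` J) = N.rk (snd ` J)"
    unfolding bfstate_def by auto
  have A1u: "A1 \<subseteq> univ M" using A1 by (simp add: ss_def)
  have Bu: "B \<subseteq> univ N" using B by (simp add: ss_def)
  define R0 where "R0 = fst ` p"
  obtain R1 where R1: "M.transv A1 R1" "R0 \<subseteq> R1"
    using M.transv_extend[OF tA A1(1,2) A1u] unfolding R0_def .
  interpret E: localized_ext ar M X A A1 R0 R1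
    using A A1 R1 tA by unfold_locales (auto simp: R0_def)
  define th where "th \<rho> = snd (inv_into p fst \<rho>)" for \<rho>
  have th: "(\<rho>, th \<rho>) \<in> p" if "\<rho> \<in> R0" for \<rho>
  proof -
    have "inv_into p fst \<rho> \<in> p" "fst (inv_into p fst \<rho>) = \<rho>"
      using that unfolding R0_def by (auto intro: inv_into_into f_inv_into_f)
    thus ?thesis unfolding th_def by (metis prod.collapse)
  qed
  have thp: "th \<rho> = b" if "(\<rho>, b) \<in> p" for \<rho> b
  proof -
    have "\<rho> \<in> R0" using that by (force simp: R0_def)
    from inj_onD[OF inj(1) _ th[OF this] that] show ?thesis by simp
  qed
  have thR: "th ` R0 = snd ` p" using th thp by (force simp: R0_def)
  have rkth: "M.rk J = N.rk (th ` J)" if J: "J \<subseteq> R0" for J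
  proof -
    let ?J = "(\<lambda>\<rho>. (\<rho>, th \<rho>)) ` J"
    have "?J \<subseteq> p" using th J by auto
    moreover have "fst ` ?J = J" "snd ` ?J = th ` J" by (auto simp: image_comp)
    ultimately show ?thesis using rkp by metis
  qed
  have thB: "th \<rho> \<in> B" "th \<rho> \<notin> cl N W" if "\<rho> \<in> R0" for \<rho>
    using tB thR that unfolding N.transv_def by auto

  obtain i0 where i0: "\<And>i. ar i0 \<le> ar i" using ex_has_least_nat[of "\<lambda>_. True" _ ar] by auto
  \<comment> \<open>Room outside \<open>B\<close> for the \<open>ar i0 - 2\<close> points of
    \<open>xs\<close> and for replacing each loop of \<open>A1\<close> by a loop of its own;
    \<open>card A1\<close> bounds the number of the latter.\<close>
  obtain H where H: "finite H" "B \<inter> cl N W \<subseteq> H" "H \<subseteq> cl N W" "W \<subseteq> H" "ss (B \<union> H) N"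
    "ar i0 - 2 + card A1 \<le> card (H - B)"
    "\<forall>e i. e \<in> rel N i \<longrightarrow> e \<subseteq> B \<union> H \<longrightarrow> e \<inter> (H - B) \<noteq> {} \<longrightarrow> e \<subseteq> H"
    "dl N H = dim N W"
    using N.enlarge_loops[OF B inf, of "ar i0 - 2 + card A1"] .
  obtain xs0 where xs0: "xs0 \<subseteq> H - B" "card xs0 = ar i0 - 2"
    using obtain_subset_with_card_n[of "ar i0 - 2" "H - B"] H(6) by auto
  have fxs0: "finite xs0" using xs0 H finite_subset by (metis finite_Diff)
  have "3 \<le> ar i0" using lang by (simp add: language_def)
  hence xs0ne: "xs0 \<noteq> {}" using xs0 by auto
  have "card A1 \<le> card (H - B - xs0)" using xs0 H(1,6) fxs0 by (simp add: card_Diff_subset)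
  \<comment> \<open>Injectivity keeps the arity of a copied relation, and avoiding
    \<open>xs0\<close> keeps copied relations apart from links. Which loops are used does not affect
    ranks.\<close>
  then obtain ell where ell: "ell ` A1 \<subseteq> H - B - xs0" "inj_on ell A1"
    using card_le_inj[of A1 "H - B - xs0"] A1(2) H(1) by auto

  have BHu: "finite (B \<union> H)" "B \<union> H \<subseteq> univ N" using B H(1,5) by (auto simp: ss_def)
  obtain D g where D: "D \<in> \<A>" "embedding g D N" "g ` univ D = B \<union> H"
    using generic_copy[OF lang ad gen BHu] .
  have DC: "D \<in> C0 ar" by (rule admissible_C0[OF ad D(1)])
  note DD = C0D[OF DC]
  define gi where "gi = inv_into (univ D) g"
  have ginj: "inj_on g (univ D)" by (rule embedding_inj[OF D(2)])
  have ggi: "g (gi b) = b" "gi b \<in> univ D" if "b \<in> B \<union> H" for b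
    using that D(3) f_inv_into_f[of b g "univ D"] inv_into_into[of b g "univ D"] by (auto simp: gi_def)
  have gig: "gi (g x) = x" if "x \<in> univ D" for x using that ginj by (simp add: gi_def)
  have gi_im: "g ` gi ` S = S" if "S \<subseteq> B \<union> H" for S using ggi that by (force simp: image_comp)
  have gi_sub: "gi ` S \<subseteq> univ D" if "S \<subseteq> B \<union> H" for S using ggi that by auto
  have gi_inj: "inj_on gi (B \<union> H)" by (metis ggi(1) inj_onI)
  have dlg: "dl N (g ` U) = dl D U" if "U \<subseteq> univ D" for U
    using embedding_dl[OF lang DD(1) N.str D(2) that] finite_subset[OF that DD(2)] by simp

  define Lp where "Lp = gi ` H"
  define xs where "xs = gi ` xs0"
  have gLp: "g ` Lp = H" "Lp \<subseteq> univ D" unfolding Lp_def by (auto simp: gi_im gi_sub del: subsetI)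
  have dlLp: "dl D Lp = dim N W" using dlg[OF gLp(2)] gLp H(8) by simp

  \<comment> \<open>\<open>T\<close> counts the incidences of points with new relations. The
    incidence of \<open>u\<close> with \<open>q\<close> uses chain index
    \<open>Suc (nm (q, u))\<close>, so no chain point serves two relations and index 0 is kept for
    the representative.\<close>
  define Fs where "Fs = (SIGMA q : E.newE. snd q)"
  have fFs: "finite Fs"
    unfolding Fs_def
  proof (rule finite_SigmaI[OF E.finite_newE])
    fix q assume "q \<in> E.newE"
    thus "finite (snd q)" using M.relD(2) by (auto simp: E.newE_def M.ed2_def ed_def)
  qed
  define T where "T = card Fs"
  obtain nm where nm: "bij_betw nm Fs {0..<T}" using ex_bij_betw_finite_nat[OF fFs] by (auto simp: T_def)
  define fl where "fl q = (\<lambda>u. (E.rep u, Suc (nm (q, u)))) ` (snd q - cl M X)" for q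
  define lo where "lo q = gi ` ell ` (snd q \<inter> cl M X)" for q :: "'i \<times> 'a set"
  obtain enc :: "'a \<times> nat \<Rightarrow> nat" where enc: "inj_on enc (R1 \<times> {..T})" "enc ` (R1 \<times> {..T}) \<inter> univ D = {}"
    using fresh_encoding[of "R1 \<times> {..T}" "univ D"] E.Au DD(2) by auto
  \<comment> \<open>An old class starts at the copy of its partner in \<open>B\<close>; every other
    chain point is a fresh natural number.\<close>
  define vt where "vt \<rho> j = (if j = 0 \<and> \<rho> \<in> R0 then gi (th \<rho>) else enc (\<rho>, j))" for \<rho> j

  have newE: "e \<in> rel M i" "e \<subseteq> A1" "2 \<le> M.rk e" "finite e" if "(i, e) \<in> E.newE" for i e
    using that M.relD(2) by (auto simp: E.newE_def M.ed2_def ed_def)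
  have nmT: "nm (q, u) < T" if "q \<in> E.newE" "u \<in> snd q" for q u
    using nm that unfolding bij_betw_def Fs_def by fastforce
  have nminj: "q = q' \<and> u = u'" if "q \<in> E.newE" "u \<in> snd q" "q' \<in> E.newE" "u' \<in> snd q'" "nm (q, u) = nm (q', u')" for q q' u u'
    using nm that unfolding bij_betw_def Fs_def inj_on_def by auto
  have fstfl: "fst ` fl q = E.rep ` (snd q - cl M X)" for q by (auto simp: fl_def image_comp)
  have QL: "card {q \<in> E.newE. fst ` fl q \<subseteq> L} = E.newI L" if "L \<subseteq> R1" for L
  proof -
    have "{q \<in> E.newE. fst ` fl q \<subseteq> L} = {(i, e) \<in> E.newE. e \<subseteq> M.span A1 L}"
      unfolding fstfl
      by (rule Collect_cong) (use E.subset_span_iff[OF newE(2) that] in \<open>simp add: case_prod_unfold, metis prod.collapse\<close>)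
    thus ?thesis by (simp add: E.newI_def)
  qed
  have R1u: "\<rho> \<in> univ M" "\<rho> \<notin> cl M X" if "\<rho> \<in> R1" for \<rho>
    using R1(1) that A1u unfolding M.transv_def by auto
  have vt0: "vt \<rho> 0 = gi (th \<rho>)" "g (vt \<rho> 0) = th \<rho>" "vt \<rho> 0 \<in> univ D" if "\<rho> \<in> R0" for \<rho>
    using that thB(1)[OF that] ggi by (auto simp: vt_def)
  have thinj: "\<rho> = \<sigma>" if "\<rho> \<in> R0" "\<sigma> \<in> R0" "th \<rho> = th \<sigma>" for \<rho> \<sigma>
    using inj_onD[OF inj(2) _ th[OF that(1)] th[OF that(2)]] that(3) by simp
  have vtB: "vt \<rho> j \<in> univ D \<longleftrightarrow> j = 0 \<and> \<rho> \<in> R0" if "\<rho> \<in> R1" "j \<le> T" for \<rho> j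
  proof (cases "j = 0 \<and> \<rho> \<in> R0")
    case True
    thus ?thesis using vt0 by auto
  next
    case False
    hence "vt \<rho> j \<in> enc ` (R1 \<times> {..T})" using that by (auto simp: vt_def)
    thus ?thesis using False enc(2) by auto
  qed
  have vtinj: "\<rho> = \<sigma> \<and> j = k" if "\<rho> \<in> R1" "\<sigma> \<in> R1" "j \<le> T" "k \<le> T" "vt \<rho> j = vt \<sigma> k" for \<rho> \<sigma> j k
  proof (cases "vt \<rho> j \<in> univ D")
    case True
    hence 1: "j = 0" "\<rho> \<in> R0" "k = 0" "\<sigma> \<in> R0" using vtB[of \<rho> j] vtB[of \<sigma> k] that by auto
    hence "th \<rho> = th \<sigma>" using vt0(2)[of \<rho>] vt0(2)[of \<sigma>] that by auto
    thus ?thesis using thinj 1 by auto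
  next
    case False
    hence "\<not> (j = 0 \<and> \<rho> \<in> R0)" "\<not> (k = 0 \<and> \<sigma> \<in> R0)" using vtB[of \<rho> j] vtB[of \<sigma> k] that by auto
    hence "enc (\<rho>, j) = enc (\<sigma>, k)" using that by (simp add: vt_def split: if_splits)
    thus ?thesis using enc(1) that by (auto simp: inj_on_def)
  qed
  interpret G: gadget ar D Lp xs i0 R1 R0 vt T E.newE fst fl lo M.rk
  proof unfold_locales
    show "D \<in> C0 ar" by (rule DC)
    show "Lp \<subseteq> univ D" by (rule gLp)
    show "xs \<subseteq> Lp" using xs0 by (auto simp: xs_def Lp_def)
    show "card xs = ar i0 - 2"
      unfolding xs_def using xs0 gi_inj by (subst card_image) (auto intro: inj_on_subset)
    show "finite R1" "R0 \<subseteq> R1" using E.Au R1 by auto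
    show "\<rho> = \<sigma> \<and> j = k" if "\<rho> \<in> R1" "\<sigma> \<in> R1" "j \<le> T" "k \<le> T" "vt \<rho> j = vt \<sigma> k" for \<rho> \<sigma> j k
      using vtinj that .
    show "vt \<rho> j \<in> univ D \<longleftrightarrow> j = 0 \<and> \<rho> \<in> R0" if "\<rho> \<in> R1" "j \<le> T" for \<rho> j
      using vtB that .
    show "vt \<rho> 0 \<notin> Lp" if "\<rho> \<in> R0" for \<rho>
    proof
      assume "vt \<rho> 0 \<in> Lp"
      hence "g (vt \<rho> 0) \<in> H" using gLp by auto
      thus False using vt0[OF that] thB[OF that] H(3) by auto
    qed
    show "finite E.newE" by (rule E.finite_newE)
    show "fl q \<subseteq> R1 \<times> {1..T}" if "q \<in> E.newE" for q
    proof -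
      have "E.rep u \<in> R1 \<and> Suc (nm (q, u)) \<le> T" if u: "u \<in> snd q" "u \<notin> cl M X" for u
        using E.rep(1)[of u] nmT[OF \<open>q \<in> E.newE\<close> u(1)] newE(2)[of "fst q" "snd q"] \<open>q \<in> E.newE\<close> u by auto
      thus ?thesis by (auto simp: fl_def)
    qed
    show "fl q \<noteq> {}" if "q \<in> E.newE" for q
    proof
      assume "fl q = {}"
      hence "snd q \<subseteq> cl M X" by (auto simp: fl_def)
      hence "M.rk (snd q) = 0" using newE(4)[of "fst q" "snd q"] that by (intro M.rk_loops) auto
      thus False using newE(3)[of "fst q" "snd q"] that by simp
    qed
    show "fl q \<inter> fl q' = {}" if "q \<in> E.newE" "q' \<in> E.newE" "q \<noteq> q'" for q q'
      using nminj[OF that(1) _ that(2)] that(3) by (auto simp: fl_def)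
    show "lo q \<subseteq> Lp - xs" if "q \<in> E.newE" for q
    proof -
      have "ell ` (snd q \<inter> cl M X) \<subseteq> H - xs0" using newE(2)[of "fst q" "snd q"] that ell by auto
      hence "lo q \<subseteq> gi ` (H - xs0)" by (auto simp: lo_def)
      also have "\<dots> = gi ` H - gi ` xs0"
        using xs0 by (intro inj_on_image_set_diff[OF gi_inj]) auto
      finally show ?thesis by (simp add: Lp_def xs_def)
    qed
    show "card (fl q) + card (lo q) = ar (fst q)" if q: "q \<in> E.newE" for q
    proof -
      have q': "(fst q, snd q) \<in> E.newE" using q by simp
      note n = newE[OF q']
      have "inj_on (\<lambda>u. (E.rep u, Suc (nm (q, u)))) (snd q - cl M X)"
        using nminj[OF q _ q] by (auto simp: inj_on_def)
      hence "card (fl q) = card (snd q - cl M X)" unfolding fl_def by (rule card_image)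
      moreover have "card (lo q) = card (snd q \<inter> cl M X)"
      proof -
        have s: "snd q \<inter> cl M X \<subseteq> A1" using n by auto
        have "inj_on ell (snd q \<inter> cl M X)" using ell(2) s by (rule inj_on_subset)
        moreover have "inj_on gi (ell ` (snd q \<inter> cl M X))"
          by (rule inj_on_subset[OF gi_inj]) (use ell s in auto)
        ultimately show ?thesis unfolding lo_def by (simp add: card_image)
      qed
      moreover have "card (snd q) = card (snd q \<inter> cl M X) + card (snd q - cl M X)"
        using n(4) by (metis card_Int_Diff)
      ultimately show ?thesis using M.relD(3)[OF n(1)] by simp
    qed
    show "M.rk L \<le> M.rk L'" if "L \<subseteq> L'" "L' \<subseteq> R1" for L L'
      using that E.Au by (intro M.rk_mono) (auto intro: finite_subset)
    show "M.rk L \<le> M.rk (L \<inter> R0) + int (card (L - R0)) - int (card {q \<in> E.newE. fst ` fl q \<subseteq> L})" if "L \<subseteq> R1" for L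
      using E.rk_le_gain[OF that] QL[OF that] by simp
    show "\<exists>L. K \<subseteq> L \<and> L \<subseteq> R1 \<and> M.rk K = M.rk (L \<inter> R0) + int (card (L - R0)) - int (card {q \<in> E.newE. fst ` fl q \<subseteq> L})" if K: "K \<subseteq> R1" for K
    proof -
      obtain L where "K \<subseteq> L" "L \<subseteq> R1" "M.rk K = M.rk (L \<inter> R0) + int (card (L - R0)) - int (E.newI L)"
        using E.rk_eq_gain[OF K] by (elim exE conjE)
      thus ?thesis using QL[of L] by (intro exI[of _ L]) simp
    qed
    show "1 \<le> M.rk {\<rho>}" if "\<rho> \<in> R1" for \<rho> using M.rk_insert_notin R1u[OF that] by simp
    show "2 \<le> M.rk (fst ` fl q)" if q: "q \<in> E.newE" for q
      using E.rk_rep[of "snd q"] newE[of "fst q" "snd q"] q by (simp add: fstfl)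
    show "dl D Lp + M.rk J \<le> dl D U" if J: "J \<subseteq> R0" and U: "U \<subseteq> univ D" "Lp \<subseteq> U" "(\<lambda>\<rho>. vt \<rho> 0) ` J \<subseteq> U" for J U
    proof -
      have "H \<subseteq> g ` U" using U(2) gLp(1) by auto
      moreover have "th \<rho> \<in> g ` U" if "\<rho> \<in> J" for \<rho>
      proof -
        have "vt \<rho> 0 \<in> U" "\<rho> \<in> R0" using J that U(3) by auto
        thus ?thesis using vt0(2)[of \<rho>] by force
      qed
      ultimately have "W \<union> th ` J \<subseteq> g ` U" using H(4) by auto
      hence "dim N (W \<union> th ` J) \<le> dl N (g ` U)"
        using embedding_subset[OF D(2) U(1)] finite_subset[OF U(1) DD(2)] by (intro N.dim_le) auto
      thus ?thesis using rkth[OF J] dlg[OF U(1)] dlLp by (simp add: N.rk_def)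
    qed
    \<comment> \<open>The witness is the trace on the self-sufficient set
      \<open>B \<union> H\<close> of the closure of \<open>W\<close> and the old representatives;
      its predimension is the dimension, and it contains all of \<open>H\<close>.\<close>
    show "\<exists>U. U \<subseteq> univ D \<and> Lp \<subseteq> U \<and> (\<lambda>\<rho>. vt \<rho> 0) ` J \<subseteq> U \<and> dl D U \<le> dl D Lp + M.rk J" if J: "J \<subseteq> R0" for J
    proof -
      have J': "th ` J \<subseteq> B" using thB(1) J by auto
      have fJ: "finite (th ` J)" "th ` J \<subseteq> univ N" using finite_subset[OF J' B(1)] J' Bu by auto
      have clJ: "W \<union> th ` J \<subseteq> cl N (W \<union> th ` J)" using N.cl_extensive[of "W \<union> th ` J"] fJ N.finX N.Xu by auto
      have clW: "cl N W \<subseteq> cl N (W \<union> th ` J)" using fJ N.finX N.Xu by (intro N.cl_mono_fin) auto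
      define U where "U = gi ` ((B \<union> H) \<inter> cl N (W \<union> th ` J))"
      have gU: "g ` U = (B \<union> H) \<inter> cl N (W \<union> th ` J)" "U \<subseteq> univ D" unfolding U_def by (auto simp: gi_im gi_sub del: subsetI)
      have "dl N ((B \<union> H) \<inter> cl N (W \<union> th ` J)) = dim N (W \<union> th ` J)"
        using H B J' by (intro N.dim_closed) auto
      hence "dl D U = dl D Lp + M.rk J" using dlg[OF gU(2)] gU rkth[OF J] dlLp by (simp add: N.rk_def)
      moreover have "Lp \<subseteq> U" using H(3) clW by (auto simp: Lp_def U_def)
      moreover have "(\<lambda>\<rho>. vt \<rho> 0) ` J \<subseteq> U"
      proof clarify
        fix \<rho> assume "\<rho> \<in> J"
        hence "vt \<rho> 0 = gi (th \<rho>)" "th \<rho> \<in> (B \<union> H) \<inter> cl N (W \<union> th ` J)" using vt0(1) J J' clJ by auto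
        thus "vt \<rho> 0 \<in> U" unfolding U_def by (simp only: imageI)
      qed
      ultimately show ?thesis using gU by (intro exI[of _ U]) simp
    qed
  qed (rule lang)

  have BA: "G.B1 \<in> \<A>"
  proof -
    \<comment> \<open>\<open>xs0\<close> is nonempty and lies in \<open>H - B\<close>, so a relation
      containing it stays inside \<open>H\<close>, among the loops, whereas a representative is not
      a loop.\<close>
    have free: "vt \<rho> 0 \<notin> e" if "\<rho> \<in> R0" "e \<in> rel D i0" "xs \<subseteq> e" for \<rho> e
    proof
      assume v: "vt \<rho> 0 \<in> e"
      have eu: "e \<subseteq> univ D" using DD(1) that by (auto simp: is_lstruct_def)
      have ge: "g ` e \<in> rel N i0" using embedding_rel_iff[OF D(2) eu] that by simp
      have "xs0 \<subseteq> g ` e" using that(3) gi_im[of xs0] xs0 by (auto simp: xs_def)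
      hence "g ` e \<inter> (H - B) \<noteq> {}" using xs0 xs0ne by auto
      hence "g ` e \<subseteq> H" using H(7)[rule_format, OF ge] eu D(3) by auto
      hence "th \<rho> \<in> H" using v vt0[OF that(1)] by auto
      thus False using thB[OF that(1)] H(3) by auto
    qed
    show ?thesis
      using ad unfolding admissible_def
    proof (elim disjE exE conjE)
      assume "\<A> = C0 ar"
      thus ?thesis using G.B1_C0 by simp
    next
      fix \<mu> assume a: "\<A> = Cmu ar \<mu>" "\<forall>Y Z. msa ar Y Z \<longrightarrow> delta (restr Z Y) \<ge> 2 \<longrightarrow> \<mu> Y Z \<ge> 2"
        "\<forall>Y Z. msa ar Y Z \<longrightarrow> delta (restr Z Y) = 1 \<longrightarrow> \<mu> Y Z \<ge> 1"
      have "G.B1 \<in> Cmu ar \<mu>"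
        using D(1) a i0 free by (intro G.B1_Cmu) auto
      thus ?thesis using a by simp
    qed
  qed
  have "restr G.B1 (univ D) = D" using G.restr_B1[OF order_refl] DD(1) by simp
  hence "embedding g (restr G.B1 (univ D)) N" "ss (g ` univ D) N" using D H(5) by auto
  from generic_extend[OF gen BA G.ss_B1 this] obtain g1
    where g1: "embedding g1 G.B1 N" "\<forall>a\<in>univ D. g1 a = g a" "ss (g1 ` univ G.B1) N" .
  define Bn where "Bn = g1 ` univ G.B1"
  define t1 where "t1 \<rho> = g1 (vt \<rho> 0)" for \<rho>
  define p1 where "p1 = (\<lambda>\<rho>. (\<rho>, t1 \<rho>)) ` R1"
  have Bnf: "finite Bn" "ss Bn N" using G.finB1 g1 by (auto simp: Bn_def)
  have Bnu: "Bn \<subseteq> univ N" using Bnf by (simp add: ss_def)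
  have DB1: "univ D \<subseteq> univ G.B1" by (simp add: G.univ_B1)
  have BHn: "B \<union> H \<subseteq> Bn"
  proof
    fix b assume "b \<in> B \<union> H"
    then obtain x where "x \<in> univ D" "b = g x" unfolding D(3)[symmetric] by auto
    thus "b \<in> Bn" using g1(2) DB1 by (force simp: Bn_def)
  qed
  have t1R: "t1 \<rho> = th \<rho>" if "\<rho> \<in> R0" for \<rho> using vt0[OF that] g1(2) by (simp add: t1_def)
  have vtu: "vt \<rho> j \<in> univ G.B1" if "\<rho> \<in> R1" "j \<le> T" for \<rho> j
    using that by (force simp: G.univ_B1 G.vx_def)
  have t1B: "t1 ` K \<subseteq> Bn" if "K \<subseteq> R1" for K using vtu that by (auto simp: t1_def Bn_def)
  have dlg1: "dl N (g1 ` U) = dl G.B1 U" if "U \<subseteq> univ G.B1" for U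
    using embedding_dl[OF lang G.str_B1 N.str g1(1) that] finite_subset[OF that G.finB1] by simp
  have "g1 ` Lp = g ` Lp" using g1(2) gLp(2) by (intro image_cong) auto
  hence g1Lp: "g1 ` Lp = H" using gLp(1) by simp
  have rk1: "M.rk K = N.rk (t1 ` K)" if K: "K \<subseteq> R1" for K
  proof (rule antisym)
    have fK: "finite (t1 ` K)" "t1 ` K \<subseteq> univ N" using finite_subset[OF K E.Au(9)] t1B[OF K] Bnu by auto
    have Hu: "H \<subseteq> univ N" using H(3) N.cl_subset_univ by blast
    \<comment> \<open>Adding the loops \<open>H\<close> leaves the dimension unchanged; the
      minimizing set then pulls back to one containing \<open>Lp\<close>, as \<open>dl_ge_r\<close>
      demands.\<close>
    have "dim N (W \<union> t1 ` K \<union> H) = dim N (W \<union> t1 ` K)"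
    proof (rule N.dim_cl)
      have "cl N W \<subseteq> cl N (W \<union> t1 ` K)" using fK N.finX N.Xu by (intro N.cl_mono_fin) auto
      thus "H \<subseteq> cl N (W \<union> t1 ` K)" using H(3) by auto
    qed (use fK N.finX N.Xu H in auto)
    moreover have "W \<union> t1 ` K \<union> H \<subseteq> Bn" using t1B[OF K] BHn B(3) by auto
    from N.ss_dim[OF Bnf(2,1) this] obtain S where
      S: "W \<union> t1 ` K \<union> H \<subseteq> S" "S \<subseteq> Bn" "dim N (W \<union> t1 ` K \<union> H) = dl N S" by (elim exE conjE)
    ultimately have dS: "dim N (W \<union> t1 ` K) = dl N S" by simp
    define U where "U = {x \<in> univ G.B1. g1 x \<in> S}"
    have gU: "g1 ` U = S" using S(2) by (auto simp: U_def Bn_def)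
    have Uu: "U \<subseteq> univ G.B1" by (auto simp: U_def)
    have LpU: "Lp \<subseteq> U" using g1Lp S(1) gLp(2) DB1 by (auto simp: U_def)
    have "K \<subseteq> G.Kl U"
    proof
      fix \<rho> assume \<rho>: "\<rho> \<in> K"
      hence "vt \<rho> 0 \<in> U" using S(1) vtu[of \<rho> 0] K by (auto simp: U_def t1_def)
      thus "\<rho> \<in> G.Kl U" using \<rho> K by (auto simp: G.Kl_def)
    qed
    hence "M.rk K \<le> M.rk (G.Kl U)" by (intro G.r_mono) (auto simp: G.Kl_def)
    thus "M.rk K \<le> N.rk (t1 ` K)"
      using G.dl_ge_r[OF Uu LpU] dlg1[OF Uu] gU dS dlLp by (simp add: N.rk_def)
    obtain V where V: "V \<subseteq> univ G.B1" "Lp \<subseteq> V" "(\<lambda>\<rho>. vt \<rho> 0) ` K \<subseteq> V" "dl G.B1 V \<le> dl D Lp + M.rk K"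
      using G.dl_le_r[OF K] by (elim exE conjE)
    have "W \<subseteq> g1 ` V" using image_mono[OF V(2), of g1] g1Lp H(4) by simp
    hence "W \<union> t1 ` K \<subseteq> g1 ` V" using V(3) by (auto simp: t1_def)
    hence "dim N (W \<union> t1 ` K) \<le> dl N (g1 ` V)"
      using embedding_subset[OF g1(1) V(1)] finite_subset[OF V(1) G.finB1] by (intro N.dim_le) auto
    thus "N.rk (t1 ` K) \<le> M.rk K" using dlg1[OF V(1)] V(4) dlLp by (simp add: N.rk_def)
  qed
  have t1u: "t1 \<rho> \<in> univ N" if "\<rho> \<in> R1" for \<rho> using t1B[of "{\<rho>}"] that Bnu by auto
  have nonloop: "t1 \<rho> \<notin> cl N W" if "\<rho> \<in> R1" for \<rho>
    using N.loop_iff_rk[OF t1u[OF that]] M.loop_iff_rk[OF R1u(1)[OF that]] R1u(2)[OF that] rk1[of "{\<rho>}"] that by simp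
  have nonpar: "\<sigma> = \<rho>" if "\<rho> \<in> R1" "\<sigma> \<in> R1" "t1 \<sigma> \<in> cl N (insert (t1 \<rho>) W)" for \<rho> \<sigma>
  proof -
    have "\<sigma> \<in> cl M (insert \<rho> X)"
      using that N.par_iff_rk[OF t1u] M.par_iff_rk[OF R1u(1)] rk1[of "{\<rho>}"] rk1[of "{\<rho>, \<sigma>}"] by simp
    thus ?thesis using R1(1) that unfolding M.transv_def by auto
  qed
  have cover: "u \<in> cl N W \<or> (\<exists>\<rho>\<in>R1. u \<in> cl N (insert (t1 \<rho>) W))" if u: "u \<in> Bn" for u
  proof -
    obtain x where x: "x \<in> univ G.B1" "u = g1 x" using u by (auto simp: Bn_def)
    show ?thesis
    proof (cases "x \<in> univ D")
      case True
      hence "u \<in> B \<union> H" using x g1(2) D(3) by auto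
      thus ?thesis
      proof
        assume "u \<in> B"
        hence "u \<in> cl N W \<or> (\<exists>b\<in>th ` R0. u \<in> cl N (insert b W))" using tB thR unfolding N.transv_def by auto
        thus ?thesis
        proof
          assume "\<exists>b\<in>th ` R0. u \<in> cl N (insert b W)"
          then obtain \<rho> where "\<rho> \<in> R0" "u \<in> cl N (insert (th \<rho>) W)" by auto
          hence "\<rho> \<in> R1" "u \<in> cl N (insert (t1 \<rho>) W)" using t1R[of \<rho>] R1(2) by auto
          thus ?thesis by blast
        qed simp
      qed (use H(3) in auto)
    next
      case False
      then obtain \<rho> j where \<rho>: "\<rho> \<in> R1" "j \<le> T" "x = vt \<rho> j" using x by (auto simp: G.univ_B1 G.vx_def)
      \<comment> \<open>The whole chain lies in a set whose predimension is \<open>dim N W\<close>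
        plus the rank of the representative, so each of its points is in the closure of
        \<open>W\<close> and that representative.\<close>
      obtain V where V: "V \<subseteq> univ G.B1" "Lp \<subseteq> V" "(\<lambda>\<rho>. vt \<rho> 0) ` {\<rho>} \<subseteq> V" "G.vx ` ({\<rho>} \<times> {..T}) \<subseteq> V"
        "dl G.B1 V \<le> dl D Lp + M.rk {\<rho>}"
      proof -
        have "{\<rho>} \<subseteq> R1" using \<rho> by simp
        from G.dl_le_r[OF this] show thesis using that by (elim exE conjE)
      qed
      have "G.vx (\<rho>, j) \<in> V" using V(4) \<rho>(2) by blast
      hence "x \<in> V" using \<rho>(3) by (simp add: G.vx_def)
      moreover have "W \<subseteq> g1 ` V" using image_mono[OF V(2), of g1] g1Lp H(4) by simp
      ultimately have "insert u (insert (t1 \<rho>) W) \<subseteq> g1 ` V" using V(3) x by (auto simp: t1_def)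
      hence "dim N (insert u (insert (t1 \<rho>) W)) \<le> dl N (g1 ` V)"
        using embedding_subset[OF g1(1) V(1)] finite_subset[OF V(1) G.finB1] by (intro N.dim_le) auto
      also have "\<dots> \<le> dim N W + N.rk {t1 \<rho>}" using dlg1[OF V(1)] V(5) dlLp rk1[of "{\<rho>}"] \<rho> by simp
      also have "\<dots> = dim N (insert (t1 \<rho>) W)" by (simp add: N.rk_def)
      finally have "dim N (insert u (insert (t1 \<rho>) W)) \<le> dim N (insert (t1 \<rho>) W)" .
      moreover have "u \<in> univ N" using u Bnu by auto
      moreover have "dim N (insert (t1 \<rho>) W) \<le> dim N (insert u (insert (t1 \<rho>) W))"
        using t1u[OF \<rho>(1)] \<open>u \<in> univ N\<close> N.finX N.Xu by (intro N.dim_mono) auto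
      ultimately have "u \<in> cl N (insert (t1 \<rho>) W)" using N.finX by (simp add: N.cl_iff)
      thus ?thesis using \<rho> by auto
    qed
  qed
  have tn: "N.transv Bn (t1 ` R1)"
    unfolding N.transv_def using t1B[of R1] nonloop nonpar cover by auto
  have f1: "fst ` p1 = R1" "snd ` p1 = t1 ` R1" by (auto simp: p1_def image_comp)
  have "bfstate M X N W A1 Bn p1"
    unfolding bfstate_def
  proof (intro conjI allI impI)
    show "finite A1" "ss A1 M" "X \<subseteq> A1" "finite Bn" "ss Bn N" "W \<subseteq> Bn"
      using A1 A Bnf BHn B(3) by auto
    show "inj_on fst p1" by (auto simp: p1_def inj_on_def)
    have "\<sigma> = \<rho>" if "\<rho> \<in> R1" "\<sigma> \<in> R1" "t1 \<sigma> = t1 \<rho>" for \<rho> \<sigma>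
    proof -
      have "t1 \<sigma> \<in> cl N (insert (t1 \<rho>) W)"
        using N.cl_extensive[of "insert (t1 \<rho>) W"] t1u[OF that(1)] N.finX N.Xu that(3) by auto
      thus ?thesis by (rule nonpar[OF that(1,2)])
    qed
    thus "inj_on snd p1" by (auto simp: p1_def inj_on_def)
    show "M.transv A1 (fst ` p1)" "N.transv Bn (snd ` p1)" using f1 R1 tn by auto
    fix J assume J: "J \<subseteq> p1"
    have "fst ` J \<subseteq> R1" using J f1 by auto
    moreover have "snd ` J = t1 ` fst ` J"
      unfolding image_image by (rule image_cong) (use J in \<open>auto simp: p1_def\<close>)
    ultimately show "M.rk (fst ` J) = N.rk (snd ` J)" using rk1 by simp
  qed
  moreover have "p \<subseteq> p1"
  proof clarify
    fix a b assume ab: "(a, b) \<in> p"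
    hence "a \<in> R0" by (force simp: R0_def)
    thus "(a, b) \<in> p1" using thp[OF ab] t1R R1(2) by (force simp: p1_def)
  qed
  moreover have "B \<subseteq> Bn" using BHn by auto
  ultimately show thesis using that by blast
qed

section \<open>The isomorphism of geometries\<close>

context localized
begin

definition cls :: "'a \<Rightarrow> 'a set" where
  "cls u = cl D (insert u X) - cl D X"

lemma pts_geom_over: "pts (geom_over D X) = {cls u | u. u \<in> univ D \<and> u \<notin> cl D X}"
  by (simp add: geom_over_def geometry_of_def localization_def pregeom_of_def cls_def)

lemma clo_geom_over: "clo (geom_over D X) S = {cls u | u. u \<in> cl D (X \<union> \<Union>S) \<and> u \<notin> cl D X}"
  by (simp add: geom_over_def geometry_of_def localization_def pregeom_of_def cls_def)

lemma cls_self: "u \<in> univ D \<Longrightarrow> u \<notin> cl D X \<Longrightarrow> u \<in> cls u"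
  using cl_extensive[of "insert u X"] finX Xu by (auto simp: cls_def)

lemma cls_eq_iff:
  assumes "u \<in> univ D" "u \<notin> cl D X" "v \<in> univ D"
  shows "cls u = cls v \<longleftrightarrow> u \<in> cl D (insert v X)"
proof
  assume "cls u = cls v"
  thus "u \<in> cl D (insert v X)" using cls_self[OF assms(1,2)] by (auto simp: cls_def)
next
  assume "u \<in> cl D (insert v X)"
  thus "cls u = cls v" using par_eq[OF assms(3) _ assms(2)] by (simp add: cls_def)
qed

text \<open>With \<open>R\<close> and \<open>\<pi>\<close> abstract, the same set of pairs can be
  used with \<open>fst\<close> on one side and \<open>snd\<close> on the other, and the two criteria
  then correspond by equality of ranks.\<close>

lemma cls_in_clo_iff:
  assumes \<pi>: "\<And>z. z \<in> R \<Longrightarrow> \<pi> z \<in> univ D \<and> \<pi> z \<notin> cl D X"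
    and dense: "\<And>u. u \<in> univ D \<Longrightarrow> u \<notin> cl D X \<Longrightarrow> \<exists>z\<in>R. u \<in> cl D (insert (\<pi> z) X)"
    and S: "S \<subseteq> pts (geom_over D X)" and z: "z \<in> R"
  shows "cls (\<pi> z) \<in> clo (geom_over D X) S \<longleftrightarrow>
    (\<exists>J. finite J \<and> J \<subseteq> R \<and> (\<forall>j\<in>J. cls (\<pi> j) \<in> S) \<and> rk (\<pi> ` insert z J) = rk (\<pi> ` J))" (is "?l \<longleftrightarrow> ?r")
proof -
  have inJ: "\<pi> z \<in> cl D (X \<union> \<pi> ` J) \<longleftrightarrow> rk (\<pi> ` insert z J) = rk (\<pi> ` J)" if "finite J" for J
    using cl_iff[of "X \<union> \<pi> ` J" "\<pi> z"] finX that \<pi>[OF z] by (simp add: rk_def)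
  have Su: "\<Union>S \<subseteq> univ D" using S cl_subset_univ by (fastforce simp: pts_geom_over cls_def)
  show ?thesis
  proof
    assume ?l
    then obtain x where x: "cls (\<pi> z) = cls x" "x \<in> cl D (X \<union> \<Union>S)" "x \<notin> cl D X"
      by (auto simp: clo_geom_over)
    obtain F where F: "finite F" "F \<subseteq> X \<union> \<Union>S" "x \<in> cl D F"
      using cl_iff_finite_subset[of "X \<union> \<Union>S" x] x Su Xu by auto
    have "\<exists>j\<in>R. u \<in> cl D (insert (\<pi> j) X) \<and> cls (\<pi> j) \<in> S" if u: "u \<in> F - X" for u
    proof -
      obtain y where y: "u \<in> cls y" "cls y \<in> S" "y \<in> univ D" using u F(2) S by (fastforce simp: pts_geom_over)
      have uu: "u \<in> univ D" "u \<notin> cl D X" using y(1) cl_subset_univ by (auto simp: cls_def)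
      have "cls u = cls y" using cls_eq_iff[OF uu y(3)] y(1) by (simp add: cls_def)
      moreover obtain j where j: "j \<in> R" "u \<in> cl D (insert (\<pi> j) X)" using dense[OF uu] by auto
      moreover have "cls u = cls (\<pi> j)" using cls_eq_iff[OF uu] \<pi>[OF j(1)] j(2) by simp
      ultimately show ?thesis using y(2) by auto
    qed
    then obtain c where c: "\<And>u. u \<in> F - X \<Longrightarrow> c u \<in> R \<and> u \<in> cl D (insert (\<pi> (c u)) X) \<and> cls (\<pi> (c u)) \<in> S"
      by metis
    define J where "J = c ` (F - X)"
    have J: "finite J" "J \<subseteq> R" "\<forall>j\<in>J. cls (\<pi> j) \<in> S" using F c by (auto simp: J_def)
    have Ju: "finite (X \<union> \<pi> ` J)" "X \<union> \<pi> ` J \<subseteq> univ D" using J \<pi> finX Xu by auto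
    have "F \<subseteq> cl D (X \<union> \<pi> ` J)"
    proof
      fix u assume u: "u \<in> F"
      show "u \<in> cl D (X \<union> \<pi> ` J)"
      proof (cases "u \<in> X")
        case True
        thus ?thesis using cl_extensive[OF Ju] by auto
      next
        case False
        have "insert (\<pi> (c u)) X \<subseteq> X \<union> \<pi> ` J" using u False by (auto simp: J_def)
        hence "cl D (insert (\<pi> (c u)) X) \<subseteq> cl D (X \<union> \<pi> ` J)" using Ju by (rule cl_mono_fin)
        thus ?thesis using c[of u] u False by auto
      qed
    qed
    hence xJ: "x \<in> cl D (X \<union> \<pi> ` J)" using cl_subsetI[OF Ju F(1)] F(3) by auto
    have xu: "x \<in> univ D" using xJ cl_subset_univ by auto
    have "\<pi> z \<in> cl D (insert x X)" using cls_eq_iff[of "\<pi> z" x] \<pi>[OF z] xu x(1) by simp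
    moreover have "cl D (insert x X) \<subseteq> cl D (X \<union> \<pi> ` J)"
      using xJ cl_extensive[OF Ju] finX by (intro cl_subsetI[OF Ju]) auto
    ultimately have "\<pi> z \<in> cl D (X \<union> \<pi> ` J)" by auto
    thus ?r using J inJ[OF J(1)] by blast
  next
    assume ?r
    then obtain J where J: "finite J" "J \<subseteq> R" "\<forall>j\<in>J. cls (\<pi> j) \<in> S" "rk (\<pi> ` insert z J) = rk (\<pi> ` J)"
      by (elim exE conjE)
    have "\<pi> ` J \<subseteq> \<Union>S" using J(2,3) \<pi> cls_self by blast
    hence "X \<union> \<pi> ` J \<subseteq> X \<union> \<Union>S" by auto
    hence "cl D (X \<union> \<pi> ` J) \<subseteq> cl D (X \<union> \<Union>S)" using Su Xu by (intro cl_mono) auto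
    thus ?l using inJ[OF J(1)] J(4) \<pi>[OF z] by (auto simp: clo_geom_over)
  qed
qed

end

text \<open>Equality of classes and membership in closures are both equalities of ranks, so a
  rank-preserving relation that reaches all classes on both sides induces an isomorphism.\<close>

lemma geom_iso_of_relation:
  assumes M: "localized ar M X" and N: "localized ar N W"
    and RM: "\<And>z. z \<in> R \<Longrightarrow> fst z \<in> univ M \<and> fst z \<notin> cl M X"
    and RN: "\<And>z. z \<in> R \<Longrightarrow> snd z \<in> univ N \<and> snd z \<notin> cl N W"
    and rk: "\<And>J. finite J \<Longrightarrow> J \<subseteq> R \<Longrightarrow> localized.rk M X (fst ` J) = localized.rk N W (snd ` J)"
    and dM: "\<And>u. u \<in> univ M \<Longrightarrow> u \<notin> cl M X \<Longrightarrow> \<exists>z\<in>R. u \<in> cl M (insert (fst z) X)"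
    and dN: "\<And>u. u \<in> univ N \<Longrightarrow> u \<notin> cl N W \<Longrightarrow> \<exists>z\<in>R. u \<in> cl N (insert (snd z) W)"
  shows "geom_iso (geom_over M X) (geom_over N W)"
proof -
  interpret M: localized ar M X by (rule M)
  interpret N: localized ar N W by (rule N)
  have key: "M.cls (fst z) = M.cls (fst z') \<longleftrightarrow> N.cls (snd z) = N.cls (snd z')" if z: "z \<in> R" "z' \<in> R" for z z'
    using M.cls_eq_iff[of "fst z" "fst z'"] N.cls_eq_iff[of "snd z" "snd z'"] RM RN z
      M.par_iff_rk[of "fst z" "fst z'"] N.par_iff_rk[of "snd z" "snd z'"] rk[of "{z', z}"] rk[of "{z'}"] by simp
  have pM: "pts (geom_over M X) = (\<lambda>z. M.cls (fst z)) ` R"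
  proof -
    have "M.cls u \<in> (\<lambda>z. M.cls (fst z)) ` R" if u: "u \<in> univ M" "u \<notin> cl M X" for u
    proof -
      obtain z where z: "z \<in> R" "u \<in> cl M (insert (fst z) X)" using dM[OF u] by auto
      hence "M.cls u = M.cls (fst z)" using M.cls_eq_iff[OF u] RM by simp
      thus ?thesis using z by auto
    qed
    thus ?thesis using RM by (auto simp: M.pts_geom_over)
  qed
  have pN: "pts (geom_over N W) = (\<lambda>z. N.cls (snd z)) ` R"
  proof -
    have "N.cls u \<in> (\<lambda>z. N.cls (snd z)) ` R" if u: "u \<in> univ N" "u \<notin> cl N W" for u
    proof -
      obtain z where z: "z \<in> R" "u \<in> cl N (insert (snd z) W)" using dN[OF u] by auto
      hence "N.cls u = N.cls (snd z)" using N.cls_eq_iff[OF u] RN by simp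
      thus ?thesis using z by auto
    qed
    thus ?thesis using RN by (auto simp: N.pts_geom_over)
  qed
  \<comment> \<open>The choice is harmless: by \<open>key\<close>, pairs with the same first class
    have the same second class.\<close>
  define f where "f P = N.cls (snd (SOME z. z \<in> R \<and> M.cls (fst z) = P))" for P
  have f: "f (M.cls (fst z)) = N.cls (snd z)" if z: "z \<in> R" for z
  proof -
    have "\<exists>z'. z' \<in> R \<and> M.cls (fst z') = M.cls (fst z)" using z by (intro exI[of _ z]) simp
    from someI_ex[OF this] show ?thesis using key[OF _ z] unfolding f_def by blast
  qed
  have bij: "bij_betw f (pts (geom_over M X)) (pts (geom_over N W))"
    unfolding bij_betw_def
  proof
    show "inj_on f (pts (geom_over M X))"
      unfolding pM
    proof (rule inj_onI)
      fix P P' assume "P \<in> (\<lambda>z. M.cls (fst z)) ` R" "P' \<in> (\<lambda>z. M.cls (fst z)) ` R" and eq: "f P = f P'"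
      then obtain z z' where z: "z \<in> R" "z' \<in> R" "P = M.cls (fst z)" "P' = M.cls (fst z')" by blast
      thus "P = P'" using eq f[OF z(1)] f[OF z(2)] key[OF z(1,2)] by simp
    qed
    show "f ` pts (geom_over M X) = pts (geom_over N W)" unfolding pM pN image_image
      by (rule image_cong) (auto simp: f)
  qed
  have "f ` clo (geom_over M X) S = clo (geom_over N W) (f ` S)" if S: "S \<subseteq> pts (geom_over M X)" for S
  proof -
    have S': "f ` S \<subseteq> pts (geom_over N W)" using S bij by (auto simp: bij_betw_def)
    have memS: "M.cls (fst j) \<in> S \<longleftrightarrow> N.cls (snd j) \<in> f ` S" if j: "j \<in> R" for j
    proof -
      have "M.cls (fst j) \<in> pts (geom_over M X)" using j pM by auto
      thus ?thesis using inj_on_image_mem_iff[OF bij_betw_imp_inj_on[OF bij] _ S] f[OF j] by metis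
    qed
    have iff: "M.cls (fst z) \<in> clo (geom_over M X) S \<longleftrightarrow> N.cls (snd z) \<in> clo (geom_over N W) (f ` S)" if z: "z \<in> R" for z
    proof -
      have eqv: "(\<forall>j\<in>J. M.cls (fst j) \<in> S) \<and> M.rk (fst ` insert z J) = M.rk (fst ` J) \<longleftrightarrow>
          (\<forall>j\<in>J. N.cls (snd j) \<in> f ` S) \<and> N.rk (snd ` insert z J) = N.rk (snd ` J)"
        if J: "finite J" "J \<subseteq> R" for J
      proof -
        have "(\<forall>j\<in>J. M.cls (fst j) \<in> S) \<longleftrightarrow> (\<forall>j\<in>J. N.cls (snd j) \<in> f ` S)"
          by (rule ball_cong[OF refl], rule memS) (use J in blast)
        moreover have "M.rk (fst ` insert z J) = N.rk (snd ` insert z J)" "M.rk (fst ` J) = N.rk (snd ` J)"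
          by (rule rk; use J z in simp)+
        ultimately show ?thesis by presburger
      qed
      have "M.cls (fst z) \<in> clo (geom_over M X) S \<longleftrightarrow> (\<exists>J. finite J \<and> J \<subseteq> R \<and>
          (\<forall>j\<in>J. M.cls (fst j) \<in> S) \<and> M.rk (fst ` insert z J) = M.rk (fst ` J))"
        by (rule M.cls_in_clo_iff[OF _ _ S z]) (use RM dM in auto)
      moreover have "N.cls (snd z) \<in> clo (geom_over N W) (f ` S) \<longleftrightarrow> (\<exists>J. finite J \<and> J \<subseteq> R \<and>
          (\<forall>j\<in>J. N.cls (snd j) \<in> f ` S) \<and> N.rk (snd ` insert z J) = N.rk (snd ` J))"
        by (rule N.cls_in_clo_iff[OF _ _ S' z]) (use RN dN in auto)
      moreover have "(\<exists>J. finite J \<and> J \<subseteq> R \<and>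
          (\<forall>j\<in>J. M.cls (fst j) \<in> S) \<and> M.rk (fst ` insert z J) = M.rk (fst ` J)) \<longleftrightarrow>
        (\<exists>J. finite J \<and> J \<subseteq> R \<and>
          (\<forall>j\<in>J. N.cls (snd j) \<in> f ` S) \<and> N.rk (snd ` insert z J) = N.rk (snd ` J))"
        by (rule ex_cong1, rule conj_cong[OF refl], rule conj_cong[OF refl], rule eqv)
      ultimately show ?thesis by simp
    qed
    have sub1: "clo (geom_over M X) S \<subseteq> (\<lambda>z. M.cls (fst z)) ` R"
      unfolding pM[symmetric] using M.cl_subset_univ by (auto simp: M.clo_geom_over M.pts_geom_over)
    have sub2: "clo (geom_over N W) (f ` S) \<subseteq> (\<lambda>z. N.cls (snd z)) ` R"
      unfolding pN[symmetric] using N.cl_subset_univ by (auto simp: N.clo_geom_over N.pts_geom_over)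
    show ?thesis
    proof
      show "f ` clo (geom_over M X) S \<subseteq> clo (geom_over N W) (f ` S)"
      proof clarify
        fix P assume P: "P \<in> clo (geom_over M X) S"
        then obtain z where "z \<in> R" "P = M.cls (fst z)" using sub1 by auto
        thus "f P \<in> clo (geom_over N W) (f ` S)" using P iff f by simp
      qed
      show "clo (geom_over N W) (f ` S) \<subseteq> f ` clo (geom_over M X) S"
      proof
        fix P assume P: "P \<in> clo (geom_over N W) (f ` S)"
        then obtain z where z: "z \<in> R" "P = N.cls (snd z)" using sub2 by auto
        hence "M.cls (fst z) \<in> clo (geom_over M X) S" using P iff by simp
        thus "P \<in> f ` clo (geom_over M X) S" using f[OF z(1)] z(2) by (metis imageI)
      qed
    qed
  qed
  thus ?thesis using bij unfolding geom_iso_def by blast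
qed

lemma bfstate_step:
  assumes M: "localized ar M X" and N: "localized ar N W" and ad: "admissible ar \<A>" "admissible ar \<B>"
    and gen: "is_generic ar \<A> M" "is_generic ar \<B> N"
    and inf: "infinite (cl M X)" "infinite (cl N W)"
    and st: "bfstate M X N W A B p" and u: "u \<in> univ M" and v: "v \<in> univ N"
  shows "\<exists>A' B' p'. bfstate M X N W A' B' p' \<and> p \<subseteq> p' \<and> A \<subseteq> A' \<and> B \<subseteq> B' \<and> u \<in> A' \<and> v \<in> B'"
proof -
  interpret M: localized ar M X by (rule M)
  interpret N: localized ar N W by (rule N)
  have A: "finite A" "A \<subseteq> univ M" using st by (auto simp: bfstate_def ss_def)
  obtain A1 where A1: "insert u A \<subseteq> A1" "finite A1" "ss A1 M"
    using M.ss_hull[of "insert u A"] A u by (metis finite.insertI insert_subset)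
  have "A \<subseteq> A1" using A1 by auto
  then obtain B1 p1 where 1: "bfstate M X N W A1 B1 p1" "p \<subseteq> p1" "B \<subseteq> B1"
    using bfstate_extend[OF M N ad(2) gen(2) inf(2) st _ A1(2,3)] by metis
  have B1: "finite B1" "B1 \<subseteq> univ N" using 1 by (auto simp: bfstate_def ss_def)
  obtain B2 where B2: "insert v B1 \<subseteq> B2" "finite B2" "ss B2 N"
    using N.ss_hull[of "insert v B1"] B1 v by (metis finite.insertI insert_subset)
  have "B1 \<subseteq> B2" using B2 by auto
  then obtain A2 p2 where 2: "bfstate N W M X B2 A2 p2" "prod.swap ` p1 \<subseteq> p2" "A1 \<subseteq> A2"
    using bfstate_extend[OF N M ad(1) gen(1) inf(1) bfstate_sym[OF 1(1)] _ B2(2,3)] by metis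
  have "bfstate M X N W A2 B2 (prod.swap ` p2)" by (rule bfstate_sym[OF 2(1)])
  moreover have "p \<subseteq> prod.swap ` p2" using 1(2) 2(2) by force
  ultimately show ?thesis using A1(1) 1(3) 2(3) B2(1) by (intro exI[of _ A2] exI[of _ B2] exI[of _ "prod.swap ` p2"]) auto
qed

lemma geom_iso_generic:
  fixes M :: "('i, 'a) lstruct" and N :: "('i, 'b) lstruct"
  assumes M: "localized ar M X" and N: "localized ar N W" and ad: "admissible ar \<A>" "admissible ar \<B>"
    and gen: "is_generic ar \<A> M" "is_generic ar \<B> N"
    and inf: "infinite (cl M X)" "infinite (cl N W)"
  shows "geom_iso (geom_over M X) (geom_over N W)"
proof -
  interpret M: localized ar M X by (rule M)
  interpret N: localized ar N W by (rule N)
  have cnt: "countable (univ M)" "countable (univ N)" using gen by (auto simp: is_generic_def)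
  have ne: "univ M \<noteq> {}" "univ N \<noteq> {}" using inf M.cl_subset_univ[of X] N.cl_subset_univ[of W] by auto
  define en where "en = from_nat_into (univ M)"
  define em where "em = from_nat_into (univ N)"
  have en: "range en = univ M" "range em = univ N"
    using cnt ne by (auto simp: en_def em_def range_from_nat_into)
  define P where "P = (\<lambda>(n::nat) s. case s of (A, B, p) \<Rightarrow> bfstate M X N W A B p)"
  define Q where "Q = (\<lambda>n s s'. case s of (A, B, p) \<Rightarrow> case s' of (A', B', p') \<Rightarrow>
     p \<subseteq> (p' :: ('a \<times> 'b) set) \<and> A \<subseteq> A' \<and> B \<subseteq> B' \<and> en n \<in> A' \<and> em n \<in> B')"
  \<comment> \<open>The start of the construction: \<open>X\<close> and \<open>W\<close> contain
    only loops, so there is no class to match.\<close>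
  have "bfstate M X N W X W {}"
  proof -
    have "X \<subseteq> cl M X" "W \<subseteq> cl N W" using M.cl_extensive N.cl_extensive M.finX M.Xu N.finX N.Xu by auto
    thus ?thesis
      using M.finX M.ssX N.finX N.ssX by (auto simp: bfstate_def M.transv_def N.transv_def)
  qed
  hence 0: "\<exists>s. P 0 s" by (intro exI[of _ "(X, W, {})"]) (simp add: P_def)
  have step: "\<exists>s'. P (Suc n) s' \<and> Q n s s'" if "P n s" for n s
  proof -
    obtain A B p where s: "s = (A, B, p)" by (cases s)
    have st: "bfstate M X N W A B p" using that by (simp add: P_def s)
    have e: "en n \<in> univ M" "em n \<in> univ N" using en by auto
    obtain A' B' p' where "bfstate M X N W A' B' p' \<and> p \<subseteq> p' \<and> A \<subseteq> A' \<and> B \<subseteq> B' \<and> en n \<in> A' \<and> em n \<in> B'"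
      using bfstate_step[OF M N ad gen inf st e] by (elim exE)
    thus ?thesis by (intro exI[of _ "(A', B', p')"]) (simp add: P_def Q_def s)
  qed
  from dependent_nat_choice[of P Q, OF 0 step] obtain s where s: "\<And>n. P n (s n)" "\<And>n. Q n (s n) (s (Suc n))"
    by auto
  define A where "A n = fst (s n)" for n
  define B where "B n = fst (snd (s n))" for n
  define p where "p n = snd (snd (s n))" for n
  have st: "bfstate M X N W (A n) (B n) (p n)" for n
    using s(1)[of n] by (simp add: P_def A_def B_def p_def case_prod_beta)
  have inc: "p n \<subseteq> p (Suc n)" "en n \<in> A (Suc n)" "em n \<in> B (Suc n)" for n
    using s(2)[of n] by (simp_all add: Q_def A_def B_def p_def case_prod_beta)
  have mono: "p n \<subseteq> p m" if "n \<le> m" for n m using lift_Suc_mono_le[of p n m] inc that by auto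
  define R where "R = (\<Union>n. p n)"
  have tM: "M.transv (A n) (fst ` p n)" "A n \<subseteq> univ M" and tN: "N.transv (B n) (snd ` p n)" "B n \<subseteq> univ N"
    and rkn: "\<And>J. J \<subseteq> p n \<Longrightarrow> M.rk (fst ` J) = N.rk (snd ` J)" for n
    using st[of n] by (auto simp: bfstate_def ss_def)
  show ?thesis
  proof (rule geom_iso_of_relation[OF M N, of R])
    show "fst z \<in> univ M \<and> fst z \<notin> cl M X" if z: "z \<in> R" for z
    proof -
      obtain n where "z \<in> p n" using z by (auto simp: R_def)
      thus ?thesis using tM[of n] unfolding M.transv_def by auto
    qed
    show "snd z \<in> univ N \<and> snd z \<notin> cl N W" if z: "z \<in> R" for z
    proof -
      obtain n where "z \<in> p n" using z by (auto simp: R_def)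
      thus ?thesis using tN[of n] unfolding N.transv_def by auto
    qed
    show "M.rk (fst ` J) = N.rk (snd ` J)" if J: "finite J" "J \<subseteq> R" for J
    proof -
      have "\<exists>n. J \<subseteq> p n" using J
      proof (induction J rule: finite_induct)
        case (insert x J)
        then obtain k l where k: "J \<subseteq> p k" "x \<in> p l" by (auto simp: R_def)
        have "p k \<subseteq> p (max k l)" "p l \<subseteq> p (max k l)" by (auto intro!: mono)
        thus ?case using k by (intro exI[of _ "max k l"]) auto
      qed simp
      thus ?thesis using rkn by auto
    qed
    show "\<exists>z\<in>R. u \<in> cl M (insert (fst z) X)" if u: "u \<in> univ M" "u \<notin> cl M X" for u
    proof -
      obtain n where "u = en n" using u en by auto
      hence "u \<in> A (Suc n)" using inc by simp
      hence "\<exists>z\<in>p (Suc n). u \<in> cl M (insert (fst z) X)" using tM(1)[of "Suc n"] u unfolding M.transv_def by auto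
      thus ?thesis by (auto simp: R_def)
    qed
    show "\<exists>z\<in>R. u \<in> cl N (insert (snd z) W)" if u: "u \<in> univ N" "u \<notin> cl N W" for u
    proof -
      obtain n where "u = em n" using u en by auto
      hence "u \<in> B (Suc n)" using inc by simp
      hence "\<exists>z\<in>p (Suc n). u \<in> cl N (insert (snd z) W)" using tN(1)[of "Suc n"] u unfolding N.transv_def by auto
      thus ?thesis by (auto simp: R_def)
    qed
  qed
qed

section \<open>Infinite closures\<close>

lemma C0bar_struct_generic:
  assumes "language ar" "is_generic ar \<A> N"
  shows "C0bar_struct ar N"
proof
  show "language ar" "N \<in> C0bar ar" "is_lstruct ar N"
    using assms by (auto simp: is_generic_def C0bar_def)
qed

lemma (in C0bar_struct) ss_empty: "ss {} D"
  using dl_nonneg by (simp add: ss_def)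

lemma embedding_empty:
  assumes "language ar" "is_lstruct ar D" "is_lstruct ar N"
  shows "embedding h (restr D {}) N"
proof -
  interpret D: lang_struct ar D using assms by unfold_locales
  interpret N: lang_struct ar N using assms by unfold_locales
  show ?thesis using D.relD(4) N.relD(4) by (auto simp: embedding_def)
qed

lemma generic_realize:
  assumes L: "language ar" and g: "is_generic ar \<A> N" and D: "D \<in> \<A>" "D \<in> C0 ar"
  obtains g where "embedding g D N" "ss (g ` univ D) N"
proof -
  interpret N: C0bar_struct ar N by (rule C0bar_struct_generic[OF L g])
  interpret D: lang_struct ar D using L C0D(1)[OF D(2)] by unfold_locales
  have "ss_fin {} D" using C0D(3)[OF D(2)] by (simp add: ss_fin_def)
  moreover have "embedding undefined (restr D {}) N" by (rule embedding_empty[OF L D.str N.str])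
  moreover have "ss (undefined ` {}) N" using N.ss_empty by simp
  ultimately show thesis using generic_extend[OF g D(1)] that by blast
qed

text \<open>Self-sufficient copies of such structures in the generic structure consist of points in
  the closure of the empty set, which is thereby shown infinite.\<close>

lemma large_zero_structure:
  fixes ar :: "'i \<Rightarrow> nat"
  assumes L: "language ar"
  obtains D :: "('i, nat) lstruct" where "D \<in> C0 ar" "delta D = 0" "m \<le> card (univ D)"
proof -
  fix i0 :: 'i
  define n where "n = ar i0"
  have n: "3 \<le> n" using L by (simp add: n_def language_def)
  define k where "k = m + 2 * n"
  \<comment> \<open>\<open>i \<in> E i\<close>, so a set \<open>S\<close> contains at most \<open>card S\<close> of the edges\<close>
  define E where "E i = insert i (if i < n - 1 then {n - 1..<2 * n - 2} else {..<n - 1})" for i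
  define D :: "('i, nat) lstruct" where "D = \<lparr>univ = {..<k}, rel = (\<lambda>i. if i = i0 then E ` {..<k} else {})\<rparr>"
  have cE: "card (E i) = n" for i
  proof (cases "i < n - 1")
    case True
    have "E i = insert i {n - 1..<2 * n - 2}" using True by (simp add: E_def)
    moreover have "i \<notin> {n - 1..<2 * n - 2}" using True by auto
    ultimately show ?thesis using n by simp
  next
    case False
    have "E i = insert i {..<n - 1}" using False by (simp add: E_def)
    moreover have "i \<notin> {..<n - 1}" using False by auto
    ultimately show ?thesis using n by simp
  qed
  have fE: "finite (E i)" for i by (simp add: E_def)
  have Ek: "E i \<subseteq> {..<k}" if "i < k" for i using that n by (auto simp: E_def k_def)
  have str: "is_lstruct ar D" using cE fE Ek by (auto simp: is_lstruct_def D_def n_def split: if_splits)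
  interpret D: lang_struct ar D using L str by unfold_locales
  \<comment> \<open>An edge with index below \<open>n - 1\<close> has at least two points from
    \<open>n - 1\<close> on, any other edge exactly one. In either case the index is the only point
    on its own side.\<close>
  have injE: "i = j" if e: "E i = E j" for i j
  proof -
    have small: "E i \<inter> {n - 1..} = {i}" if "\<not> i < n - 1" for i using that by (auto simp: E_def)
    have big: "{n - 1, n} \<subseteq> E i" if "i < n - 1" for i using that n by (auto simp: E_def)
    have big': "E i \<inter> {..<n - 1} = {i}" if "i < n - 1" for i using that by (auto simp: E_def)
    have no: False if "i < n - 1" "\<not> j < n - 1" "E i = E j" for i j
    proof -
      have "n - 1 \<in> {j}" "n \<in> {j}" using big[OF that(1)] small[OF that(2)] that(3) by auto
      thus False using n by simp
    qed
    show ?thesis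
    proof (cases "i < n - 1"; cases "j < n - 1")
      assume "i < n - 1" "j < n - 1"
      thus ?thesis using big'[of i] big'[of j] e by auto
    next
      assume "\<not> i < n - 1" "\<not> j < n - 1"
      thus ?thesis using small[of i] small[of j] e by auto
    qed (use no[of i j] no[of j i] e in auto)
  qed
  have edS: "ed D S = (\<lambda>i. (i0, E i)) ` {i \<in> S. E i \<subseteq> S}" if "S \<subseteq> {..<k}" for S
  proof -
    have "i \<in> S" if "E i \<subseteq> S" for i using that by (auto simp: E_def)
    thus ?thesis using that by (auto simp: ed_def D_def split: if_splits)
  qed
  have "0 \<le> dl D S" if S: "S \<subseteq> univ D" for S
  proof -
    have S': "S \<subseteq> {..<k}" using S by (simp add: D_def)
    hence fS: "finite S" by (rule finite_subset) simp
    have "card (ed D S) \<le> card {i \<in> S. E i \<subseteq> S}" unfolding edS[OF S'] using fS by (intro card_image_le) simp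
    also have "\<dots> \<le> card S" using fS by (intro card_mono) auto
    finally show ?thesis by (simp add: D.dl_eq[OF fS])
  qed
  hence "D \<in> C0 ar" using str by (simp add: C0_def D_def)
  moreover have "delta D = 0"
  proof -
    have "{i \<in> {..<k}. E i \<subseteq> {..<k}} = {..<k}" using Ek by auto
    moreover have "inj_on (\<lambda>i. (i0, E i)) {..<k}" using injE by (auto simp: inj_on_def)
    ultimately have "card (ed D {..<k}) = k" using edS[of "{..<k}"] by (simp add: card_image)
    hence "dl D {..<k} = 0" by (simp add: D.dl_eq)
    moreover have "univ D = {..<k}" by (simp add: D_def)
    ultimately show ?thesis using restr_univ[OF str] by simp
  qed
  moreover have "m \<le> card (univ D)" by (simp add: D_def k_def)
  ultimately show thesis using that by blast
qed

lemma infinite_cl_empty: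
  fixes N :: "('i, 'b) lstruct"
  assumes L: "language ar" and g: "is_generic ar (C0 ar) N"
  shows "infinite (cl N {})"
proof
  assume f: "finite (cl N {})"
  interpret N: C0bar_struct ar N by (rule C0bar_struct_generic[OF L g])
  obtain D :: "('i, nat) lstruct" where D: "D \<in> C0 ar" "delta D = 0" "Suc (card (cl N {})) \<le> card (univ D)"
    using large_zero_structure[OF L] .
  obtain h where h: "embedding h D N" "ss (h ` univ D) N" using generic_realize[OF L g D(1,1)] .
  have hu: "h ` univ D \<subseteq> univ N" "finite (h ` univ D)" using h C0D(2)[OF D(1)] by (auto simp: ss_def)
  have dl0: "dl N (h ` univ D) = 0"
    using embedding_dl[OF L C0D(1)[OF D(1)] N.str h(1) order_refl C0D(2)[OF D(1)]] D(2) C0D(1)[OF D(1)] by simp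
  have "h ` univ D \<subseteq> cl N {}"
  proof
    fix u assume u: "u \<in> h ` univ D"
    have "dim N {u} \<le> 0" using N.dim_le[of "{u}" "h ` univ D"] u hu dl0 by simp
    moreover have "0 \<le> dim N {}" by (rule N.dim_geI) (auto intro: N.dl_nonneg)
    moreover have "dim N {} \<le> dim N {u}" using u hu by (intro N.dim_mono) auto
    ultimately show "u \<in> cl N {}" using u hu by (auto simp: N.cl_iff)
  qed
  hence "card (h ` univ D) \<le> card (cl N {})" using f by (intro card_mono)
  moreover have "card (h ` univ D) = card (univ D)" by (rule card_image[OF embedding_inj[OF h(1)]])
  ultimately show False using D(3) by simp
qed

text \<open>Without relations the predimension is the number of points, so a proper extension is
  never algebraic and no copy of one occurs.\<close>

lemma discrete_Cmu:
  assumes L: "language ar" and F: "finite S"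
  shows "\<lparr>univ = S, rel = (\<lambda>i. {})\<rparr> \<in> Cmu ar \<mu>" (is "?D \<in> _")
proof (rule CmuI)
  have str: "is_lstruct ar ?D" by (simp add: is_lstruct_def)
  interpret D: lang_struct ar ?D using L str by unfold_locales
  have "0 \<le> dl ?D U" if "U \<subseteq> S" for U
    using finite_subset[OF that F] by (simp add: D.dl_eq ed_def)
  thus "?D \<in> C0 ar" using str F by (simp add: C0_def)
  fix Y Z h G
  assume m: "msa ar Y Z" and G: "\<forall>j \<le> \<mu> Y Z. embedding (G j) Z ?D \<and> (\<forall>y \<in> Y. G j y = h y)"
  note mD = msaD[OF m]
  interpret Z: lang_struct ar Z using L mD by unfold_locales
  have e: "embedding (G 0) Z ?D" using G by simp
  have "e \<notin> rel Z i" for i e using embedding_rel_iff[OF e, of e i] Z.relD(1)[of e i] by auto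
  hence ed: "ed Z U = {}" for U by (auto simp: ed_def)
  have fY: "finite Y" using mD(2,6) finite_subset by blast
  have "card Y = card (univ Z)" using mD(4,5,6) Z.dl_eq[OF fY] Z.dl_eq[OF mD(6)] by (simp add: ed)
  thus False using card_subset_eq[OF mD(6) mD(2)] mD(3) by simp
qed

text \<open>\<open>X\<close> consists of \<open>ar i0 - 1\<close> independent points:
  \<open>ar i0 - 2\<close> of them serve as \<open>xs\<close>, the last starts a chain that stays in
  the closure of \<open>X\<close>. The points of \<open>xs\<close> act as loops only in that ranks
  are counted over them.\<close>

lemma exists_infinite_cl:
  fixes M :: "('i, 'a) lstruct"
  assumes L: "language ar" and g: "is_generic ar (Cmu ar \<mu>) M"
    and mu2: "\<And>Y Z. msa ar Y Z \<Longrightarrow> delta (restr Z Y) \<ge> 2 \<Longrightarrow> \<mu> Y Z \<ge> 2"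
    and mu1: "\<And>Y Z. msa ar Y Z \<Longrightarrow> delta (restr Z Y) = 1 \<Longrightarrow> \<mu> Y Z \<ge> 1"
  obtains X where "finite X" "ss X M" "infinite (cl M X)"
proof -
  interpret M: C0bar_struct ar M by (rule C0bar_struct_generic[OF L g])
  obtain i0 where i0: "\<And>i. ar i0 \<le> ar i" using ex_has_least_nat[of "\<lambda>_. True" _ ar] by auto
  define n where "n = ar i0"
  have n: "3 \<le> n" using L by (simp add: n_def language_def)
  define D :: "('i, nat) lstruct" where "D = \<lparr>univ = {..<n - 1}, rel = (\<lambda>i. {})\<rparr>"
  have DC: "D \<in> Cmu ar \<mu>" unfolding D_def by (rule discrete_Cmu[OF L]) simp
  hence D0: "D \<in> C0 ar" by (simp add: Cmu_def)
  note DD = C0D[OF D0]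
  interpret D: lang_struct ar D using L DD by unfold_locales
  have dlD: "dl D S = int (card S)" if "finite S" for S using D.dl_eq[OF that] by (simp add: ed_def D_def)
  obtain h where h: "embedding h D M" "ss (h ` univ D) M" using generic_realize[OF L g DC D0] .
  define X where "X = h ` univ D"
  have Xf: "finite X" "ss X M" using h DD by (auto simp: X_def)
  have Xu: "X \<subseteq> univ M" using Xf by (simp add: ss_def)
  have dX: "dim M X = int n - 1"
    using M.ss_dim_eq[OF Xf(2,1)] embedding_dl[OF L DD(1) M.str h(1) order_refl DD(2)] dlD[OF DD(2)] n
    by (simp add: X_def) (simp add: D_def)
  have "infinite (cl M X)"
  proof
    assume f: "finite (cl M X)"
    \<comment> \<open>A chain with indices up to \<open>T\<close> has \<open>T + 1\<close> points,
      one more than the supposedly finite closure.\<close>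
    define T where "T = card (cl M X)"
    \<comment> \<open>a single chain with no relations to copy\<close>
    define vt :: "unit \<Rightarrow> nat \<Rightarrow> nat" where "vt \<rho> j = n - 2 + j" for \<rho> j
    interpret G: gadget ar D "{..<n - 2}" "{..<n - 2}" i0 "{()}" "{()}" vt T "{} :: unit set"
      "\<lambda>_. i0" "\<lambda>_. {}" "\<lambda>_. {}" "\<lambda>L. int (card L)"
    proof unfold_locales
      show "D \<in> C0 ar" by (rule D0)
      show "{..<n - 2} \<subseteq> univ D" by (auto simp: D_def)
      show "vt \<rho> j \<in> univ D \<longleftrightarrow> j = 0 \<and> \<rho> \<in> {()}" for \<rho> j using n by (auto simp: D_def vt_def)
      show "int (card L) \<le> int (card L')" if "L \<subseteq> L'" "L' \<subseteq> {()}" for L L' :: "unit set"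
        using that by (simp add: card_mono finite_subset)
      have sub: "J = {} \<or> J = {()}" for J :: "unit set" by (cases "() \<in> J") auto
      show "int (card L) \<le> int (card (L \<inter> {()})) + int (card (L - {()})) - int (card {q \<in> {} :: unit set. fst ` {} \<subseteq> L})" for L :: "unit set"
        using sub[of L] by auto
      show "\<exists>L. K \<subseteq> L \<and> L \<subseteq> {()} \<and> int (card K) = int (card (L \<inter> {()})) + int (card (L - {()})) - int (card {q \<in> {} :: unit set. fst ` {} \<subseteq> L})" for K :: "unit set"
        using sub[of K] by (intro exI[of _ K]) auto
      show "dl D {..<n - 2} + int (card J) \<le> dl D U"
        if "U \<subseteq> univ D" "{..<n - 2} \<subseteq> U" "(\<lambda>\<rho>. vt \<rho> 0) ` J \<subseteq> U" for J :: "unit set" and U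
      proof -
        have fU: "finite U" using that DD(2) finite_subset by blast
        have "n - 2 + card J \<le> card U"
        proof (cases "J = {}")
          case True
          thus ?thesis using card_mono[OF fU that(2)] by simp
        next
          case False
          hence J: "J = {()}" using sub by auto
          hence "insert (n - 2) {..<n - 2} \<subseteq> U" using that(2,3) by (auto simp: vt_def)
          from card_mono[OF fU this] show ?thesis using J by simp
        qed
        thus ?thesis using fU by (simp add: dlD)
      qed
      show "\<exists>U. U \<subseteq> univ D \<and> {..<n - 2} \<subseteq> U \<and> (\<lambda>\<rho>. vt \<rho> 0) ` J \<subseteq> U \<and> dl D U \<le> dl D {..<n - 2} + int (card J)" for J :: "unit set"
      proof (cases "J = {}")
        case True
        thus ?thesis by (intro exI[of _ "{..<n - 2}"]) (auto simp: D_def)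
      next
        case False
        hence J: "J = {()}" using sub by auto
        show ?thesis using J n by (intro exI[of _ "{..<n - 1}"]) (auto simp: D_def[THEN arg_cong[of _ _ univ]] vt_def dlD)
      qed
    qed (use L n in \<open>auto simp: vt_def n_def\<close>)
    have BC: "G.B1 \<in> Cmu ar \<mu>"
    proof (rule G.B1_Cmu[OF DC i0 _ mu2 mu1])
      show "vt \<rho> 0 \<notin> e" if "e \<in> rel D i0" for \<rho> e using that by (simp add: D_def)
    qed
    have "restr G.B1 (univ D) = D" using G.restr_B1[OF order_refl] DD(1) by simp
    hence "embedding h (restr G.B1 (univ D)) M" using h(1) by simp
    from generic_extend[OF g BC G.ss_B1 this h(2)] obtain g1
      where g1: "embedding g1 G.B1 M" "\<forall>a\<in>univ D. g1 a = h a" "ss (g1 ` univ G.B1) M" .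
    obtain V where V: "V \<subseteq> univ G.B1" "{..<n - 2} \<subseteq> V" "(\<lambda>\<rho>. vt \<rho> 0) ` {()} \<subseteq> V" "G.vx ` ({()} \<times> {..T}) \<subseteq> V"
      "dl G.B1 V \<le> dl D {..<n - 2} + int (card {()})"
      using G.dl_le_r[OF order_refl] by (elim exE conjE)
    have fV: "finite V" using V(1) G.finB1 finite_subset by blast
    have dV: "dl M (g1 ` V) \<le> int n - 1"
      using embedding_dl[OF L G.str_B1 M.str g1(1) V(1) fV] V(5) n by (simp add: dlD)
    have "univ D \<subseteq> V"
    proof
      fix x assume "x \<in> univ D"
      hence "x < n - 2 \<or> x = n - 2" by (auto simp: D_def)
      thus "x \<in> V" using V(2,3) by (auto simp: vt_def)
    qed
    have "h ` univ D = g1 ` univ D" using g1(2) by auto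
    hence XV: "X \<subseteq> g1 ` V" using \<open>univ D \<subseteq> V\<close> by (auto simp: X_def)
    have gVu: "g1 ` V \<subseteq> univ M" by (rule embedding_subset[OF g1(1) V(1)])
    have "g1 ` V \<subseteq> cl M X"
    proof
      fix u assume u: "u \<in> g1 ` V"
      have "dim M (insert u X) \<le> dl M (g1 ` V)" using u XV gVu fV by (intro M.dim_le) auto
      moreover have "dim M X \<le> dim M (insert u X)" using u gVu Xu Xf by (intro M.dim_mono) auto
      ultimately show "u \<in> cl M X" using u gVu dV dX Xf by (auto simp: M.cl_iff)
    qed
    hence "card (g1 ` V) \<le> T" using f by (simp add: T_def card_mono)
    moreover have "card (g1 ` V) = card V"
      using inj_on_subset[OF embedding_inj[OF g1(1)] V(1)] by (rule card_image)
    moreover have "card (G.vx ` ({()} \<times> {..T})) \<le> card V" using V(4) fV by (intro card_mono)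
    moreover have "card (G.vx ` ({()} \<times> {..T})) = Suc T"
      using card_image[OF G.inj_vx] by (simp add: card_cartesian_product)
    ultimately show False by simp
  qed
  thus thesis using that Xf by blast
qed

theorem theorem3p1:
  fixes ar :: "'i \<Rightarrow> nat"
    and \<mu> :: "nat set \<Rightarrow> ('i, nat) lstruct \<Rightarrow> nat"
    and M :: "('i, 'a) lstruct"
    and M0 :: "('i, 'b) lstruct"
  assumes "language ar"
    and "mu_function ar \<mu>"
    and "free_amalgam_condition ar \<mu>"
    and "amalgamation_class ar (Cmu ar \<mu>)"
    and "\<And>Y Z. msa ar Y Z \<Longrightarrow> delta (restr Z Y) \<ge> 2 \<Longrightarrow> \<mu> Y Z \<ge> 2"
    and "\<And>Y Z. msa ar Y Z \<Longrightarrow> delta (restr Z Y) = 1 \<Longrightarrow> \<mu> Y Z \<ge> 1"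
    and "is_generic ar (Cmu ar \<mu>) M"
    and "is_generic ar (C0 ar) M0"
  shows "(\<forall>X. finite X \<and> ss X M \<and> infinite (cl M X) \<longrightarrow> geom_iso (geom_over M X) (geom M0)) \<and>
         (\<exists>X. finite X \<and> X \<subseteq> univ M \<and> geom_iso (geom_over M X) (geom M0))"
proof -
  interpret M: C0bar_struct ar M by (rule C0bar_struct_generic[OF assms(1,7)])
  interpret M0: C0bar_struct ar M0 by (rule C0bar_struct_generic[OF assms(1,8)])
  have ad: "admissible ar (Cmu ar \<mu>)" "admissible ar (C0 ar)"
    unfolding admissible_def using assms(5,6) by blast+
  \<comment> \<open>The geometry of \<open>M0\<close> is its localization over the empty set, so
    both sides have the form treated by \<open>geom_iso_generic\<close>.\<close>
  have "localization (pregeom_of M0) {} = pregeom_of M0"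
    by (simp add: localization_def pregeom_of_def)
  hence g0: "geom M0 = geom_over M0 {}" by (simp add: geom_def geom_over_def)
  have s0: "localized ar M0 {}" by unfold_locales (simp_all add: M0.ss_empty)
  have main: "geom_iso (geom_over M X) (geom M0)" if "finite X" "ss X M" "infinite (cl M X)" for X
  proof -
    have "localized ar M X" by unfold_locales (use that in auto)
    from geom_iso_generic[OF this s0 ad assms(7,8) that(3) infinite_cl_empty[OF assms(1,8)]]
    show ?thesis unfolding g0 .
  qed
  moreover obtain X where "finite X" "ss X M" "infinite (cl M X)"
    using exists_infinite_cl[OF assms(1,7,5,6)] .
  ultimately show ?thesis by (auto simp: ss_def)
qed

end
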